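(* Let $\alpha_1,\alpha_2\in(0,1)$, $c>0$, $n\ge1$, $p>1$, and assume that $s\mapsto\Psi(s)^{-1}=s^{(\alpha_2c+\alpha_1s)/(c+s)}$ is a Bernstein function on $(0,\infty)$. Let $X=L^1(\mathbb R^n)\cap L^\infty(\mathbb R^n)$ and let $u_0\in X$ be nonnegative and nontrivial, with $T_{\max}$ the maximal existence time of the corresponding nonnegative maximal mild solution. (i) If $1<p<1+2/n$, then $T_{\max}<\infty$. (ii) If $p=1+2/n$ and $\|u_0\|_1>(4\pi n)^{n/2}$, then $T_{\max}<\infty$. (iii) For every $p>1$ and every nonzero $0\le\varphi\in X$, the solution with initial datum $u_0=A\varphi$ blows up in finite time (its maximal existence time is finite) for all sufficiently large $A$.
   Context: A Bernstein function is a $C^\infty$ function $F:(0,\infty)\to[0,\infty)$ with $(-1)^{m-1}F^{(m)}\ge0$ for all $m\ge1$. $\Psi(z)=z^{-B(z)}$ with $B(z)=\frac{\alpha_2c+\alpha_1z}{c+z}$ (principal branch). The families are $S_{\mathcal A}(t)g=Z(t)*g$, $P_{\mathcal A}(t)g=Y(t)*g$, where, under the Bernstein condition, $Z(t)$ ($t>0$, weakly continuous in $t$) are probability measures and $Y(t)$ (a.e. $t>0$, measurable in $t$) are finite positive measures on $\mathbb R^n$ determined by $$\int_0^\infty e^{-zt}\int_{\mathbb R^n}e^{-ix\cdot\xi}Z(t,dx)\,dt=\frac{\Psi(z)^{-1}}{z(\Psi(z)^{-1}+|\xi|^2)},\qquad\int_0^\infty e^{-zt}\int_{\mathbb R^n}e^{-ix\cdot\xi}Y(t,dx)\,dt=\frac1{\Psi(z)^{-1}+|\xi|^2}\quad(z>0);$$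 $S_{\mathcal A}(0)=I$. A mild solution on $[0,T]$ is a function in $C([0,T];L^1(\mathbb R^n))\cap L^\infty((0,T);L^\infty(\mathbb R^n))$ satisfying $$u(t)=S_{\mathcal A}(t)u_0+\int_0^tP_{\mathcal A}(t-s)(u(s)_+)^p\,ds$$ in $L^1$ for every $t\in[0,T]$ and in $L^\infty$ for a.e. $t>0$ (this is the mild form of ${}^{S}D_0^{\alpha(t)}u=\Delta u+u^p$, $u(0)=u_0$, with $\alpha(t)=\alpha_2+(\alpha_1-\alpha_2)e^{-ct}$). For each $0\le u_0\in X$ there is a unique nonnegative maximal mild solution $u$ on $[0,T_{\max})$, $0<T_{\max}\le\infty$, i.e. one that is a mild solution on $[0,T]$ for all $T<T_{\max}$ and cannot be extended to a mild solution on a strictly larger interval. *)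

theory Defs
  imports "HOL-Probability.Probability"
begin

text \<open>
  Functions on \<open>\<real>\<^sup>n\<close> (with \<open>n = CARD('n)\<close>) stand for their classes modulo Lebesgue-null sets,
  and are always Borel representatives.
\<close>

definition bernstein_function :: "(real \<Rightarrow> real) \<Rightarrow> bool" where
  "bernstein_function F \<longleftrightarrow>
     (\<forall>s>0. 0 \<le> F s) \<and>
     (\<forall>m. \<forall>s>0. (deriv ^^ m) F differentiable (at s)) \<and>
     (\<forall>m\<ge>1. \<forall>s>0. 0 \<le> (-1) ^ (m - 1) * (deriv ^^ m) F s)"

definition Bfun :: "real \<Rightarrow> real \<Rightarrow> real \<Rightarrow> real \<Rightarrow> real" where
  "Bfun \<alpha>\<^sub>1 \<alpha>\<^sub>2 c z = (\<alpha>\<^sub>2 * c + \<alpha>\<^sub>1 * z) / (c + z)"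

text \<open>Only positive real arguments are needed; there the principal branch is the real power.\<close>

definition Psi :: "real \<Rightarrow> real \<Rightarrow> real \<Rightarrow> real \<Rightarrow> real" where
  "Psi \<alpha>\<^sub>1 \<alpha>\<^sub>2 c z = z powr (- Bfun \<alpha>\<^sub>1 \<alpha>\<^sub>2 c z)"

definition fourier_measure :: "(real ^ 'n) measure \<Rightarrow> real ^ 'n \<Rightarrow> complex" where
  "fourier_measure \<mu> \<xi> = (\<integral>x. exp (- \<i> * complex_of_real (x \<bullet> \<xi>)) \<partial>\<mu>)"

definition has_fourier_laplace ::
    "(real \<Rightarrow> (real ^ 'n) measure) \<Rightarrow> real ^ 'n \<Rightarrow> real \<Rightarrow> real \<Rightarrow> bool" where
  "has_fourier_laplace M \<xi> z r \<longleftrightarrow>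
     has_bochner_integral (lebesgue_on {0<..})
       (\<lambda>t. exp (- z * t) *\<^sub>R fourier_measure (M t) \<xi>) (complex_of_real r)"

definition Z_family ::
    "real \<Rightarrow> real \<Rightarrow> real \<Rightarrow> (real \<Rightarrow> (real ^ 'n) measure) \<Rightarrow> bool" where
  "Z_family \<alpha>\<^sub>1 \<alpha>\<^sub>2 c Z \<longleftrightarrow>
     (\<forall>t>0. prob_space (Z t) \<and> sets (Z t) = sets borel) \<and>
     (\<forall>f :: real ^ 'n \<Rightarrow> real. continuous_on UNIV f \<and> bounded (range f) \<longrightarrow>
        continuous_on {0<..} (\<lambda>t. \<integral>x. f x \<partial>Z t)) \<and>
     (\<forall>z>0. \<forall>\<xi>. has_fourier_laplace Z \<xi> z
        (inverse (Psi \<alpha>\<^sub>1 \<alpha>\<^sub>2 c z) / (z * (inverse (Psi \<alpha>\<^sub>1 \<alpha>\<^sub>2 c z) + (norm \<xi>)\<^sup>2))))"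

text \<open>
  The measures \<open>Y t\<close> matter only for almost every \<open>t\<close>, so measurability in \<open>t\<close> (here and in
  the Duhamel integral below) refers to the completed Lebesgue measure.
\<close>

definition Y_family ::
    "real \<Rightarrow> real \<Rightarrow> real \<Rightarrow> (real \<Rightarrow> (real ^ 'n) measure) \<Rightarrow> bool" where
  "Y_family \<alpha>\<^sub>1 \<alpha>\<^sub>2 c Y \<longleftrightarrow>
     (AE t in lebesgue_on {0<..}. finite_measure (Y t) \<and> sets (Y t) = sets borel) \<and>
     (\<forall>A\<in>sets borel. (\<lambda>t. emeasure (Y t) A) \<in> borel_measurable (lebesgue_on {0<..})) \<and>
     (\<forall>z>0. \<forall>\<xi>. has_fourier_laplace Y \<xi> z
        (1 / (inverse (Psi \<alpha>\<^sub>1 \<alpha>\<^sub>2 c z) + (norm \<xi>)\<^sup>2)))"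

definition measure_conv ::
    "(real ^ 'n) measure \<Rightarrow> (real ^ 'n \<Rightarrow> real) \<Rightarrow> real ^ 'n \<Rightarrow> real" where
  "measure_conv \<mu> g x = (\<integral>y. g (x - y) \<partial>\<mu>)"

definition S_op ::
    "(real \<Rightarrow> (real ^ 'n) measure) \<Rightarrow> real \<Rightarrow> (real ^ 'n \<Rightarrow> real) \<Rightarrow> real ^ 'n \<Rightarrow> real" where
  "S_op Z t g = (if t = 0 then g else measure_conv (Z t) g)"

definition P_op ::
    "(real \<Rightarrow> (real ^ 'n) measure) \<Rightarrow> real \<Rightarrow> (real ^ 'n \<Rightarrow> real) \<Rightarrow> real ^ 'n \<Rightarrow> real" where
  "P_op Y t g = measure_conv (Y t) g"

definition in_L1 :: "(real ^ 'n \<Rightarrow> real) \<Rightarrow> bool" where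
  "in_L1 f \<longleftrightarrow> integrable lborel f"

definition L1_norm :: "(real ^ 'n \<Rightarrow> real) \<Rightarrow> real" where
  "L1_norm f = (\<integral>x. \<bar>f x\<bar> \<partial>lborel)"

definition Linf_bound :: "(real ^ 'n \<Rightarrow> real) \<Rightarrow> real \<Rightarrow> bool" where
  "Linf_bound f M \<longleftrightarrow> f \<in> borel_measurable borel \<and> (AE x in lborel. \<bar>f x\<bar> \<le> M)"

definition in_X :: "(real ^ 'n \<Rightarrow> real) \<Rightarrow> bool" where
  "in_X f \<longleftrightarrow> in_L1 f \<and> (\<exists>M. Linf_bound f M)"

definition duhamel_integrand ::
    "real \<Rightarrow> (real \<Rightarrow> (real ^ 'n) measure) \<Rightarrow> (real \<Rightarrow> real ^ 'n \<Rightarrow> real) \<Rightarrow>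
     real \<Rightarrow> real ^ 'n \<Rightarrow> real \<Rightarrow> real" where
  "duhamel_integrand p Y u t x s = P_op Y (t - s) (\<lambda>y. (max 0 (u s y)) powr p) x"

text \<open>
  Every curve in \<open>C([0,T]; L\<^sup>1)\<close> has a representative that is jointly Borel measurable in
  \<open>(t, x)\<close>; only such representatives are considered. For them an \<open>L\<^sup>1\<close>-valued (Bochner) integral
  in time is represented by the integral in time taken separately at almost every \<open>x\<close>. The
  equation in \<open>L\<^sup>1\<close>, and for almost every \<open>t\<close> in \<open>L\<^sup>\<infinity>\<close>, is therefore an identity for almost
  every \<open>x\<close>; both sides lie in \<open>L\<^sup>1\<close> (and in \<open>L\<^sup>\<infinity>\<close> for almost every \<open>t\<close>) because
  \<open>u t\<close> does.
\<close>

definition mild_solution ::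
    "real \<Rightarrow> (real \<Rightarrow> (real ^ 'n) measure) \<Rightarrow> (real \<Rightarrow> (real ^ 'n) measure) \<Rightarrow>
     (real ^ 'n \<Rightarrow> real) \<Rightarrow> real \<Rightarrow> (real \<Rightarrow> real ^ 'n \<Rightarrow> real) \<Rightarrow> bool" where
  "mild_solution p Z Y u\<^sub>0 T u \<longleftrightarrow>
     (\<lambda>(t, x). u t x) \<in> borel_measurable (restrict_space borel {0..T} \<Otimes>\<^sub>M borel) \<and>
     (\<forall>t\<in>{0..T}. in_L1 (u t)) \<and>
     (\<forall>t\<in>{0..T}. ((\<lambda>s. L1_norm (\<lambda>x. u s x - u t x)) \<longlongrightarrow> 0) (at t within {0..T})) \<and>
     (\<exists>M. AE t in lborel. t \<in> {0<..<T} \<longrightarrow> Linf_bound (u t) M) \<and>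
     (\<forall>t\<in>{0..T}. AE x in lborel.
        set_integrable lebesgue {0..t} (duhamel_integrand p Y u t x) \<and>
        u t x = S_op Z t u\<^sub>0 x + (LINT s:{0..t}|lebesgue. duhamel_integrand p Y u t x s))"

text \<open>
  The interval of existence is \<open>[0,Tmax)\<close>, so a solution on the closed interval \<open>[0,Tmax]\<close>
  already counts as an extension.
\<close>

definition nonneg_maximal_mild_solution ::
    "real \<Rightarrow> (real \<Rightarrow> (real ^ 'n) measure) \<Rightarrow> (real \<Rightarrow> (real ^ 'n) measure) \<Rightarrow>
     (real ^ 'n \<Rightarrow> real) \<Rightarrow> ereal \<Rightarrow> (real \<Rightarrow> real ^ 'n \<Rightarrow> real) \<Rightarrow> bool" where
  "nonneg_maximal_mild_solution p Z Y u\<^sub>0 Tmax u \<longleftrightarrow>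
     0 < Tmax \<and>
     (\<forall>t\<ge>0. ereal t < Tmax \<longrightarrow> (AE x in lborel. 0 \<le> u t x)) \<and>
     (\<forall>T>0. ereal T < Tmax \<longrightarrow> mild_solution p Z Y u\<^sub>0 T u) \<and>
     \<not> (\<exists>T v. Tmax \<le> ereal T \<and> mild_solution p Z Y u\<^sub>0 T v \<and>
            (\<forall>t\<ge>0. ereal t < Tmax \<longrightarrow> (AE x in lborel. v t x = u t x)))"

end

theory Submission
  imports Defs
begin

text \<open>
  For a global solution, put \<open>m = z \<integral>\<integral> e\<^sup>-\<^sup>z\<^sup>t G\<^sub>s(x) u(t, x) dx dt\<close> with the Gaussian \<open>G\<^sub>s\<close> of
  variance parameter \<open>s\<close>. The time Laplace transform of \<open>Y\<close> is the resolvent kernel of the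
  Laplacian at \<open>l = \<Psi>(z)\<^sup>-\<^sup>1\<close>, that of \<open>Z\<close> is \<open>l / z\<close> times it, and the resolvent maps \<open>G\<^sub>s\<close> to
  \<open>\<integral> e\<^sup>-\<^sup>l\<^sup>r G\<^sub>s\<^sub>+\<^sub>r dr \<ge> G\<^sub>s / (l + n / (2 s))\<close>. Testing the mild equation thus gives
  \<open>l \<integral> G\<^sub>s u\<^sub>0 + m\<^sup>p \<le> (l + n / (2 s)) m\<close>, which bounds \<open>\<integral> G\<^sub>s u\<^sub>0\<close> by a multiple of
  \<open>(l + n / (2 s))\<^sup>p\<^sup>/\<^sup>(\<^sup>p\<^sup>-\<^sup>1\<^sup>) / l\<close> once \<open>m\<close> is finite. Taking \<open>s = 1 / l\<close> and \<open>z \<rightarrow> 0\<close> settles (i)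
  and (ii), and \<open>z = s = 1\<close> settles (iii).

  To see that \<open>m\<close> is finite, replace \<open>G\<^sub>s\<close> by \<open>\<psi> = \<integral> e\<^sup>-\<^sup>r\<^sup>/\<^sup>2 G\<^sub>s\<^sub>+\<^sub>r dr\<close>, which the resolvent maps to
  something comparable with \<open>\<psi>\<close> from both sides. Hence \<open>\<integral>\<^sub>0\<^sup>\<epsilon> Y(t) * \<psi> dt \<ge> c \<epsilon>\<^sup>2 \<psi>\<close>, and
  \<open>F(t) = \<integral>\<^sub>0\<^sup>t \<integral> \<psi> u\<close> satisfies \<open>F(t + \<epsilon>) \<ge> c' \<epsilon>\<^sup>2 t\<^sup>1\<^sup>-\<^sup>p F(t)\<^sup>p\<close>, so that faster than linear growth
  of \<open>F\<close> would lead to blow-up of \<open>F\<close>.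
\<close>

section \<open>Kernels of finite measures\<close>

text \<open>The bound on the datum appears only after the integral of \<open>V powr p\<close> is
  cancelled from both sides, which is void if that term is infinite. Mild solutions are controlled
  on bounded time intervals only, so finiteness of the Laplace transform is the main obstacle.
  Nothing is known about \<open>Y\<close> pointwise in time; the one handle is its transform. A
  lower bound on a window of length \<epsilon> therefore has to be the transform at a large
  \<open>z\<close> minus its tail beyond \<epsilon>, and the tail must be bounded above by the same
  test function. A Gaussian fails here, since G_{s+r} / G_s is unbounded in \<open>x\<close> for r >
  0, whereas shifting r by q in its potential of rate 1/2 costs at most a factor exp(q/2). The rate
  1/2 lies below \<open>l (z / 2)\<close>, which is at least 1 once \<open>z \<ge> 2\<close>. With
  \<open>l z \<le> z\<close> and \<open>z\<close> of order 1/\<epsilon>^2 the tail is exponentially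
  small and mass of order \<epsilon>^2 survives; superlinear growth absorbs this polynomial loss.
  Test integrals take values in the nonnegative extended reals, so Tonelli and duality need no
  integrability; finiteness matters only at the cancellations.\<close>

definition borel_kernel :: "(real \<Rightarrow> 'a::euclidean_space measure) \<Rightarrow> bool" where
  "borel_kernel M \<longleftrightarrow>
     (\<forall>t. finite_measure (M t) \<and> sets (M t) = sets borel) \<and>
     (\<forall>A\<in>sets borel. (\<lambda>t. emeasure (M t) A) \<in> borel_measurable borel)"

lemma borel_kernelD:
  assumes "borel_kernel M"
  shows "finite_measure (M t)" "sets (M t) = sets borel" "space (M t) = UNIV"
    "A \<in> sets borel \<Longrightarrow> (\<lambda>t. emeasure (M t) A) \<in> borel_measurable borel"
  using assms sets_eq_imp_space_eq[of "M t" borel] by (auto simp: borel_kernel_def)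

text \<open>
  The measurability theory of the library concerns subprobability kernels. Dividing by one plus the
  total mass reduces finite kernels to that case without a case distinction at mass zero.
\<close>

definition normalized_kernel :: "(real \<Rightarrow> 'a::euclidean_space measure) \<Rightarrow> real \<Rightarrow> 'a measure" where
  "normalized_kernel M t = scale_measure (inverse (1 + emeasure (M t) UNIV)) (M t)"

lemma ennreal_one_plus_inverse:
  fixes w :: ennreal
  assumes "w \<noteq> \<infinity>"
  shows "(1 + w) * inverse (1 + w) = 1"
proof -
  have "1 + w \<noteq> 0" "1 + w < top" using assms by (auto simp: less_top)
  then show ?thesis
    by (metis divide_ennreal_def ennreal_divide_self)
qed

lemma subprob_space_normalized_kernel:
  assumes "finite_measure (M t)" "sets (M t) = sets borel"
  shows "subprob_space (normalized_kernel M t)"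
proof
  have sp: "space (M t) = UNIV"
    using sets_eq_imp_space_eq[OF assms(2)] by simp
  have w: "emeasure (M t) UNIV \<noteq> \<infinity>"
    using finite_measure.emeasure_finite[OF assms(1)] by (simp add: less_top)
  have "inverse (1 + emeasure (M t) UNIV) * emeasure (M t) UNIV
      \<le> inverse (1 + emeasure (M t) UNIV) * (1 + emeasure (M t) UNIV)"
    by (intro mult_left_mono) auto
  also have "\<dots> = 1" using ennreal_one_plus_inverse[OF w] by (simp add: mult.commute)
  finally show "emeasure (normalized_kernel M t) (space (normalized_kernel M t)) \<le> 1"
    by (simp add: normalized_kernel_def space_scale_measure sp)
  show "space (normalized_kernel M t) \<noteq> {}"
    by (simp add: normalized_kernel_def space_scale_measure sp)
qed

lemma nn_integral_normalized_kernel: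
  assumes "finite_measure (M t)" "sets (M t) = sets borel" "f \<in> borel_measurable borel"
  shows "(\<integral>\<^sup>+y. f y \<partial>M t) =
    (1 + emeasure (M t) UNIV) * (\<integral>\<^sup>+y. f y \<partial>normalized_kernel M t)"
proof -
  have w: "emeasure (M t) UNIV \<noteq> \<infinity>"
    using finite_measure.emeasure_finite[OF assms(1)] by (simp add: less_top)
  have "f \<in> borel_measurable (M t)"
    using assms(2,3) measurable_cong_sets by blast
  then show ?thesis
    using ennreal_one_plus_inverse[OF w]
    by (simp add: normalized_kernel_def nn_integral_scale_measure mult.assoc[symmetric])
qed

lemma emeasure_normalized_kernel:
  assumes "finite_measure (M t)"
  shows "emeasure (M t) A =
    (1 + emeasure (M t) UNIV) * emeasure (normalized_kernel M t) A"
proof -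
  have w: "emeasure (M t) UNIV \<noteq> \<infinity>"
    using finite_measure.emeasure_finite[OF assms(1)] by (simp add: less_top)
  show ?thesis
    using ennreal_one_plus_inverse[OF w]
    by (simp add: normalized_kernel_def mult.assoc[symmetric])
qed

text \<open>A Dynkin argument reduces measurability of the kernel to an intersection-stable
  generator. The total mass is a separate assumption because it is also the normalizing
  factor.\<close>

lemma normalized_kernel_generated:
  fixes M :: "real \<Rightarrow> 'a::euclidean_space measure"
  assumes fin: "\<And>t. finite_measure (M t)" and sets: "\<And>t. sets (M t) = sets borel"
    and G: "sets (borel :: 'a measure) = sigma_sets UNIV G" "Int_stable G"
    and meas: "\<And>A. A \<in> G \<Longrightarrow> (\<lambda>t. emeasure (M t) A) \<in> borel_measurable borel"
    and top[measurable]: "(\<lambda>t. emeasure (M t) UNIV) \<in> borel_measurable borel"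
  shows "normalized_kernel M \<in> borel \<rightarrow>\<^sub>M subprob_algebra borel"
proof (rule measurable_subprob_algebra_generated[OF G])
  show "G \<subseteq> Pow UNIV" by auto
  show "subprob_space (normalized_kernel M t)" for t
    by (intro subprob_space_normalized_kernel fin sets)
  show "sets (normalized_kernel M t) = sets borel" for t
    by (simp add: normalized_kernel_def sets)
  show "(\<lambda>t. emeasure (normalized_kernel M t) A) \<in> borel_measurable borel" if "A \<in> G" for A
    unfolding normalized_kernel_def using meas[OF that] by simp
  show "(\<lambda>t. emeasure (normalized_kernel M t) UNIV) \<in> borel_measurable borel"
    unfolding normalized_kernel_def by simp
qed

lemma normalized_kernel_measurable:
  assumes "borel_kernel M"
  shows "normalized_kernel M \<in> borel \<rightarrow>\<^sub>M subprob_algebra borel"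
  using borel_kernelD[OF assms]
  by (intro normalized_kernel_generated[where G="sets borel"])
    (auto simp: sets.sigma_sets_eq[of borel, simplified] Int_stable_def)

text \<open>The freedom in \<open>G\<close> is what makes both families accessible: a countable
  generator suits almost-everywhere information in \<open>t\<close>, and closed sets suit weak
  continuity in \<open>t\<close>.\<close>

lemma borel_kernelI_generated:
  fixes M :: "real \<Rightarrow> 'a::euclidean_space measure"
  assumes fin: "\<And>t. finite_measure (M t)" and sets: "\<And>t. sets (M t) = sets borel"
    and G: "sets (borel :: 'a measure) = sigma_sets UNIV G" "Int_stable G"
    and meas: "\<And>A. A \<in> G \<Longrightarrow> (\<lambda>t. emeasure (M t) A) \<in> borel_measurable borel"
    and top[measurable]: "(\<lambda>t. emeasure (M t) UNIV) \<in> borel_measurable borel"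
  shows "borel_kernel M"
  unfolding borel_kernel_def
proof (intro conjI allI ballI fin sets)
  fix A :: "'a set" assume A: "A \<in> sets borel"
  have [measurable]: "normalized_kernel M \<in> borel \<rightarrow>\<^sub>M subprob_algebra borel"
    using assms by (rule normalized_kernel_generated)
  have "(\<lambda>t. emeasure (normalized_kernel M t) A) \<in> borel_measurable borel"
    using A by (rule measurable_emeasure_kernel[rotated]) measurable
  then have "(\<lambda>t. (1 + emeasure (M t) UNIV) * emeasure (normalized_kernel M t) A)
      \<in> borel_measurable borel" by measurable
  then show "(\<lambda>t. emeasure (M t) A) \<in> borel_measurable borel"
    by (subst emeasure_normalized_kernel[OF fin])
qed

lemma measurable_nn_integral_kernel:
  assumes M: "borel_kernel M" and [measurable]: "\<tau> \<in> N \<rightarrow>\<^sub>M borel"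
    and f: "(\<lambda>(x, y). f x y) \<in> borel_measurable (N \<Otimes>\<^sub>M borel)"
  shows "(\<lambda>x. \<integral>\<^sup>+y. f x y \<partial>M (\<tau> x)) \<in> borel_measurable N"
proof -
  have w[measurable]: "(\<lambda>t. emeasure (M t) UNIV) \<in> borel_measurable borel"
    using borel_kernelD(4)[OF M] by simp
  have [measurable]: "(\<lambda>x. emeasure (M (\<tau> x)) UNIV) \<in> borel_measurable N"
    using measurable_compose[OF assms(2) w] .
  have [measurable]: "(\<lambda>x. \<integral>\<^sup>+y. f x y \<partial>normalized_kernel M (\<tau> x)) \<in> borel_measurable N"
    using f measurable_compose[OF assms(2) normalized_kernel_measurable[OF M]]
    by (rule nn_integral_measurable_subprob_algebra2)
  have "(\<lambda>x. (1 + emeasure (M (\<tau> x)) UNIV) * (\<integral>\<^sup>+y. f x y \<partial>normalized_kernel M (\<tau> x)))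
      \<in> borel_measurable N"
    by measurable
  moreover have "(\<integral>\<^sup>+y. f x y \<partial>M (\<tau> x)) =
      (1 + emeasure (M (\<tau> x)) UNIV) * (\<integral>\<^sup>+y. f x y \<partial>normalized_kernel M (\<tau> x))"
    if "x \<in> space N" for x
    using measurable_Pair2[OF f that] borel_kernelD(1,2)[OF M]
    by (intro nn_integral_normalized_kernel) auto
  ultimately show ?thesis
    by (simp cong: measurable_cong)
qed

text \<open>The mixture of the measures \<open>M t\<close> with weight \<rho>(t) dt, obtained as a
  monadic bind of the normalized kernel over a density that carries the removed masses. With an
  exponential weight on \<open>t > 0\<close> it yields the resolvent measures.\<close>

lemma kernel_mixture:
  fixes M :: "real \<Rightarrow> 'a::euclidean_space measure"
  assumes M: "borel_kernel M" and [measurable]: "\<rho> \<in> borel_measurable borel"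
  obtains R where "sets R = sets (borel :: 'a measure)"
    "\<And>f. f \<in> borel_measurable borel \<Longrightarrow>
       (\<integral>\<^sup>+y. f y \<partial>R) = (\<integral>\<^sup>+t. \<rho> t * (\<integral>\<^sup>+y. f y \<partial>M t) \<partial>lborel)"
proof
  note [measurable] = normalized_kernel_measurable[OF M]
  have [measurable]: "(\<lambda>t. emeasure (M t) UNIV) \<in> borel_measurable borel"
    using borel_kernelD(4)[OF M] by simp
  let ?D = "density lborel (\<lambda>t. \<rho> t * (1 + emeasure (M t) UNIV))"
  let ?R = "?D \<bind> normalized_kernel M"
  have K: "normalized_kernel M \<in> ?D \<rightarrow>\<^sub>M subprob_algebra borel"
    by simp
  show "sets ?R = sets borel"
    by (rule sets_bind[OF sets_kernel[OF K]]) auto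
  fix f :: "'a \<Rightarrow> ennreal" assume f[measurable]: "f \<in> borel_measurable borel"
  have [measurable]: "(\<lambda>t. \<integral>\<^sup>+y. f y \<partial>normalized_kernel M t) \<in> borel_measurable borel"
    by (rule nn_integral_measurable_subprob_algebra2) measurable
  show "(\<integral>\<^sup>+y. f y \<partial>?R) = (\<integral>\<^sup>+t. \<rho> t * (\<integral>\<^sup>+y. f y \<partial>M t) \<partial>lborel)"
    by (subst nn_integral_bind[OF f K], subst nn_integral_density, simp, simp)
      (simp add: mult.assoc nn_integral_normalized_kernel[of M, OF borel_kernelD(1,2)[OF M] f])
qed

lemma nn_integral_kernel_swap:
  fixes M :: "real \<Rightarrow> 'a::euclidean_space measure"
  assumes M: "borel_kernel M" and N: "sigma_finite_measure N"
    and f: "(\<lambda>(x, y). f x y) \<in> borel_measurable (N \<Otimes>\<^sub>M borel)"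
  shows "(\<integral>\<^sup>+x. \<integral>\<^sup>+y. f x y \<partial>M t \<partial>N) = (\<integral>\<^sup>+y. \<integral>\<^sup>+x. f x y \<partial>N \<partial>M t)"
proof -
  interpret Mt: finite_measure "M t" by (rule borel_kernelD(1)[OF M])
  interpret N: sigma_finite_measure N by fact
  interpret pair_sigma_finite "M t" N ..
  have "(\<lambda>(y, x). f x y) \<in> borel_measurable (borel \<Otimes>\<^sub>M N)"
    using measurable_comp[OF measurable_pair_swap' f] by (simp add: comp_def case_prod_beta)
  then have "(\<lambda>(y, x). f x y) \<in> borel_measurable (M t \<Otimes>\<^sub>M N)"
    by (subst measurable_cong_sets[OF sets_pair_measure_cong[OF borel_kernelD(2)[OF M] refl] refl])
  then show ?thesis
    by (rule Fubini')
qed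

section \<open>The Gaussian and its Fourier transform\<close>

text \<open>A rescaling by \<open>sqrt (2 * s)\<close> of the characteristic function of the
  standard normal distribution.\<close>

lemma gaussian_fourier_real:
  fixes a s :: real
  assumes s: "0 < s"
  shows "integrable lborel (\<lambda>b. iexp (a * b) * complex_of_real (exp (- s * b\<^sup>2)))" (is ?I)
    and "(\<integral>b. iexp (a * b) * complex_of_real (exp (- s * b\<^sup>2)) \<partial>lborel) =
      complex_of_real (sqrt (pi / s) * exp (- a\<^sup>2 / (4 * s)))" (is ?E)
proof -
  define t where "t = a / sqrt (2 * s)"
  have nz: "sqrt (2 * s) \<noteq> 0" and sq: "(sqrt (2 * s))\<^sup>2 = 2 * s" using s by auto
  let ?f = "\<lambda>x. std_normal_density x *\<^sub>R iexp (t * x)"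
  have prob: "prob_space std_normal_distribution"
    by (rule prob_space_normal_density) simp
  interpret prob_space std_normal_distribution by fact
  have "integrable std_normal_distribution (\<lambda>x. iexp (t * x))"
    by (rule integrable_const_bound[where B=1]) auto
  then have "integrable lborel ?f"
    by (subst (asm) integrable_density) auto
  moreover have "integral\<^sup>L lborel ?f = complex_of_real (exp (- (t\<^sup>2) / 2))"
    using fun_cong[OF char_std_normal_distribution, of t]
    unfolding char_def by (subst (asm) integral_density) auto
  ultimately have "has_bochner_integral lborel ?f (complex_of_real (exp (- (t\<^sup>2) / 2)))"
    by (simp add: has_bochner_integral_iff)
  then have "has_bochner_integral lborel (\<lambda>b. ?f (0 + sqrt (2 * s) * b))
      (complex_of_real (exp (- (t\<^sup>2) / 2)) /\<^sub>R \<bar>sqrt (2 * s)\<bar>)"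
    by (subst (asm) lborel_has_bochner_integral_real_affine_iff[OF nz, where t=0]) simp
  also have "(\<lambda>b. ?f (0 + sqrt (2 * s) * b)) =
      (\<lambda>b. (1 / sqrt (2 * pi)) *\<^sub>R (iexp (a * b) * complex_of_real (exp (- s * b\<^sup>2))))"
    using nz sq by (auto simp: t_def std_normal_density_def scaleR_conv_of_real power_mult_distrib
        simp del: real_sqrt_mult)
  finally have *: "has_bochner_integral lborel
      (\<lambda>b. sqrt (2 * pi) *\<^sub>R (1 / sqrt (2 * pi)) *\<^sub>R
        (iexp (a * b) * complex_of_real (exp (- s * b\<^sup>2))))
      (sqrt (2 * pi) *\<^sub>R (complex_of_real (exp (- (t\<^sup>2) / 2)) /\<^sub>R \<bar>sqrt (2 * s)\<bar>))"
    by (intro has_bochner_integral_scaleR_right)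
  have "sqrt (2 * pi) *\<^sub>R (complex_of_real (exp (- (t\<^sup>2) / 2)) /\<^sub>R \<bar>sqrt (2 * s)\<bar>) =
      complex_of_real (sqrt (pi / s) * exp (- a\<^sup>2 / (4 * s)))"
    using s by (simp add: scaleR_conv_of_real t_def power_divide real_sqrt_mult real_sqrt_divide
        field_simps)
  with * show ?I ?E
    by (simp_all add: has_bochner_integral_iff)
qed

text \<open>\<open>lborel\<close> on a Euclidean space is the image of a product of one-dimensional
  Lebesgue measures, and the integrand factors over \<open>Basis\<close>.\<close>

lemma gaussian_fourier:
  fixes x :: "'a::euclidean_space"
  assumes s: "0 < s"
  shows "integrable lborel (\<lambda>\<xi>. iexp (x \<bullet> \<xi>) * complex_of_real (exp (- s * (norm \<xi>)\<^sup>2)))" (is ?I)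
    and "(\<integral>\<xi>. iexp (x \<bullet> \<xi>) * complex_of_real (exp (- s * (norm \<xi>)\<^sup>2)) \<partial>lborel) =
      complex_of_real ((pi / s) powr (DIM('a) / 2) * exp (- (norm x)\<^sup>2 / (4 * s)))" (is ?E)
proof -
  interpret product_sigma_finite "\<lambda>b::'a. lborel :: real measure" ..
  let ?g = "\<lambda>(b::'a) \<beta>. iexp ((x \<bullet> b) * \<beta>) * complex_of_real (exp (- s * \<beta>\<^sup>2))"
  let ?f = "\<lambda>\<xi>. iexp (x \<bullet> \<xi>) * complex_of_real (exp (- s * (norm \<xi>)\<^sup>2))"
  let ?T = "\<lambda>f. \<Sum>b\<in>Basis. f b *\<^sub>R b :: 'a"
  have [measurable]: "?T \<in> (\<Pi>\<^sub>M b\<in>Basis. lborel) \<rightarrow>\<^sub>M borel" by measurable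
  have eq: "?f (?T f) = (\<Prod>b\<in>Basis. ?g b (f b))" for f
  proof -
    have "x \<bullet> ?T f = (\<Sum>b\<in>Basis. (x \<bullet> b) * f b)"
      by (simp add: inner_sum_right mult.commute)
    moreover have "(norm (?T f))\<^sup>2 = (\<Sum>b\<in>Basis. (f b)\<^sup>2)"
      by (simp add: norm_eq_sqrt_inner inner_sum_left inner_sum_right inner_Basis sum.delta'
          if_distrib power2_eq_square cong: if_cong sum.cong)
        (simp add: sum_nonneg)
    ultimately show ?thesis
      by (simp add: prod.distrib exp_sum sum_distrib_left of_real_sum flip: of_real_prod sum_negf)
  qed
  have I: "integrable (\<Pi>\<^sub>M b\<in>Basis. lborel) (\<lambda>f. \<Prod>b\<in>Basis. ?g b (f b))"
    by (intro product_integrable_prod gaussian_fourier_real s) simp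
  show ?I
    unfolding lborel_eq[where 'a='a] by (subst integrable_distr_eq) (use I eq in simp_all)
  have "integral\<^sup>L lborel ?f = (\<integral>f. (\<Prod>b\<in>Basis. ?g b (f b)) \<partial>(\<Pi>\<^sub>M b\<in>Basis. lborel))"
    unfolding lborel_eq[where 'a='a] by (subst integral_distr) (use eq in simp_all)
  also have "\<dots> = (\<Prod>b\<in>Basis. integral\<^sup>L lborel (?g b))"
    by (intro product_integral_prod gaussian_fourier_real s) simp
  also have "\<dots> = (\<Prod>b\<in>(Basis :: 'a set). complex_of_real (sqrt (pi / s) * exp (- (x \<bullet> b)\<^sup>2 / (4 * s))))"
    by (intro prod.cong refl gaussian_fourier_real s)
  also have "\<dots> = complex_of_real (sqrt (pi / s) ^ DIM('a) * exp (\<Sum>b\<in>(Basis :: 'a set). - (x \<bullet> b)\<^sup>2 / (4 * s)))"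
    by (simp add: prod.distrib exp_sum)
  also have "(\<Sum>b\<in>(Basis :: 'a set). - (x \<bullet> b)\<^sup>2 / (4 * s)) = - (norm x)\<^sup>2 / (4 * s)"
    unfolding norm_eq_sqrt_inner euclidean_inner[of x x]
    by (simp add: sum_nonneg power2_eq_square sum_negf sum_divide_distrib)
  also have "sqrt (pi / s) ^ DIM('a) = (pi / s) powr (DIM('a) / 2)"
    using s by (simp add: powr_half_sqrt[symmetric] powr_powr flip: powr_realpow)
  finally show ?E .
qed

text \<open>The heat kernel at time \<open>s\<close>: it has mass one and Fourier transform exp(-s
  |\<xi>|^2).\<close>

definition gauss :: "real \<Rightarrow> 'a::euclidean_space \<Rightarrow> real" where
  "gauss s x = (4 * pi * s) powr (- (real DIM('a) / 2)) * exp (- (norm x)\<^sup>2 / (4 * s))"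

lemma gauss_pos: "0 < s \<Longrightarrow> 0 < gauss s x"
  by (simp add: gauss_def)

lemma gauss_nonneg: "0 \<le> gauss s x"
  by (simp add: gauss_def)

lemma borel_measurable_gauss[measurable (raw)]:
  assumes [measurable]: "f \<in> borel_measurable N" "g \<in> N \<rightarrow>\<^sub>M borel"
  shows "(\<lambda>w. gauss (f w) (g w :: 'a::euclidean_space)) \<in> borel_measurable N"
  unfolding gauss_def by measurable

text \<open>Writing the Gaussian as an inverse Fourier integral means that testing a measure with it
  involves only the Fourier transform of that measure, so no uniqueness theorem for transforms is
  called upon later.\<close>

lemma gauss_inverse_fourier:
  fixes x :: "'a::euclidean_space"
  assumes s: "0 < s"
  shows "complex_of_real (gauss s x) = complex_of_real ((2 * pi) powr (- real DIM('a))) *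
    (\<integral>\<xi>. iexp (x \<bullet> \<xi>) * complex_of_real (exp (- s * (norm \<xi>)\<^sup>2)) \<partial>lborel)"
proof -
  let ?n = "real DIM('a)"
  have "(2 * pi) powr (- ?n) * (pi / s) powr (?n / 2) = (4 * pi * s) powr (- (?n / 2))"
  proof -
    have "(2 * pi) powr (- ?n) = ((2 * pi) powr 2) powr (- (?n / 2))"
      by (subst powr_powr) simp
    also have "(2 * pi) powr 2 = (4 * pi * s) * (pi / s)"
      using s by (simp add: power2_eq_square)
    also have "\<dots> powr (- (?n / 2)) = (4 * pi * s) powr (- (?n / 2)) * (pi / s) powr (- (?n / 2))"
      by (rule powr_mult)
    finally show ?thesis using s by (simp add: powr_minus)
  qed
  then show ?thesis
    unfolding gaussian_fourier(2)[OF s] gauss_def by (simp flip: of_real_mult mult.assoc)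
qed

lemma gauss_integral:
  assumes s: "0 < s"
  shows "(\<integral>\<^sup>+x. ennreal (gauss s (x :: 'a::euclidean_space)) \<partial>lborel) = 1"
proof -
  let ?n = "real DIM('a)" and ?f = "\<lambda>x::'a. exp (- (1 / (4 * s)) * (norm x)\<^sup>2)"
  have s': "0 < 1 / (4 * s)" using s by simp
  have I: "integrable lborel ?f"
    using integrable_norm[OF gaussian_fourier(1)[OF s', of "0::'a"]] by (simp add: norm_mult)
  have "complex_of_real (integral\<^sup>L lborel ?f) = (\<integral>x. complex_of_real (?f x) \<partial>lborel)"
    by (rule integral_complex_of_real[symmetric])
  also have "\<dots> = complex_of_real ((pi / (1 / (4 * s))) powr (?n / 2))"
    using gaussian_fourier(2)[OF s', of "0::'a"] by simp
  finally have E: "integral\<^sup>L lborel ?f = (4 * pi * s) powr (?n / 2)"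
    by (simp only: of_real_eq_iff) (simp add: mult_ac)
  have "(\<integral>\<^sup>+x. ennreal (gauss s (x :: 'a)) \<partial>lborel) =
      (\<integral>\<^sup>+x. ennreal ((4 * pi * s) powr (- (?n / 2)) * ?f x) \<partial>lborel)"
    by (simp add: gauss_def)
  also have "\<dots> = ennreal (\<integral>x. (4 * pi * s) powr (- (?n / 2)) * ?f x \<partial>lborel)"
    by (intro nn_integral_eq_integral integrable_mult_right I) auto
  also have "\<dots> = 1"
    unfolding integral_mult_right_zero E using s by (simp add: powr_minus)
  finally show ?thesis .
qed

text \<open>Enlarging \<open>s\<close> improves the exponential factor; only the normalization
  loses, by (s / (s + r))^(n/2), and 1 + r/s \<le> exp(r/s) bounds this loss by exp(-n r / (2 s)).
  This is the origin of the rate n / (2 s) throughout.\<close>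

lemma gauss_add_ge:
  fixes x :: "'a::euclidean_space"
  assumes s: "0 < s" and r: "0 \<le> r"
  shows "exp (- (real DIM('a) / (2 * s)) * r) * gauss s x \<le> gauss (s + r) x"
proof -
  let ?n = "real DIM('a)"
  have "(s + r) / s \<le> exp (r / s)"
    using exp_ge_add_one_self[of "r / s"] s by (simp add: field_simps)
  then have "((s + r) / s) powr (?n / 2) \<le> exp (r / s) powr (?n / 2)"
    using s r by (intro powr_mono2) auto
  then have "(s + r) powr (?n / 2) \<le> s powr (?n / 2) * exp ((?n / (2 * s)) * r)"
  proof -
    have "exp (r / s) powr (?n / 2) = exp ((?n / (2 * s)) * r)"
      by (simp add: powr_def mult_ac)
    moreover have "((s + r) / s) powr (?n / 2) = (s + r) powr (?n / 2) / s powr (?n / 2)"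
      by (rule powr_divide)
    moreover have "0 < s powr (?n / 2)" using s by simp
    ultimately show ?thesis
      using \<open>((s + r) / s) powr (?n / 2) \<le> _\<close> by (simp add: pos_divide_le_eq mult.commute)
  qed
  then have "exp (- (?n / (2 * s)) * r) * s powr (- (?n / 2)) \<le> (s + r) powr (- (?n / 2))"
    using s r by (simp add: powr_minus exp_minus field_simps)
  then have "exp (- (?n / (2 * s)) * r) * (4 * pi * s) powr (- (?n / 2))
      \<le> (4 * pi * (s + r)) powr (- (?n / 2))"
    using s r by (simp add: powr_mult mult.left_commute)
  moreover have "exp (- (norm x)\<^sup>2 / (4 * s)) \<le> exp (- (norm x)\<^sup>2 / (4 * (s + r)))"
    using s r by (simp add: frac_le)
  ultimately have "(exp (- (?n / (2 * s)) * r) * (4 * pi * s) powr (- (?n / 2))) *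
      exp (- (norm x)\<^sup>2 / (4 * s)) \<le>
      (4 * pi * (s + r)) powr (- (?n / 2)) * exp (- (norm x)\<^sup>2 / (4 * (s + r)))"
    by (intro mult_mono) auto
  then show ?thesis unfolding gauss_def by (simp add: mult.assoc)
qed

section \<open>Resolvent measures of the Laplacian\<close>

lemma nn_integral_exp_decay:
  assumes a: "0 < a"
  shows "(\<integral>\<^sup>+r\<in>{0<..}. ennreal (exp (- a * r)) \<partial>lborel) = ennreal (1 / a)"
proof -
  have "(\<integral>\<^sup>+r\<in>{0<..}. ennreal (exp (- a * r)) \<partial>lborel) =
      (\<integral>\<^sup>+r. ennreal (exp (- a * r)) * indicator {0..} r \<partial>lborel)"
    using AE_lborel_singleton[of "0::real"]
    by (intro nn_integral_cong_AE) (auto elim!: eventually_mono simp: indicator_def)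
  also have "\<dots> = ennreal (0 - (- exp (- a * 0) / a))"
  proof (rule nn_integral_FTC_atLeast[where F="\<lambda>r. - exp (- a * r) / a"])
    show "((\<lambda>r. - exp (- a * r) / a) has_real_derivative exp (- a * x)) (at x)" for x
      using a by (auto intro!: derivative_eq_intros)
    have "((\<lambda>r. exp (- a * r)) \<longlongrightarrow> 0) at_top"
      using a by (intro filterlim_compose[OF exp_at_bot] filterlim_tendsto_neg_mult_at_bot[OF tendsto_const]
          filterlim_ident) auto
    from tendsto_divide[OF tendsto_minus[OF this] tendsto_const, of a]
    show "((\<lambda>r. - exp (- a * r) / a) \<longlongrightarrow> 0) at_top" using a by simp
  qed auto
  finally show ?thesis by simp
qed

text \<open>Finiteness of \<open>R\<close>, the uniform bound on \<open>h\<close> and the integrable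
  Gaussian weight give absolute convergence. The statement is general in \<open>R\<close> because it
  is applied both to a measure on space and to an exponential law on the half-line.\<close>

lemma fubini_gaussian_weight:
  fixes h :: "'b \<Rightarrow> 'a::euclidean_space \<Rightarrow> complex"
  assumes R: "finite_measure R" and s: "0 < s"
    and h[measurable]: "(\<lambda>(y, \<xi>). h y \<xi>) \<in> borel_measurable (R \<Otimes>\<^sub>M borel)"
    and bound: "\<And>y \<xi>. norm (h y \<xi>) \<le> 1"
  shows "(\<integral>y. (\<integral>\<xi>. h y \<xi> * complex_of_real (exp (- s * (norm \<xi>)\<^sup>2)) \<partial>lborel) \<partial>R) =
    (\<integral>\<xi>. (\<integral>y. h y \<xi> \<partial>R) * complex_of_real (exp (- s * (norm \<xi>)\<^sup>2)) \<partial>lborel)"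
proof -
  interpret R: finite_measure R by fact
  interpret pair_sigma_finite R "lborel :: 'a measure" ..
  let ?e = "\<lambda>\<xi>::'a. complex_of_real (exp (- s * (norm \<xi>)\<^sup>2))"
  have e: "integrable lborel (\<lambda>\<xi>::'a. exp (- s * (norm \<xi>)\<^sup>2))"
    using integrable_norm[OF gaussian_fourier(1)[OF s, of "0::'a"]] by (simp add: norm_mult)
  have h': "(\<lambda>(y, \<xi>). h y \<xi>) \<in> borel_measurable (R \<Otimes>\<^sub>M lborel)" by simp
  have m[measurable]: "(\<lambda>(y, \<xi>). h y \<xi> * ?e \<xi>) \<in> borel_measurable (R \<Otimes>\<^sub>M lborel)"
    using h' by measurable
  have dom: "integrable (R \<Otimes>\<^sub>M lborel) (\<lambda>(y, \<xi>). h y \<xi> * ?e \<xi>)"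
  proof (rule Bochner_Integration.integrable_bound)
    show "integrable (R \<Otimes>\<^sub>M lborel) (\<lambda>(y::'b, \<xi>::'a). exp (- s * (norm \<xi>)\<^sup>2))"
    proof (rule Fubini_integrable)
      show "AE y in R. integrable lborel (\<lambda>\<xi>::'a. case (y, \<xi>) of (y, \<xi>) \<Rightarrow> exp (- s * (norm \<xi>)\<^sup>2))"
        using e by simp
      show "integrable R (\<lambda>y. \<integral>\<xi>. norm (case (y, \<xi>::'a) of (y, \<xi>) \<Rightarrow> exp (- s * (norm \<xi>)\<^sup>2)) \<partial>lborel)"
        by simp
    qed measurable
    show "AE x in R \<Otimes>\<^sub>M lborel. norm (case x of (y, \<xi>) \<Rightarrow> h y \<xi> * ?e \<xi>)
        \<le> norm (case x of (y, \<xi>) \<Rightarrow> exp (- s * (norm \<xi>)\<^sup>2))"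
      using bound by (auto simp: norm_mult mult_left_le_one_le)
  qed measurable
  have "(\<integral>y. (\<integral>\<xi>. h y \<xi> * ?e \<xi> \<partial>lborel) \<partial>R) = (\<integral>\<xi>. (\<integral>y. h y \<xi> * ?e \<xi> \<partial>R) \<partial>lborel)"
    using Fubini_integral[OF dom] by simp
  also have "\<dots> = (\<integral>\<xi>. (\<integral>y. h y \<xi> \<partial>R) * ?e \<xi> \<partial>lborel)"
    by simp
  finally show ?thesis .
qed

text \<open>The kernel of C (l - \<Delta>)^{-1}, described by its Fourier transform. The sign in the
  exponent differs from \<open>fourier_measure\<close>, which is immaterial for a real-valued
  transform. The constant is 1 for \<open>Y\<close> and \<open>l z / z\<close> for
  \<open>Z\<close>.\<close>

definition resolvent_measure :: "'a::euclidean_space measure \<Rightarrow> real \<Rightarrow> real \<Rightarrow> bool" where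
  "resolvent_measure R C l \<longleftrightarrow> finite_measure R \<and> sets R = sets borel \<and>
     (\<forall>\<xi>. (\<integral>y. iexp (y \<bullet> \<xi>) \<partial>R) = complex_of_real (C / (l + (norm \<xi>)\<^sup>2)))"

text \<open>The resolvent (l - \<Delta>)^{-1} applied to the heat kernel at time \<open>s\<close>,
  written as the Laplace transform of the heat semigroup.\<close>

definition gauss_potential :: "real \<Rightarrow> real \<Rightarrow> 'a::euclidean_space \<Rightarrow> ennreal" where
  "gauss_potential l s x = (\<integral>\<^sup>+r\<in>{0<..}. ennreal (exp (- l * r) * gauss (s + r) x) \<partial>lborel)"

lemma borel_measurable_gauss_potential[measurable]:
  "(gauss_potential l s :: 'a::euclidean_space \<Rightarrow> ennreal) \<in> borel_measurable borel"
  unfolding gauss_potential_def by measurable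

lemma gauss_le:
  assumes "0 < s" "0 \<le> r"
  shows "gauss (s + r) (x :: 'a::euclidean_space) \<le> (4 * pi * s) powr (- (real DIM('a) / 2))"
proof -
  have "(4 * pi * (s + r)) powr (- (real DIM('a) / 2)) \<le> (4 * pi * s) powr (- (real DIM('a) / 2))"
    using assms by (intro powr_mono2') auto
  moreover have "exp (- (norm x)\<^sup>2 / (4 * (s + r))) \<le> 1"
    using assms by simp
  ultimately have "(4 * pi * (s + r)) powr (- (real DIM('a) / 2)) * exp (- (norm x)\<^sup>2 / (4 * (s + r)))
      \<le> (4 * pi * s) powr (- (real DIM('a) / 2)) * 1"
    by (intro mult_mono) auto
  then show ?thesis by (simp add: gauss_def)
qed

lemma gauss_potential_le:
  assumes "0 < l" "0 < s"
  shows "gauss_potential l s (x :: 'a::euclidean_space) \<le>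
    ennreal ((4 * pi * s) powr (- (real DIM('a) / 2)) / l)"
proof -
  let ?c = "(4 * pi * s) powr (- (real DIM('a) / 2))"
  have "gauss_potential l s x \<le> (\<integral>\<^sup>+r. ennreal ?c * (ennreal (exp (- l * r)) * indicator {0<..} r) \<partial>lborel)"
    unfolding gauss_potential_def using assms
    by (intro nn_integral_mono)
      (auto simp: indicator_def mult.commute[of "exp _"] ennreal_mult'[symmetric]
        intro!: ennreal_leI mult_right_mono gauss_le)
  also have "\<dots> = ennreal ?c * ennreal (1 / l)"
    by (subst nn_integral_cmult) (simp_all add: nn_integral_exp_decay[OF assms(1), simplified])
  finally show ?thesis by (simp flip: ennreal_mult')
qed

lemma gauss_le_gauss_potential:
  assumes l: "0 < l" and s: "0 < s"
  shows "ennreal (1 / (l + real DIM('a) / (2 * s))) * ennreal (gauss s x)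
    \<le> gauss_potential l s (x :: 'a::euclidean_space)"
proof -
  let ?a = "l + real DIM('a) / (2 * s)"
  have a: "0 < ?a" using l s by (simp add: add_pos_nonneg)
  have "ennreal (1 / ?a) * ennreal (gauss s x) =
      (\<integral>\<^sup>+r. (ennreal (exp (- ?a * r)) * indicator {0<..} r) * ennreal (gauss s x) \<partial>lborel)"
    unfolding nn_integral_exp_decay[OF a, symmetric] by (rule nn_integral_multc[symmetric]) simp
  also have "\<dots> \<le> gauss_potential l s x"
    unfolding gauss_potential_def
  proof (intro nn_integral_mono)
    fix r :: real
    have "exp (- ?a * r) * gauss s x \<le> exp (- l * r) * gauss (s + r) x" if "0 < r"
    proof -
      have "exp (- ?a * r) * gauss s x = exp (- l * r) * (exp (- (real DIM('a) / (2 * s)) * r) * gauss s x)"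
        by (simp add: algebra_simps flip: exp_add)
      also have "\<dots> \<le> exp (- l * r) * gauss (s + r) x"
        using gauss_add_ge[OF s, of r x] that by (intro mult_left_mono) auto
      finally show ?thesis .
    qed
    then show "ennreal (exp (- ?a * r)) * indicator {0<..} r * ennreal (gauss s x)
        \<le> ennreal (exp (- l * r) * gauss (s + r) x) * indicator {0<..} r"
      by (auto simp: indicator_def ennreal_mult'[symmetric] intro!: ennreal_leI)
  qed
  finally show ?thesis .
qed

text \<open>Both sides are inverse Fourier integrals with the same integrand: 1 / (l + |\<xi>|^2) is
  the integral of exp(-(l + |\<xi>|^2) r) over r > 0, which replaces \<open>R\<close> by an
  exponential mixture of heat kernels. Two exchanges of integrals, one for \<open>R\<close> and one
  for the law of \<open>r\<close>, connect them.\<close>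

lemma resolvent_gauss:
  fixes R :: "'a::euclidean_space measure"
  assumes R: "resolvent_measure R C l" and l: "0 < l" and C: "0 \<le> C" and s: "0 < s"
  shows "(\<integral>\<^sup>+y. ennreal (gauss s (x + y)) \<partial>R) = ennreal C * gauss_potential l s x"
proof -
  let ?c = "complex_of_real ((2 * pi) powr (- real DIM('a)))"
  let ?e = "\<lambda>s \<xi>::'a. complex_of_real (exp (- s * (norm \<xi>)\<^sup>2))"
  have fin: "finite_measure R" and sets[measurable_cong]: "sets R = sets borel"
    and hat: "\<And>\<xi>. (\<integral>y. iexp (y \<bullet> \<xi>) \<partial>R) = complex_of_real (C / (l + (norm \<xi>)\<^sup>2))"
    using R by (auto simp: resolvent_measure_def)
  interpret R: finite_measure R by fact
  let ?D = "density lborel (\<lambda>r. ennreal (exp (- l * r)) * indicator {0<..} r)"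
  have D_emeasure: "emeasure ?D (space ?D) = ennreal (1 / l)"
    by (subst emeasure_density) (auto simp: nn_integral_exp_decay[OF l, simplified])
  have D: "finite_measure ?D"
    by standard (simp only: D_emeasure, simp)
  interpret D: finite_measure ?D by fact
  have IR: "integrable R (\<lambda>y. gauss s (x + y))"
    using gauss_le[OF s, of 0]
    by (intro R.integrable_const_bound[where B="(4 * pi * s) powr (- (real DIM('a) / 2))"])
      (auto simp: gauss_nonneg)
  have D_AE: "AE r in ?D. 0 < r"
    by (subst AE_density) (auto simp: indicator_def)
  have ID: "integrable ?D (\<lambda>r. gauss (s + r) x)"
    using D_AE gauss_le[OF s, where 'a='a]
    by (intro D.integrable_const_bound[where B="(4 * pi * s) powr (- (real DIM('a) / 2))"])
      (auto simp: gauss_nonneg elim!: eventually_mono)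
  \<comment> \<open>The cut-off at \<open>0 < r\<close> costs nothing under \<open>?D\<close>, but
    it makes the integrand bounded by 1 for every \<open>r\<close>, as the exchange lemma demands;
    exp(-r |\<xi>|^2) is unbounded for negative \<open>r\<close>.\<close>
  have h: "(\<integral>r. (if 0 < r then iexp (x \<bullet> \<xi>) * ?e r \<xi> else 0) \<partial>?D) =
      iexp (x \<bullet> \<xi>) * complex_of_real (1 / (l + (norm \<xi>)\<^sup>2))" for \<xi>
  proof -
    have l': "0 < l + (norm \<xi>)\<^sup>2" using l by (simp add: add_pos_nonneg)
    have "(\<integral>r. (if 0 < r then iexp (x \<bullet> \<xi>) * ?e r \<xi> else 0) \<partial>?D) =
        (\<integral>r. iexp (x \<bullet> \<xi>) * complex_of_real (exp (- (norm \<xi>)\<^sup>2 * r)) \<partial>?D)"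
      using D_AE by (intro integral_cong_AE) (auto elim!: eventually_mono simp: mult.commute)
    also have "\<dots> = iexp (x \<bullet> \<xi>) * complex_of_real (\<integral>r. exp (- (norm \<xi>)\<^sup>2 * r) \<partial>?D)"
      by simp
    also have "(\<integral>r. exp (- (norm \<xi>)\<^sup>2 * r) \<partial>?D) =
        enn2real (\<integral>\<^sup>+r. ennreal (exp (- (norm \<xi>)\<^sup>2 * r)) \<partial>?D)"
      by (rule integral_eq_nn_integral) auto
    also have "(\<integral>\<^sup>+r. ennreal (exp (- (norm \<xi>)\<^sup>2 * r)) \<partial>?D) =
        (\<integral>\<^sup>+r\<in>{0<..}. ennreal (exp (- (l + (norm \<xi>)\<^sup>2) * r)) \<partial>lborel)"
      by (subst nn_integral_density)
        (auto intro!: nn_integral_cong simp: indicator_def ennreal_mult'[symmetric] algebra_simps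
          simp flip: exp_add)
    also have "\<dots> = ennreal (1 / (l + (norm \<xi>)\<^sup>2))"
      by (rule nn_integral_exp_decay[OF l'])
    finally show ?thesis using l' by simp
  qed
  have "complex_of_real (\<integral>y. gauss s (x + y) \<partial>R) =
      (\<integral>y. ?c * (\<integral>\<xi>. iexp ((x + y) \<bullet> \<xi>) * ?e s \<xi> \<partial>lborel) \<partial>R)"
    by (simp only: integral_complex_of_real[symmetric] gauss_inverse_fourier[OF s])
  also have "\<dots> = ?c * (\<integral>\<xi>. (\<integral>y. iexp ((x + y) \<bullet> \<xi>) \<partial>R) * ?e s \<xi> \<partial>lborel)"
    by (subst integral_mult_right_zero, subst fubini_gaussian_weight[OF fin s]) auto
  also have "(\<lambda>\<xi>. \<integral>y. iexp ((x + y) \<bullet> \<xi>) \<partial>R) =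
      (\<lambda>\<xi>. C * (\<integral>r. (if 0 < r then iexp (x \<bullet> \<xi>) * ?e r \<xi> else 0) \<partial>?D))"
  proof
    fix \<xi>
    have "(\<integral>y. iexp ((x + y) \<bullet> \<xi>) \<partial>R) = (\<integral>y. iexp (x \<bullet> \<xi>) * iexp (y \<bullet> \<xi>) \<partial>R)"
      by (simp add: inner_add_left distrib_left exp_add)
    also have "\<dots> = iexp (x \<bullet> \<xi>) * complex_of_real (C / (l + (norm \<xi>)\<^sup>2))"
      by (simp only: integral_mult_right_zero hat)
    finally show "(\<integral>y. iexp ((x + y) \<bullet> \<xi>) \<partial>R) =
        C * (\<integral>r. (if 0 < r then iexp (x \<bullet> \<xi>) * ?e r \<xi> else 0) \<partial>?D)"
      unfolding h by simp
  qed
  also have "?c * (\<integral>\<xi>. C * (\<integral>r. (if 0 < r then iexp (x \<bullet> \<xi>) * ?e r \<xi> else 0) \<partial>?D) * ?e s \<xi> \<partial>lborel) =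
      C * (\<integral>r. ?c * (\<integral>\<xi>. (if 0 < r then iexp (x \<bullet> \<xi>) * ?e r \<xi> else 0) * ?e s \<xi> \<partial>lborel) \<partial>?D)"
    by (simp only: mult.assoc integral_mult_right_zero,
        subst fubini_gaussian_weight[OF D s]) (auto simp: norm_mult mult_le_one)
  also have "(\<integral>r. ?c * (\<integral>\<xi>. (if 0 < r then iexp (x \<bullet> \<xi>) * ?e r \<xi> else 0) * ?e s \<xi> \<partial>lborel) \<partial>?D) =
      (\<integral>r. complex_of_real (gauss (s + r) x) \<partial>?D)"
  proof (rule integral_cong_AE)
    show "AE r in ?D. ?c * (\<integral>\<xi>. (if 0 < r then iexp (x \<bullet> \<xi>) * ?e r \<xi> else 0) * ?e s \<xi> \<partial>lborel) =
        complex_of_real (gauss (s + r) x)"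
      using D_AE
    proof eventually_elim
      case (elim r)
      have "(\<lambda>\<xi>. (if 0 < r then iexp (x \<bullet> \<xi>) * ?e r \<xi> else 0) * ?e s \<xi>) =
          (\<lambda>\<xi>. iexp (x \<bullet> \<xi>) * ?e (s + r) \<xi>)"
        using elim by (auto simp: algebra_simps simp flip: of_real_mult exp_add)
      then show ?case
        using elim s by (simp only: gauss_inverse_fourier[of "s + r"])
    qed
  qed measurable
  also have "C * \<dots> = complex_of_real (C * (\<integral>r. gauss (s + r) x \<partial>?D))"
    by simp
  finally have eq: "(\<integral>y. gauss s (x + y) \<partial>R) = C * (\<integral>r. gauss (s + r) x \<partial>?D)"
    by (simp only: of_real_eq_iff)
  have "(\<integral>\<^sup>+y. ennreal (gauss s (x + y)) \<partial>R) = ennreal (\<integral>y. gauss s (x + y) \<partial>R)"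
    by (intro nn_integral_eq_integral IR) (simp add: gauss_nonneg)
  also have "\<dots> = ennreal C * ennreal (\<integral>r. gauss (s + r) x \<partial>?D)"
    using C by (simp add: eq ennreal_mult')
  also have "ennreal (\<integral>r. gauss (s + r) x \<partial>?D) = (\<integral>\<^sup>+r. ennreal (gauss (s + r) x) \<partial>?D)"
    by (intro nn_integral_eq_integral[symmetric] ID) (simp add: gauss_nonneg)
  also have "\<dots> = gauss_potential l s x"
    unfolding gauss_potential_def
    by (subst nn_integral_density)
      (auto intro!: nn_integral_cong simp: indicator_def ennreal_mult')
  finally show ?thesis .
qed

lemma resolvent_gauss_ge:
  fixes R :: "'a::euclidean_space measure"
  assumes R: "resolvent_measure R C l" and l: "0 < l" and C: "0 \<le> C" and s: "0 < s"
  shows "ennreal (C / (l + real DIM('a) / (2 * s))) * ennreal (gauss s x)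
    \<le> (\<integral>\<^sup>+y. ennreal (gauss s (x + y)) \<partial>R)"
proof -
  have "0 \<le> l + real DIM('a) / (2 * s)" using l s by (simp add: add_nonneg_nonneg)
  then have "ennreal (C / (l + real DIM('a) / (2 * s))) * ennreal (gauss s x) =
      ennreal C * (ennreal (1 / (l + real DIM('a) / (2 * s))) * ennreal (gauss s x))"
    using C by (simp add: mult.assoc[symmetric] ennreal_mult'[symmetric])
  also have "\<dots> \<le> (\<integral>\<^sup>+y. ennreal (gauss s (x + y)) \<partial>R)"
    unfolding resolvent_gauss[OF assms] by (intro mult_left_mono gauss_le_gauss_potential l s) simp
  finally show ?thesis .
qed

lemma resolvent_potential_eq:
  fixes R :: "'a::euclidean_space measure"
  assumes R: "resolvent_measure R C l" 
  shows "(\<integral>\<^sup>+y. gauss_potential k s (x + y) \<partial>R) =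
    (\<integral>\<^sup>+r\<in>{0<..}. ennreal (exp (- k * r)) * (\<integral>\<^sup>+y. ennreal (gauss (s + r) (x + y)) \<partial>R) \<partial>lborel)"
proof -
  have fin: "finite_measure R" and sets[measurable_cong]: "sets R = sets borel"
    using R by (auto simp: resolvent_measure_def)
  interpret R: finite_measure R by fact
  interpret pair_sigma_finite R "lborel :: real measure" ..
  have "(\<integral>\<^sup>+y. gauss_potential k s (x + y) \<partial>R) =
      (\<integral>\<^sup>+r. (\<integral>\<^sup>+y. ennreal (exp (- k * r) * gauss (s + r) (x + y)) * indicator {0<..} r \<partial>R) \<partial>lborel)"
    unfolding gauss_potential_def by (rule Fubini'[symmetric]) measurable
  also have "\<dots> = (\<integral>\<^sup>+r\<in>{0<..}. ennreal (exp (- k * r)) *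
      (\<integral>\<^sup>+y. ennreal (gauss (s + r) (x + y)) \<partial>R) \<partial>lborel)"
    by (intro nn_integral_cong) (simp add: nn_integral_multc nn_integral_cmult ennreal_mult')
  finally show ?thesis .
qed

text \<open>Each layer \<open>gauss (s + r)\<close> of the potential satisfies the Gaussian bound
  with rate n / (2 (s + r)), so the constant of the layer r = 0 is the worst one and serves for
  all.\<close>

lemma resolvent_potential_ge:
  fixes R :: "'a::euclidean_space measure"
  assumes R: "resolvent_measure R C l" and l: "0 < l" and C: "0 \<le> C" and s: "0 < s"
  shows "ennreal (C / (l + real DIM('a) / (2 * s))) * gauss_potential k s x
    \<le> (\<integral>\<^sup>+y. gauss_potential k s (x + y) \<partial>R)"
proof -
  have "ennreal (C / (l + real DIM('a) / (2 * s))) * gauss_potential k s x =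
      (\<integral>\<^sup>+r\<in>{0<..}. ennreal (exp (- k * r)) *
        (ennreal (C / (l + real DIM('a) / (2 * s))) * ennreal (gauss (s + r) x)) \<partial>lborel)"
    unfolding gauss_potential_def
    by (subst nn_integral_cmult[symmetric], measurable, intro nn_integral_cong, subst ennreal_mult')
      (simp_all add: mult_ac)
  also have "\<dots> \<le> (\<integral>\<^sup>+r\<in>{0<..}. ennreal (exp (- k * r)) *
      (\<integral>\<^sup>+y. ennreal (gauss (s + r) (x + y)) \<partial>R) \<partial>lborel)"
  proof (intro nn_integral_mono)
    fix r :: real
    have "ennreal (C / (l + real DIM('a) / (2 * s))) * ennreal (gauss (s + r) x)
        \<le> (\<integral>\<^sup>+y. ennreal (gauss (s + r) (x + y)) \<partial>R)" if "0 < r"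
    proof -
      have "C / (l + real DIM('a) / (2 * s)) \<le> C / (l + real DIM('a) / (2 * (s + r)))"
        using that l s C by (intro frac_le add_mono divide_left_mono) (auto intro!: add_pos_nonneg)
      then have "ennreal (C / (l + real DIM('a) / (2 * s))) * ennreal (gauss (s + r) x)
        \<le> ennreal (C / (l + real DIM('a) / (2 * (s + r)))) * ennreal (gauss (s + r) x)"
        by (intro mult_right_mono ennreal_leI) auto
      also have "\<dots> \<le> (\<integral>\<^sup>+y. ennreal (gauss (s + r) (x + y)) \<partial>R)"
        using that s by (intro resolvent_gauss_ge[OF R l C]) auto
      finally show ?thesis .
    qed
    then show "ennreal (exp (- k * r)) *
        (ennreal (C / (l + real DIM('a) / (2 * s))) * ennreal (gauss (s + r) x)) * indicator {0<..} r
      \<le> ennreal (exp (- k * r)) *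
      (\<integral>\<^sup>+y. ennreal (gauss (s + r) (x + y)) \<partial>R) * indicator {0<..} r"
      by (auto simp: indicator_def intro!: mult_left_mono)
  qed
  also have "\<dots> = (\<integral>\<^sup>+y. gauss_potential k s (x + y) \<partial>R)"
    by (rule resolvent_potential_eq[OF R, symmetric])
  finally show ?thesis .
qed

text \<open>The left side is a double integral of exp(-k r) exp(-l q) G_{s+r+q}. Substituting v = r
  + q produces exp(k q) exp(-k v) G_{s+v} on v > q; enlarging the range to v > 0 restores the
  potential, and the remaining integral of exp(-(l - k) q) is 1 / (l - k). Hence the requirement
  \<open>k < l\<close>.\<close>

lemma resolvent_potential_le:
  fixes R :: "'a::euclidean_space measure"
  assumes R: "resolvent_measure R C l" and k: "0 < k" "k < l" and C: "0 \<le> C" and s: "0 < s"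
  shows "(\<integral>\<^sup>+y. gauss_potential k s (x + y) \<partial>R)
    \<le> ennreal (C / (l - k)) * gauss_potential k s x"
proof -
  have l: "0 < l" using k by simp
  let ?I = "\<lambda>r. indicator {0<..} r :: ennreal"
  have "(\<integral>\<^sup>+y. gauss_potential k s (x + y) \<partial>R) =
    (\<integral>\<^sup>+r\<in>{0<..}. ennreal (exp (- k * r)) * (ennreal C * gauss_potential l (s + r) x) \<partial>lborel)"
    unfolding resolvent_potential_eq[OF R]
    using s by (auto intro!: nn_integral_cong simp: indicator_def resolvent_gauss[OF R l C])
  also have "\<dots> = (\<integral>\<^sup>+r. (\<integral>\<^sup>+q. ennreal C * (ennreal (exp (- k * r)) * ?I r) *
      (ennreal (exp (- l * q)) * ennreal (gauss (s + r + q) x) * ?I q) \<partial>lborel) \<partial>lborel)"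
    unfolding gauss_potential_def
    by (intro nn_integral_cong, subst nn_integral_cmult) (auto simp: ennreal_mult' mult_ac)
  also have "\<dots> = (\<integral>\<^sup>+q. (\<integral>\<^sup>+r. ennreal C * (ennreal (exp (- k * r)) * ?I r) *
      (ennreal (exp (- l * q)) * ennreal (gauss (s + r + q) x) * ?I q) \<partial>lborel) \<partial>lborel)"
    by (rule lborel_pair.Fubini') measurable
  also have "\<dots> = (\<integral>\<^sup>+q. (ennreal C * (ennreal (exp (- l * q)) * ?I q)) *
      (\<integral>\<^sup>+r. ennreal (exp (- k * r)) * ennreal (gauss (s + r + q) x) * ?I r \<partial>lborel) \<partial>lborel)"
    by (intro nn_integral_cong, subst nn_integral_cmult[symmetric])
      (auto intro!: nn_integral_cong simp: mult_ac)
  also have "\<dots> \<le> (\<integral>\<^sup>+q. (ennreal C * (ennreal (exp (- l * q)) * ?I q)) *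
      (ennreal (exp (k * q)) * gauss_potential k s x) \<partial>lborel)"
  proof (intro nn_integral_mono)
    fix q :: real
    have "(\<integral>\<^sup>+r. ennreal (exp (- k * r)) * ennreal (gauss (s + r + q) x) * ?I r \<partial>lborel)
        \<le> ennreal (exp (k * q)) * gauss_potential k s x" if q: "0 < q"
    proof -
      have "(\<integral>\<^sup>+r. ennreal (exp (- k * r)) * ennreal (gauss (s + r + q) x) * ?I r \<partial>lborel)
        = (\<integral>\<^sup>+v. ennreal (exp (- k * (- q + 1 * v))) * ennreal (gauss (s + (- q + 1 * v) + q) x) * ?I (- q + 1 * v) \<partial>lborel)"
        by (subst nn_integral_real_affine[where c=1 and t="- q"]) auto
      also have "\<dots> \<le> (\<integral>\<^sup>+v. ennreal (exp (k * q)) * (ennreal (exp (- k * v) * gauss (s + v) x) * ?I v) \<partial>lborel)"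
      proof (intro nn_integral_mono)
        fix v :: real
        have "exp (- k * (- q + 1 * v)) = exp (k * q) * exp (- k * v)"
          unfolding exp_add[symmetric] by (simp add: algebra_simps)
        then have "ennreal (exp (- k * (- q + 1 * v))) * ennreal (gauss (s + (- q + 1 * v) + q) x) =
            ennreal (exp (k * q)) * ennreal (exp (- k * v) * gauss (s + v) x)"
          by (simp add: ennreal_mult' mult.assoc)
        then show "ennreal (exp (- k * (- q + 1 * v))) * ennreal (gauss (s + (- q + 1 * v) + q) x) * ?I (- q + 1 * v)
            \<le> ennreal (exp (k * q)) * (ennreal (exp (- k * v) * gauss (s + v) x) * ?I v)"
          using q by (auto simp: indicator_def)
      qed
      also have "\<dots> = ennreal (exp (k * q)) * gauss_potential k s x"
        unfolding gauss_potential_def by (rule nn_integral_cmult) measurable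
      finally show ?thesis .
    qed
    then show "(ennreal C * (ennreal (exp (- l * q)) * ?I q)) *
        (\<integral>\<^sup>+r. ennreal (exp (- k * r)) * ennreal (gauss (s + r + q) x) * ?I r \<partial>lborel) \<le>
      (ennreal C * (ennreal (exp (- l * q)) * ?I q)) * (ennreal (exp (k * q)) * gauss_potential k s x)"
      by (cases "0 < q") (auto intro!: mult_left_mono)
  qed
  also have "\<dots> = (\<integral>\<^sup>+q. (ennreal C * gauss_potential k s x) *
      (ennreal (exp (- (l - k) * q)) * ?I q) \<partial>lborel)"
  proof (intro nn_integral_cong)
    fix q :: real
    have "ennreal (exp (- (l - k) * q)) = ennreal (exp (- l * q)) * ennreal (exp (k * q))"
      by (simp add: algebra_simps flip: ennreal_mult' exp_add)
    then show "(ennreal C * (ennreal (exp (- l * q)) * ?I q)) * (ennreal (exp (k * q)) * gauss_potential k s x) =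
      (ennreal C * gauss_potential k s x) * (ennreal (exp (- (l - k) * q)) * ?I q)"
      by (simp add: mult_ac)
  qed
  also have "\<dots> = (ennreal C * gauss_potential k s x) * ennreal (1 / (l - k))"
    using nn_integral_exp_decay[of "l - k"] k by (subst nn_integral_cmult) simp_all
  also have "\<dots> = ennreal (C / (l - k)) * gauss_potential k s x"
  proof -
    have "ennreal (C / (l - k)) = ennreal C * ennreal (1 / (l - k))"
      using C k by (simp flip: ennreal_mult')
    then show ?thesis by (simp add: mult_ac)
  qed
  finally show ?thesis .
qed

lemma nn_integral_gauss_potential:
  assumes l: "0 < l" and s: "0 < s"
  shows "(\<integral>\<^sup>+x. gauss_potential l s (x :: 'a::euclidean_space) \<partial>lborel) = ennreal (1 / l)"
proof -
  have "(\<integral>\<^sup>+x. gauss_potential l s (x :: 'a) \<partial>lborel) =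
      (\<integral>\<^sup>+r. (\<integral>\<^sup>+x. ennreal (exp (- l * r) * gauss (s + r) (x :: 'a)) * indicator {0<..} r \<partial>lborel) \<partial>lborel)"
    unfolding gauss_potential_def by (rule lborel_pair.Fubini') measurable
  also have "\<dots> = (\<integral>\<^sup>+r\<in>{0<..}. ennreal (exp (- l * r)) \<partial>lborel)"
    using s by (intro nn_integral_cong)
      (auto simp: ennreal_mult' nn_integral_cmult gauss_integral indicator_def)
  also have "\<dots> = ennreal (1 / l)"
    by (rule nn_integral_exp_decay[OF l])
  finally show ?thesis .
qed

section \<open>From the Fourier--Laplace transform to resolvent measures\<close>

lemma integrable_kernel_bounded:
  assumes M: "borel_kernel M" and h[measurable]: "h \<in> borel_measurable borel"
    and bound: "\<And>y. \<bar>h y\<bar> \<le> (B :: real)"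
  shows "integrable (M t) h"
proof -
  interpret finite_measure "M t" by (rule borel_kernelD(1)[OF M])
  have "h \<in> borel_measurable (M t)"
    using borel_kernelD(2)[OF M] h measurable_cong_sets by blast
  then show ?thesis
    using bound by (intro integrable_const_bound[where B=B]) auto
qed

text \<open>Adding the bound \<open>B\<close> turns the integral of a signed function into a
  nonnegative one, for which measurability in \<open>t\<close> is already available.\<close>

lemma integral_kernel_shift:
  assumes M: "borel_kernel M" and h[measurable]: "h \<in> borel_measurable borel"
    and bound: "\<And>y. \<bar>h y\<bar> \<le> (B :: real)"
  shows "(\<integral>y. h y \<partial>M t) = enn2real (\<integral>\<^sup>+y. ennreal (h y + B) \<partial>M t) -
    B * enn2real (emeasure (M t) UNIV)"
proof -
  have sp: "space (M t) = UNIV" by (rule borel_kernelD(3)[OF M])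
  have "(\<integral>y. h y + B \<partial>M t) = (\<integral>y. h y \<partial>M t) + (\<integral>y. B \<partial>M t)"
    using integrable_kernel_bounded[OF M h bound, of t]
      integrable_kernel_bounded[OF M, of "\<lambda>_. B" "\<bar>B\<bar>" t]
    by (intro Bochner_Integration.integral_add) auto
  moreover have "(\<integral>y. h y + B \<partial>M t) = enn2real (\<integral>\<^sup>+y. ennreal (h y + B) \<partial>M t)"
  proof (rule integral_eq_nn_integral)
    show "(\<lambda>y. h y + B) \<in> borel_measurable (M t)"
      using integrable_kernel_bounded[OF M h bound, of t] by simp
    show "AE y in M t. 0 \<le> h y + B"
      using bound by (auto simp: abs_le_iff intro!: AE_I2) (smt (verit) bound)
  qed
  ultimately show ?thesis by (simp add: measure_def sp mult.commute)
qed

lemma measurable_integral_kernel: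
  assumes M: "borel_kernel M" and h[measurable]: "h \<in> borel_measurable borel"
    and bound: "\<And>y. \<bar>h y\<bar> \<le> (B :: real)"
  shows "(\<lambda>t. \<integral>y. h y \<partial>M t) \<in> borel_measurable borel"
proof -
  have [measurable]: "(\<lambda>t. \<integral>\<^sup>+y. ennreal (h y + B) \<partial>M t) \<in> borel_measurable borel"
    using M by (rule measurable_nn_integral_kernel) measurable
  have [measurable]: "(\<lambda>t. emeasure (M t) UNIV) \<in> borel_measurable borel"
    using borel_kernelD(4)[OF M] by simp
  show ?thesis
    unfolding integral_kernel_shift[OF assms] by measurable
qed

lemma fourier_measure_eq:
  fixes M :: "real \<Rightarrow> (real ^ 'n) measure"
  assumes M: "borel_kernel M"
  shows "fourier_measure (M t) \<xi> =
    Complex (\<integral>y. cos (y \<bullet> \<xi>) \<partial>M t) (- (\<integral>y. sin (y \<bullet> \<xi>) \<partial>M t))"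
proof -
  have I: "integrable (M t) (\<lambda>y. cos (y \<bullet> \<xi>))" "integrable (M t) (\<lambda>y. sin (y \<bullet> \<xi>))"
    by (auto intro!: integrable_kernel_bounded[OF M, where B=1])
  have "fourier_measure (M t) \<xi> =
      (\<integral>y. complex_of_real (cos (y \<bullet> \<xi>)) - \<i> * complex_of_real (sin (y \<bullet> \<xi>)) \<partial>M t)"
    unfolding fourier_measure_def
    by (intro Bochner_Integration.integral_cong refl) (simp add: exp_eq_polar complex_eq_iff)
  also have "\<dots> = complex_of_real (\<integral>y. cos (y \<bullet> \<xi>) \<partial>M t) - \<i> * complex_of_real (\<integral>y. sin (y \<bullet> \<xi>) \<partial>M t)"
    using I by (subst Bochner_Integration.integral_diff) auto
  finally show ?thesis by (simp add: complex_eq_iff)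
qed

lemma measurable_fourier_kernel:
  fixes M :: "real \<Rightarrow> (real ^ 'n) measure"
  assumes M: "borel_kernel M"
  shows "(\<lambda>t. fourier_measure (M t) \<xi>) \<in> borel_measurable borel"
proof -
  have [measurable]: "(\<lambda>t. \<integral>y. cos (y \<bullet> \<xi>) \<partial>M t) \<in> borel_measurable borel"
    "(\<lambda>t. \<integral>y. sin (y \<bullet> \<xi>) \<partial>M t) \<in> borel_measurable borel"
    by (auto intro!: measurable_integral_kernel[OF M, where B=1])
  show ?thesis
    unfolding fourier_measure_eq[OF M] Complex_eq by measurable
qed

lemma borel_measurable_lebesgue_on:
  assumes "f \<in> borel_measurable borel"
  shows "f \<in> borel_measurable (lebesgue_on A)"
  using assms by (intro measurable_restrict_space1 measurable_completion) simp

text \<open>\<open>R\<close> is the mixture of the \<open>M t\<close> with weight exp(-z t). The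
  hypothesis speaks of an iterated complex integral, the conclusion of the transform of
  \<open>R\<close>; the two are matched through cosine and sine separately, since the mixture
  identity holds for nonnegative integrands.\<close>

lemma laplace_resolvent:
  fixes M :: "real \<Rightarrow> (real ^ 'n) measure"
  assumes M: "borel_kernel M" and l: "0 < l" and C: "0 \<le> C"
    and FL: "\<And>\<xi>. has_fourier_laplace M \<xi> z (C / (l + (norm \<xi>)\<^sup>2))"
  obtains R where "resolvent_measure R C l"
    "\<And>f. f \<in> borel_measurable borel \<Longrightarrow> (\<integral>\<^sup>+y. f y \<partial>R) =
      (\<integral>\<^sup>+t\<in>{0<..}. ennreal (exp (- z * t)) * (\<integral>\<^sup>+y. f y \<partial>M t) \<partial>lborel)"
proof -
  have [measurable]: "(\<lambda>t. ennreal (exp (- z * t)) * indicator {0<..} t) \<in> borel_measurable borel"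
    by simp
  obtain R where sets: "sets R = sets (borel :: (real ^ 'n) measure)" and
    int: "\<And>f. f \<in> borel_measurable borel \<Longrightarrow> (\<integral>\<^sup>+y. f y \<partial>R) =
      (\<integral>\<^sup>+t. ennreal (exp (- z * t)) * indicator {0<..} t * (\<integral>\<^sup>+y. f y \<partial>M t) \<partial>lborel)"
    by (rule kernel_mixture[OF M, of "\<lambda>t. ennreal (exp (- z * t)) * indicator {0<..} t"]) simp_all
  let ?LO = "lebesgue_on {0::real<..}"
  have LO: "(\<integral>\<^sup>+t. f t \<partial>?LO) = (\<integral>\<^sup>+t\<in>{0<..}. f t \<partial>lborel)" for f :: "real \<Rightarrow> ennreal"
    by (subst nn_integral_restrict_space) (simp_all add: nn_integral_completion)
  have int': "(\<integral>\<^sup>+y. ennreal (h y) \<partial>R) = (\<integral>\<^sup>+t. ennreal (exp (- z * t) * (\<integral>y. h y \<partial>M t)) \<partial>?LO)"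
    if h[measurable]: "h \<in> borel_measurable borel" and "\<And>y. 0 \<le> h y" "\<And>y. h y \<le> B"
    for h :: "real ^ 'n \<Rightarrow> real" and B
  proof -
    have "(\<integral>\<^sup>+y. ennreal (h y) \<partial>M t) = ennreal (\<integral>y. h y \<partial>M t)" for t
      using that by (intro nn_integral_eq_integral integrable_kernel_bounded[OF M h, of B]) auto
    then show ?thesis
      unfolding LO by (subst int, simp) (simp add: ennreal_mult', simp add: mult_ac)
  qed
  have hb: "has_bochner_integral ?LO
      (\<lambda>t. exp (- z * t) *\<^sub>R Complex (\<integral>y. cos (y \<bullet> \<xi>) \<partial>M t) (- (\<integral>y. sin (y \<bullet> \<xi>) \<partial>M t)))
      (complex_of_real (C / (l + (norm \<xi>)\<^sup>2)))" for \<xi>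
    using FL[of \<xi>] unfolding has_fourier_laplace_def fourier_measure_eq[OF M] .
  have hc: "has_bochner_integral ?LO (\<lambda>t. exp (- z * t) * (\<integral>y. cos (y \<bullet> \<xi>) \<partial>M t))
      (C / (l + (norm \<xi>)\<^sup>2))" for \<xi>
    using has_bochner_integral_bounded_linear[OF bounded_linear_Re hb[of \<xi>]] by simp
  have hs: "has_bochner_integral ?LO (\<lambda>t. exp (- z * t) * (\<integral>y. sin (y \<bullet> \<xi>) \<partial>M t)) 0" for \<xi>
    using has_bochner_integral_bounded_linear[OF bounded_linear_Im hb[of \<xi>]]
      has_bochner_integral_minus by fastforce
  \<comment> \<open>At \<xi> = 0 the transform is the total mass. This makes \<open>R\<close>
    finite, with mass \<open>C / l\<close>.\<close>
  have h1: "has_bochner_integral ?LO (\<lambda>t. exp (- z * t) * (\<integral>y. 1 \<partial>M t)) (C / l)"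
    using hc[of 0] by simp
  have meas: "(\<lambda>t. exp (- z * t) * (\<integral>y. h y \<partial>M t)) \<in> borel_measurable ?LO"
    if "h \<in> borel_measurable borel" "\<And>y. \<bar>h y\<bar> \<le> 1" for h :: "real ^ 'n \<Rightarrow> real"
    using measurable_integral_kernel[OF M that] by (intro borel_measurable_lebesgue_on) simp
  have sp: "space R = UNIV" using sets_eq_imp_space_eq[OF sets] by simp
  have em: "emeasure R (space R) = ennreal (C / l)"
  proof -
    have "emeasure R (space R) = (\<integral>\<^sup>+t. ennreal (exp (- z * t) * (\<integral>y. 1 \<partial>M t)) \<partial>?LO)"
      using int'[of "\<lambda>_. 1" 1] by simp
    also have "\<dots> = ennreal (C / l)"
      using h1 by (subst nn_integral_eq_integral) (auto simp: has_bochner_integral_iff)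
    finally show ?thesis .
  qed
  interpret R: finite_measure R
    by standard (simp only: em, simp)
  have IR: "integrable R h" if [measurable]: "h \<in> borel_measurable borel" and "\<And>y. \<bar>h y\<bar> \<le> 1"
    for h :: "real ^ 'n \<Rightarrow> real"
  proof -
    have "h \<in> borel_measurable R"
      using sets that(1) measurable_cong_sets by blast
    then show ?thesis
      using that(2) by (intro R.integrable_const_bound[where B=1]) auto
  qed
  \<comment> \<open>For \<bar>h\<bar> \<le> 1 the function \<open>1 + h\<close> is nonnegative and
    the mixture identity applies to it; the masses \<open>C / l\<close> on both sides are then
    subtracted.\<close>
  have key: "(\<integral>y. h y \<partial>R) = v"
    if h[measurable]: "h \<in> borel_measurable borel" and b: "\<And>y. \<bar>h y\<bar> \<le> 1"
      and hv: "has_bochner_integral ?LO (\<lambda>t. exp (- z * t) * (\<integral>y. h y \<partial>M t)) v"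
    for h :: "real ^ 'n \<Rightarrow> real" and v
  proof -
    have hh: "0 \<le> 1 + h y" "1 + h y \<le> 2" for y using b[of y] by auto
    have eq: "exp (- z * t) * (\<integral>y. 1 + h y \<partial>M t) =
        exp (- z * t) * (\<integral>y. 1 \<partial>M t) + exp (- z * t) * (\<integral>y. h y \<partial>M t)" for t
      using integrable_kernel_bounded[OF M h b, of t] integrable_kernel_bounded[OF M, of "\<lambda>_. 1" 1 t]
      by (subst Bochner_Integration.integral_add) (auto simp: distrib_left)
    have hb: "has_bochner_integral ?LO (\<lambda>t. exp (- z * t) * (\<integral>y. 1 + h y \<partial>M t)) (C / l + v)"
      unfolding eq by (intro has_bochner_integral_add h1 hv)
    have "(\<integral>\<^sup>+y. ennreal (1 + h y) \<partial>R) = (\<integral>\<^sup>+t. ennreal (exp (- z * t) * (\<integral>y. 1 + h y \<partial>M t)) \<partial>?LO)"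
      using hh by (intro int'[where B=2]) auto
    also have "\<dots> = ennreal (C / l + v)"
      using hb hh by (subst nn_integral_eq_integral) (auto simp: has_bochner_integral_iff)
    finally have e1: "(\<integral>\<^sup>+y. ennreal (1 + h y) \<partial>R) = ennreal (C / l + v)" .
    have pos: "0 \<le> C / l + v"
    proof -
      have "0 \<le> (LINT t|?LO. exp (- z * t) * (\<integral>y. 1 + h y \<partial>M t))"
        using hh by (intro integral_nonneg_AE) auto
      then show ?thesis using hb by (simp add: has_bochner_integral_iff)
    qed
    have "(\<integral>\<^sup>+y. ennreal (1 + h y) \<partial>R) = ennreal (\<integral>y. 1 + h y \<partial>R)"
      using IR[OF h b] IR[of "\<lambda>_. 1"] hh by (intro nn_integral_eq_integral) auto
    then have "(\<integral>y. 1 + h y \<partial>R) = C / l + v"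
      using e1 pos hh by (simp add: integral_nonneg_AE)
    moreover have "(\<integral>y. 1 + h y \<partial>R) = measure R (space R) + (\<integral>y. h y \<partial>R)"
      using IR[OF h b] by (subst Bochner_Integration.integral_add) auto
    moreover have "measure R (space R) = C / l"
      using em C l by (simp add: measure_def)
    ultimately show ?thesis by simp
  qed
  show thesis
  proof
    show "resolvent_measure R C l"
      unfolding resolvent_measure_def
    proof (intro conjI allI sets)
      show "finite_measure R" by (rule R.finite_measure_axioms)
      fix \<xi> :: "real ^ 'n"
      have "(\<integral>y. iexp (y \<bullet> \<xi>) \<partial>R) =
          (\<integral>y. complex_of_real (cos (y \<bullet> \<xi>)) + \<i> * complex_of_real (sin (y \<bullet> \<xi>)) \<partial>R)"
        by (intro Bochner_Integration.integral_cong refl) (simp add: exp_eq_polar complex_eq_iff)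
      also have "\<dots> = complex_of_real (\<integral>y. cos (y \<bullet> \<xi>) \<partial>R) + \<i> * complex_of_real (\<integral>y. sin (y \<bullet> \<xi>) \<partial>R)"
        using IR[of "\<lambda>y. cos (y \<bullet> \<xi>)"] IR[of "\<lambda>y. sin (y \<bullet> \<xi>)"]
        by (subst Bochner_Integration.integral_add) auto
      also have "(\<integral>y. cos (y \<bullet> \<xi>) \<partial>R) = C / (l + (norm \<xi>)\<^sup>2)"
        by (intro key hc) auto
      also have "(\<integral>y. sin (y \<bullet> \<xi>) \<partial>R) = 0"
        by (intro key hs) auto
      finally show "(\<integral>y. iexp (y \<bullet> \<xi>) \<partial>R) = complex_of_real (C / (l + (norm \<xi>)\<^sup>2))"
        by simp
    qed
    show "(\<integral>\<^sup>+y. f y \<partial>R) = (\<integral>\<^sup>+t\<in>{0<..}. ennreal (exp (- z * t)) * (\<integral>\<^sup>+y. f y \<partial>M t) \<partial>lborel)"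
      if "f \<in> borel_measurable borel" for f
      by (subst int[OF that]) (simp add: mult_ac)
  qed
qed

section \<open>Borel versions of the two families of measures\<close>

lemma countable_Int_stable_generator:
  obtains G :: "'a::second_countable_topology set set"
  where "countable G" "Int_stable G" "UNIV \<in> G" "sets (borel :: 'a measure) = sigma_sets UNIV G"
proof -
  obtain B :: "'a set set" where B: "countable B" "topological_basis B"
    using ex_countable_basis by auto
  have bB: "sets (borel :: 'a measure) = sigma_sets UNIV B"
    using arg_cong[OF borel_eq_countable_basis[OF B], of sets] by simp
  \<comment> \<open>Finite intersections of basic open sets: still countable, stable under
    intersection, and containing \<open>UNIV\<close> as the intersection of the empty
    family.\<close>
  let ?G = "Inter ` {F. finite F \<and> F \<subseteq> B}"
  have "\<Inter>F \<in> sigma_sets UNIV B" if "finite F" "F \<subseteq> B" for F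
  proof -
    have "open (\<Inter>F)" using that B(2) by (auto intro!: open_Inter simp: topological_basis_open)
    then show ?thesis unfolding bB[symmetric] by simp
  qed
  then have "sigma_sets UNIV ?G = sigma_sets UNIV B"
    by (intro sigma_sets_eqI) (auto intro: sigma_sets.Basic intro!: rev_image_eqI[of "{_}"])
  moreover have "countable ?G"
    using countable_Collect_finite_subset[OF B(1)] by auto
  moreover have "Int_stable ?G"
    unfolding Int_stable_def
  proof clarsimp
    fix F F' assume "finite F" "F \<subseteq> B" "finite F'" "F' \<subseteq> B"
    then show "\<Inter>F \<inter> \<Inter>F' \<in> ?G"
      by (intro rev_image_eqI[of "F \<union> F'"]) auto
  qed
  moreover have "UNIV \<in> ?G" by (rule rev_image_eqI[of "{}"]) auto
  ultimately show thesis using bB that by metis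
qed

text \<open>
  Measurability of \<open>Y\<close> with respect to the completed measure does not pass to \<open>(t, s) \<mapsto> Y (t - s)\<close>,
  which the Fubini arguments below need, so \<open>Y\<close> is replaced by a Borel version.
\<close>

lemma Y_family_kernel:
  fixes Y :: "real \<Rightarrow> (real ^ 'n) measure"
  assumes Y: "Y_family \<alpha>\<^sub>1 \<alpha>\<^sub>2 c Y"
  obtains Y' N where "borel_kernel Y'" "N \<in> null_sets lborel" "\<And>t. 0 < t \<Longrightarrow> t \<notin> N \<Longrightarrow> Y' t = Y t"
    "\<And>z \<xi>. 0 < z \<Longrightarrow> has_fourier_laplace Y' \<xi> z (1 / (inverse (Psi \<alpha>\<^sub>1 \<alpha>\<^sub>2 c z) + (norm \<xi>)\<^sup>2))"
proof -
  obtain G :: "(real ^ 'n) set set" where G: "countable G" "Int_stable G" "UNIV \<in> G"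
    "sets (borel :: (real ^ 'n) measure) = sigma_sets UNIV G"
    by (rule countable_Int_stable_generator)
  have GB: "A \<in> sets borel" if "A \<in> G" for A using G(4) that by auto
  \<comment> \<open>For a single set \<open>A\<close> the mass is only measurable for the
    completion, hence equal almost everywhere to a Borel function. As the generator is countable,
    all exceptional sets fit into one null set.\<close>
  have "\<exists>g\<in>borel_measurable lborel. AE t in lborel. (if t \<in> {0<..} then emeasure (Y t) A else 0) = g t"
    if "A \<in> G" for A
  proof -
    have "(\<lambda>t. emeasure (Y t) A) \<in> borel_measurable (lebesgue_on {0<..})"
      using Y GB[OF that] by (auto simp: Y_family_def)
    then have "(\<lambda>t. if t \<in> {0<..} then emeasure (Y t) A else 0) \<in> borel_measurable lebesgue"
      by (subst (asm) measurable_restrict_space_iff[where c=0]) auto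
    then show ?thesis by (rule completion_ex_borel_measurable)
  qed
  then have "\<exists>g. \<forall>A\<in>G. g A \<in> borel_measurable lborel \<and>
      (AE t in lborel. (if t \<in> {0<..} then emeasure (Y t) A else 0) = g A t)"
    by (intro bchoice ballI) blast
  then obtain g where g[measurable]: "\<And>A. A \<in> G \<Longrightarrow> g A \<in> borel_measurable lborel"
    and geq: "\<And>A. A \<in> G \<Longrightarrow> AE t in lborel. (if t \<in> {0<..} then emeasure (Y t) A else 0) = g A t"
    by blast
  have "AE t in lebesgue_on {0<..}. finite_measure (Y t) \<and> sets (Y t) = sets borel"
    using Y by (auto simp: Y_family_def)
  then have good: "AE t in lborel. t \<in> {0<..} \<longrightarrow> finite_measure (Y t) \<and> sets (Y t) = sets borel"
    by (subst (asm) AE_restrict_space_iff) (auto simp: AE_completion_iff)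
  have "AE t in lborel. \<forall>A\<in>G. (if t \<in> {0<..} then emeasure (Y t) A else 0) = g A t"
    unfolding AE_ball_countable[OF G(1)] using geq by blast
  with good have "AE t in lborel. (t \<in> {0<..} \<longrightarrow> finite_measure (Y t) \<and> sets (Y t) = sets borel) \<and>
      (\<forall>A\<in>G. (if t \<in> {0<..} then emeasure (Y t) A else 0) = g A t)"
    by eventually_elim simp
  then obtain N where N: "N \<in> null_sets lborel" and
    NP: "\<And>t. t \<notin> N \<Longrightarrow> (t \<in> {0<..} \<longrightarrow> finite_measure (Y t) \<and> sets (Y t) = sets borel) \<and>
      (\<forall>A\<in>G. (if t \<in> {0<..} then emeasure (Y t) A else 0) = g A t)"
    by (rule AE_E3) auto
  \<comment> \<open>The zero measure is a harmless value on \<open>N\<close> and for t \<le> 0: the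
    Laplace integrals run over t > 0 and ignore null sets, and the mass of each generator set
    becomes an indicator times the Borel function \<open>g A\<close>.\<close>
  define Y' where "Y' t = (if 0 < t \<and> t \<notin> N then Y t else null_measure borel)" for t
  have N'[measurable]: "N \<in> sets borel" using N by auto
  have emG: "(\<lambda>t. emeasure (Y' t) A) \<in> borel_measurable borel" if "A \<in> G" for A
  proof -
    have "(\<lambda>t. emeasure (Y' t) A) = (\<lambda>t. indicator ({0<..} - N) t * g A t)"
      using NP that by (fastforce simp: Y'_def indicator_def)
    then show ?thesis using g[OF that] by simp
  qed
  have K: "borel_kernel Y'"
  proof (rule borel_kernelI_generated[OF _ _ G(4,2) emG emG[OF G(3)]])
    show "finite_measure (Y' t)" "sets (Y' t) = sets borel" for t
      using NP[of t] by (auto simp: Y'_def intro!: finite_measureI)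
  qed
  have FL: "has_fourier_laplace Y' \<xi> z (1 / (inverse (Psi \<alpha>\<^sub>1 \<alpha>\<^sub>2 c z) + (norm \<xi>)\<^sup>2))" if "0 < z" for z \<xi>
  proof -
    have FL: "has_fourier_laplace Y \<xi> z (1 / (inverse (Psi \<alpha>\<^sub>1 \<alpha>\<^sub>2 c z) + (norm \<xi>)\<^sup>2))"
      using Y that by (auto simp: Y_family_def)
    then have m: "(\<lambda>t. exp (- z * t) *\<^sub>R fourier_measure (Y t) \<xi>) \<in> borel_measurable (lebesgue_on {0<..})"
      unfolding has_fourier_laplace_def by (rule borel_measurable_has_bochner_integral)
    have m': "(\<lambda>t. exp (- z * t) *\<^sub>R fourier_measure (Y' t) \<xi>) \<in> borel_measurable (lebesgue_on {0<..})"
      using measurable_fourier_kernel[OF K, of \<xi>] by (intro borel_measurable_lebesgue_on) measurable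
    have "AE t in lborel. t \<notin> N" using N by (rule AE_not_in)
    then have "AE t in lebesgue_on {0<..}. t \<notin> N"
      by (subst AE_restrict_space_iff) (auto simp: AE_completion_iff)
    then have "AE t in lebesgue_on {0<..}. exp (- z * t) *\<^sub>R fourier_measure (Y t) \<xi> =
        exp (- z * t) *\<^sub>R fourier_measure (Y' t) \<xi>"
      using AE_space[of "lebesgue_on {0::real<..}"] by eventually_elim (simp add: Y'_def space_restrict_space)
    with FL show ?thesis
      unfolding has_fourier_laplace_def using has_bochner_integral_cong_AE[OF m m'] by blast
  qed
  show thesis
    by (rule that[OF K N _ FL]) (auto simp: Y'_def)
qed

text \<open>Weak continuity controls integrals of bounded continuous functions. The indicator of a
  closed set is a bounded pointwise limit of such functions, and the closed sets form an
  intersection-stable generator.\<close>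

lemma Z_family_kernel:
  fixes Z :: "real \<Rightarrow> (real ^ 'n) measure"
  assumes Z: "Z_family \<alpha>\<^sub>1 \<alpha>\<^sub>2 c Z"
  obtains Z' where "borel_kernel Z'" "\<And>t. 0 < t \<Longrightarrow> Z' t = Z t"
    "\<And>z \<xi>. 0 < z \<Longrightarrow> has_fourier_laplace Z' \<xi> z
      (inverse (Psi \<alpha>\<^sub>1 \<alpha>\<^sub>2 c z) / (z * (inverse (Psi \<alpha>\<^sub>1 \<alpha>\<^sub>2 c z) + (norm \<xi>)\<^sup>2)))"
proof -
  define Z' where "Z' t = (if 0 < t then Z t else null_measure borel)" for t
  have prob: "prob_space (Z t)" and setsZ: "sets (Z t) = sets borel" if "0 < t" for t
    using Z that by (auto simp: Z_family_def)
  have fin: "finite_measure (Z' t)" and sets: "sets (Z' t) = sets borel" for t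
    using prob[of t] setsZ[of t] by (auto simp: Z'_def prob_space_def intro!: finite_measureI)
  have cl: "(\<lambda>t. emeasure (Z' t) A) \<in> borel_measurable borel" if A: "closed A" for A :: "(real ^ 'n) set"
  \<comment> \<open>The empty set is treated apart because \<open>infdist x {}\<close> is 0, which
    would make every \<open>f k\<close> constantly 1.\<close>
  proof (cases "A = {}")
    case False
    define f where "f k x = max 0 (1 - real k * infdist x A)" for k :: nat and x
    have f_cont: "continuous_on UNIV (f k)" for k
      unfolding f_def by (intro continuous_intros)
    have f_bound: "\<bar>f k x\<bar> \<le> 1" for k x
      unfolding f_def by (auto simp: infdist_nonneg)
    have f_lim: "(\<lambda>k. f k x) \<longlonglongrightarrow> indicator A x" for x
    proof (cases "x \<in> A")
      case True
      then show ?thesis by (simp add: f_def)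
    next
      case x: False
      then have pos: "0 < infdist x A"
        using in_closed_iff_infdist_zero[OF A False] infdist_nonneg[of x A] by (simp add: less_le)
      obtain k0 :: nat where k0: "1 / infdist x A < k0" using reals_Archimedean2 by blast
      have "f k x = 0" if "k \<ge> k0" for k
      proof -
        have "1 / infdist x A \<le> k" using k0 that by linarith
        then show ?thesis using pos by (simp add: f_def field_simps)
      qed
      then have "\<forall>\<^sub>F k in sequentially. f k x = indicator A x"
        using x by (auto simp: eventually_sequentially)
      then show ?thesis by (rule tendsto_eventually)
    qed
    have em: "ennreal (if 0 < t then \<integral>x. indicator A x \<partial>Z t else 0) = emeasure (Z' t) A" for t
    proof (cases "0 < t")
      case True
      interpret prob_space "Z t" by (rule prob[OF True])
      have "A \<in> sets (Z t)" using A setsZ[OF True] by auto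
      then show ?thesis using True by (simp add: Z'_def emeasure_eq_measure)
    qed (simp add: Z'_def)
    have "(\<lambda>t. if 0 < t then \<integral>x. indicator A x \<partial>Z t else (0::real)) \<in> borel_measurable borel"
    proof (rule borel_measurable_LIMSEQ_real)
      show "(\<lambda>k. if 0 < t then \<integral>x. f k x \<partial>Z t else 0)
          \<longlonglongrightarrow> (if 0 < t then \<integral>x. indicator A x \<partial>Z t else 0)" for t
      proof (cases "0 < t")
        case True
        interpret prob_space "Z t" by (rule prob[OF True])
        have [measurable_cong]: "sets (Z t) = sets borel" by (rule setsZ[OF True])
        have "indicat_real A \<in> borel_measurable (Z t)"
          using A setsZ[OF True] by (intro borel_measurable_indicator) auto
        then        have "(\<lambda>k. \<integral>x. f k x \<partial>Z t) \<longlonglongrightarrow> (\<integral>x. indicator A x \<partial>Z t)"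
          using A f_bound f_lim borel_measurable_continuous_onI[OF f_cont]
          by (intro integral_dominated_convergence[where w="\<lambda>_. 1"]) auto
        then show ?thesis using True by simp
      qed simp
      show "(\<lambda>t. if 0 < t then \<integral>x. f k x \<partial>Z t else 0) \<in> borel_measurable borel" for k
      proof -
        have "bounded (range (f k))" using f_bound by (auto simp: bounded_iff)
        then have "continuous_on {0<..} (\<lambda>t. \<integral>x. f k x \<partial>Z t)"
          using Z f_cont by (auto simp: Z_family_def)
        then have "(\<lambda>t. indicator {0<..} t *\<^sub>R (\<integral>x. f k x \<partial>Z t)) \<in> borel_measurable borel"
          by (intro borel_measurable_continuous_on_indicator) auto
        also have "(\<lambda>t. indicator {0<..} t *\<^sub>R (\<integral>x. f k x \<partial>Z t)) = (\<lambda>t. if 0 < t then \<integral>x. f k x \<partial>Z t else 0)"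
          by (auto simp: indicator_def)
        finally show ?thesis .
      qed
    qed
    then show ?thesis unfolding em[symmetric] by simp
  qed simp
  have K: "borel_kernel Z'"
  proof (rule borel_kernelI_generated[OF fin sets, where G="Collect closed"])
    show "sets (borel :: (real ^ 'n) measure) = sigma_sets UNIV (Collect closed)"
      by (subst borel_eq_closed) simp
  qed (auto simp: Int_stable_def cl)
  have FL: "has_fourier_laplace Z' \<xi> z
      (inverse (Psi \<alpha>\<^sub>1 \<alpha>\<^sub>2 c z) / (z * (inverse (Psi \<alpha>\<^sub>1 \<alpha>\<^sub>2 c z) + (norm \<xi>)\<^sup>2)))" if "0 < z" for z \<xi>
  proof -
    have "has_fourier_laplace Z \<xi> z
      (inverse (Psi \<alpha>\<^sub>1 \<alpha>\<^sub>2 c z) / (z * (inverse (Psi \<alpha>\<^sub>1 \<alpha>\<^sub>2 c z) + (norm \<xi>)\<^sup>2)))"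
      using Z that by (auto simp: Z_family_def)
    then show ?thesis
      unfolding has_fourier_laplace_def
      by (rule has_bochner_integral_cong[THEN iffD1, rotated -1]) (auto simp: Z'_def space_restrict_space)
  qed
  show thesis
    by (rule that[OF K _ FL]) (auto simp: Z'_def)
qed

section \<open>Scalar inequalities\<close>

text \<open>The graph of v^p lies above its tangent at \<open>m\<close>. Being affine in
  \<open>v\<close>, the inequality can be integrated against any weight, with \<open>m\<close> still
  free.\<close>

lemma powr_ge_tangent:
  fixes m v p :: real
  assumes m: "0 < m" and v: "0 \<le> v" and p: "1 < p"
  shows "p * m powr (p - 1) * v \<le> v powr p + (p - 1) * m powr p"
proof (cases "v = 0")
  case True
  then show ?thesis using p by simp
next
  case False
  then have v: "0 < v" using v by simp
  define x where "x = v / m"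
  have x: "0 < x" using v m by (simp add: x_def)
  \<comment> \<open>Two instances of 1 + y \<le> exp y, namely x (1 + (p - 1) ln x) \<le> x^p and x
    (1 - ln x) \<le> 1; adding the second with weight p - 1 removes the logarithm.\<close>
  have "x * (1 + (p - 1) * ln x) \<le> x * exp ((p - 1) * ln x)"
    using x by (intro mult_left_mono exp_ge_add_one_self) auto
  also have "\<dots> = x powr p"
    using x by (simp add: powr_def algebra_simps exp_add exp_diff)
  finally have 1: "x * (1 + (p - 1) * ln x) \<le> x powr p" .
  have "x * (1 + - ln x) \<le> x * exp (- ln x)"
    using x by (intro mult_left_mono exp_ge_add_one_self) auto
  also have "\<dots> = 1" using x by (simp add: exp_minus)
  finally have "(p - 1) * (x * (1 + - ln x)) \<le> (p - 1) * 1"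
    using p by (intro mult_left_mono) auto
  with 1 have "p * x \<le> x powr p + (p - 1)"
    by (simp add: algebra_simps)
  then have "m powr p * (p * x) \<le> m powr p * (x powr p + (p - 1))"
    by (intro mult_left_mono) auto
  also have "m powr p * (x powr p + (p - 1)) = v powr p + (p - 1) * m powr p"
    using m v by (simp add: x_def powr_divide distrib_left)
  also have "m powr p * (p * x) = p * m powr (p - 1) * v"
    using m by (simp add: x_def powr_diff)
  finally show ?thesis .
qed

text \<open>
  A delayed superlinear growth inequality whose constant degenerates only polynomially in the
  delay forces blow-up within one time unit as soon as \<open>F T / T\<close> is large: iterate it
  with the delays \<open>1/2, 1/4, 1/8, \<dots>\<close>.
\<close>

lemma linear_bound_of_delayed_growth:
  fixes F :: "real \<Rightarrow> real" and b c p :: real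
  assumes mono: "\<And>s t. 0 < s \<Longrightarrow> s \<le> t \<Longrightarrow> F s \<le> F t" and nonneg: "\<And>t. 0 \<le> F t"
    and b: "0 < b" and c: "0 < c" and p: "1 < p"
    and growth: "\<And>t \<epsilon>. 1 \<le> t \<Longrightarrow> 0 < \<epsilon> \<Longrightarrow> \<epsilon> \<le> 1 \<Longrightarrow>
      c * \<epsilon>\<^sup>2 * (b * t) * (F t / (b * t)) powr p \<le> F (t + \<epsilon>)"
  obtains C where "0 < C" "\<And>t. 1 \<le> t \<Longrightarrow> F t \<le> C * (t + 1)"
proof -
  \<comment> \<open>In step k the delay is (1/2)^(k+1), and the growth factor is at least
    \<delta>^(k+1). The base \<open>D\<close> satisfies D^(p-1) = 1/\<delta>, so the gain of the
    p-th power outweighs \<delta>^k, and V^(p-1) = D/\<delta> leaves exactly one more factor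
    \<open>D\<close> per step.\<close>
  define \<delta> where "\<delta> = min c 1 / 4"
  have \<delta>: "0 < \<delta>" "\<delta> < 1" using c by (auto simp: \<delta>_def)
  define D where "D = \<delta> powr (- 1 / (p - 1))"
  have D: "1 < D"
    unfolding D_def using powr_less_mono2_neg[of "- 1 / (p - 1)" \<delta> 1] \<delta> p by simp
  have Dp: "D powr (p - 1) = 1 / \<delta>"
  proof -
    have e: "- 1 / (p - 1) * (p - 1) = - 1" using p by simp
    show ?thesis unfolding D_def powr_powr e using \<delta> by (simp add: powr_minus_divide)
  qed
  define V where "V = (D / \<delta>) powr (1 / (p - 1))"
  have V: "0 < V" using D \<delta> by (simp add: V_def)
  have Vp: "V powr (p - 1) = D / \<delta>"
    using D \<delta> p by (simp add: V_def powr_powr)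
  have small: "F T < V * b * (T + 1)" if T: "1 \<le> T" for T
  proof (rule ccontr)
    assume "\<not> ?thesis"
    then have start: "V * b * (T + 1) \<le> F T" by simp
    define B where "B = b * (T + 1)"
    have B: "0 < B" using b T by (simp add: B_def)
    \<comment> \<open>The times start at \<open>T\<close>, advance by the delays and never pass
      \<open>T + 1\<close>, where the finite value \<open>F (T + 1)\<close> has to dominate all the
      iterates.\<close>
    define t where "t k = T + 1 - (1 / 2) ^ k" for k :: nat
    have t: "1 \<le> t k" "T \<le> t k" "t k \<le> T + 1" for k
      using T power_le_one[of "1/2::real" k] by (auto simp: t_def)
    have iter: "V * D ^ k * B \<le> F (t k)" for k
    proof (induction k)
      case 0
      show ?case using start by (simp add: t_def B_def mult_ac)
    next
      case (Suc k)
      define \<epsilon> :: real where "\<epsilon> = (1 / 2) ^ Suc k"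
      have \<epsilon>: "0 < \<epsilon>" "\<epsilon> \<le> 1" using power_le_one[of "1/2::real" "Suc k"] by (auto simp: \<epsilon>_def)
      have tk: "t k + \<epsilon> = t (Suc k)" by (simp add: t_def \<epsilon>_def)
      let ?f = "F (t k)" and ?a = "b * t k"
      have a: "0 < ?a" "?a \<le> B" using b t[of k] by (auto simp: B_def)
      \<comment> \<open>Since a (F/a)^p = F^p a^(1-p) decreases in a, replacing a = b t_k by the
        fixed larger \<open>B\<close> is on the safe side and keeps the normalization constant along
        the iteration.\<close>
      have "(V * D ^ k) powr p * B = (V * D ^ k * B) powr p * B powr (1 - p)"
        using V D B by (simp add: powr_mult powr_diff)
      also have "\<dots> \<le> ?f powr p * B powr (1 - p)"
        using Suc.IH V D B p by (intro mult_right_mono powr_mono2) auto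
      also have "\<dots> \<le> ?f powr p * ?a powr (1 - p)"
        using a p by (intro mult_left_mono powr_mono2') auto
      also have "\<dots> = ?a * (?f / ?a) powr p"
        using a nonneg[of "t k"] by (simp add: powr_divide powr_diff)
      finally have 1: "(V * D ^ k) powr p * B \<le> ?a * (?f / ?a) powr p" .
      have "\<delta> ^ Suc k \<le> c * \<epsilon>\<^sup>2"
      proof -
        have "(min c 1) ^ Suc k \<le> min c 1 * 1"
          using c power_le_one[of "min c 1" k] unfolding power_Suc by (intro mult_left_mono) auto
        then have "(min c 1) ^ Suc k \<le> c" by simp
        moreover have "\<epsilon>\<^sup>2 = (1 / 4) ^ Suc k"
          unfolding \<epsilon>_def power_mult[symmetric] by (subst mult.commute) (simp only: power_mult, simp add: power2_eq_square)
        ultimately show ?thesis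
          by (simp add: \<delta>_def power_divide power_one_over divide_right_mono del: power_Suc)
      qed
      then have "\<delta> ^ Suc k * ((V * D ^ k) powr p * B) \<le> c * \<epsilon>\<^sup>2 * (?a * (?f / ?a) powr p)"
        by (rule mult_mono[OF _ 1]) (use B c in auto)
      also have "\<dots> \<le> F (t (Suc k))"
        using growth[OF t(1)[of k] \<epsilon>] by (simp add: tk mult.assoc)
      finally have 2: "\<delta> ^ Suc k * ((V * D ^ k) powr p * B) \<le> F (t (Suc k))" .
      have "(V * D ^ k) powr p = (V * D ^ k) * (V * D ^ k) powr (p - 1)"
        using V D by (simp add: powr_diff)
      also have "(V * D ^ k) powr (p - 1) = V powr (p - 1) * (D powr (p - 1)) ^ k"
        using V D by (simp add: powr_mult powr_powr mult.commute flip: powr_realpow)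
      also have "\<dots> = D / \<delta> * (1 / \<delta>) ^ k" by (simp only: Vp Dp)
      finally have "\<delta> ^ Suc k * (V * D ^ k) powr p = V * D ^ Suc k"
        using \<delta> by (simp add: power_one_over field_simps)
      with 2 show ?case by (simp add: mult.assoc[symmetric])
    qed
    have "V * D ^ k * B \<le> F (T + 1)" for k
      using iter[of k] mono[of "t k" "T + 1"] t[of k] by linarith
    then have "D ^ k \<le> F (T + 1) / (V * B)" for k
      using V B by (simp add: field_simps)
    moreover obtain k where "F (T + 1) / (V * B) < D ^ k"
      using real_arch_pow[OF D] by blast
    ultimately show False by (meson not_le)
  qed
  show thesis
    by (rule that[of "V * b"]) (use V b small in \<open>auto intro: less_imp_le\<close>)
qed

text \<open>One term of the exponential series. A power above 2 is wanted, because the tail exp(-K /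
  (2 \<epsilon>)) is to be beaten by a multiple of \<epsilon>^2.\<close>

lemma exp_minus_le_cube:
  fixes x :: real
  assumes "0 < x"
  shows "exp (- x) \<le> 6 / x ^ 3"
proof -
  have "x ^ 3 / fact 3 \<le> exp x"
    using sum_le_suminf[OF summable_exp_generic, of "{3}" x] assms
    by (simp add: exp_def scaleR_conv_of_real divide_inverse mult.commute)
  then show ?thesis using assms by (simp add: exp_minus fact_numeral field_simps)
qed

text \<open>This is the numerical core of the short-time bound at z = K / \<epsilon>^2. The
  resolvent part is at least \<epsilon>^2 / (2 K), the tail at most 96 \<epsilon>^3 / K^3, and K
  \<ge> 20 pushes the latter below 0.48 \<epsilon>^2 / K.\<close>

lemma resolvent_minus_tail:
  fixes K \<mu> \<epsilon> :: real
  assumes K: "20 \<le> K" "\<mu> \<le> K" and \<mu>: "0 \<le> \<mu>" and \<epsilon>: "0 < \<epsilon>" "\<epsilon> \<le> 1"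
  shows "1 / (100 * K) * \<epsilon>\<^sup>2 \<le> 1 / (K / \<epsilon>\<^sup>2 + \<mu>) - 2 * exp (- (K / \<epsilon>\<^sup>2) * \<epsilon> / 2)"
proof -
  have e2: "\<epsilon>\<^sup>2 \<le> 1" using \<epsilon> by (simp add: power_le_one)
  have "K / \<epsilon>\<^sup>2 + \<mu> \<le> 2 * K / \<epsilon>\<^sup>2"
  proof -
    have "\<mu> * \<epsilon>\<^sup>2 \<le> K * 1" using K \<mu> e2 by (intro mult_mono) auto
    then have "\<mu> \<le> K / \<epsilon>\<^sup>2" using \<epsilon> by (simp add: pos_le_divide_eq)
    then show ?thesis by simp
  qed
  moreover have "0 < K / \<epsilon>\<^sup>2 + \<mu>" using K \<mu> \<epsilon> by (simp add: add_pos_nonneg)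
  ultimately have 1: "\<epsilon>\<^sup>2 / (2 * K) \<le> 1 / (K / \<epsilon>\<^sup>2 + \<mu>)"
    using K \<epsilon> by (simp add: field_simps)
  have eq: "(K / \<epsilon>\<^sup>2) * \<epsilon> / 2 = K / (2 * \<epsilon>)"
    using \<epsilon> by (simp add: power2_eq_square)
  have "2 * exp (- (K / (2 * \<epsilon>))) \<le> 2 * (6 / (K / (2 * \<epsilon>)) ^ 3)"
    using K \<epsilon> by (intro mult_left_mono exp_minus_le_cube) auto
  also have "\<dots> = 96 / K ^ 3 * (\<epsilon>\<^sup>2 * \<epsilon>)"
    using K \<epsilon> by (simp add: power_divide power_mult_distrib field_simps power2_eq_square power3_eq_cube)
  also have "\<dots> \<le> 96 / K ^ 3 * (\<epsilon>\<^sup>2 * 1)"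
    using K \<epsilon> by (intro mult_left_mono) auto
  also have "96 / K ^ 3 \<le> 48 / 100 / K"
  proof -
    have "200 \<le> K * K" using mult_mono[of 20 K 20 K] K by auto
    then have "96 / (K * K) \<le> 96 / 200" by (intro frac_le) auto
    then have "96 / (K * K) / K \<le> 96 / 200 / K" using K by (intro divide_right_mono) auto
    then show ?thesis by (simp add: power3_eq_cube)
  qed
  finally have 2: "2 * exp (- (K / (2 * \<epsilon>))) \<le> 48 / 100 / K * \<epsilon>\<^sup>2"
    using \<epsilon> by (simp add: mult_right_mono)
  have "- (K / \<epsilon>\<^sup>2) * \<epsilon> / 2 = - (K / (2 * \<epsilon>))" using eq by simp
  then have "1 / (K / \<epsilon>\<^sup>2 + \<mu>) - 2 * exp (- (K / \<epsilon>\<^sup>2) * \<epsilon> / 2) \<ge> \<epsilon>\<^sup>2 / (2 * K) - 48 / 100 / K * \<epsilon>\<^sup>2"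
    using 1 2 by simp
  moreover have "\<epsilon>\<^sup>2 / (2 * K) - 48 / 100 / K * \<epsilon>\<^sup>2 \<ge> 1 / (100 * K) * \<epsilon>\<^sup>2"
    using K \<epsilon> by (simp add: field_simps)
  ultimately show ?thesis by linarith
qed

text \<open>\<open>Bfun\<close> is the weighted mean of \<open>\<alpha>\<^sub>2\<close> and
  \<open>\<alpha>\<^sub>1\<close> with weights \<open>c\<close> and \<open>z\<close>.\<close>

lemma Bfun_bounds:
  assumes "0 < \<alpha>\<^sub>1" "\<alpha>\<^sub>1 < 1" "0 < \<alpha>\<^sub>2" "\<alpha>\<^sub>2 < 1" "0 < c" "0 < z"
  shows "min \<alpha>\<^sub>1 \<alpha>\<^sub>2 \<le> Bfun \<alpha>\<^sub>1 \<alpha>\<^sub>2 c z" "Bfun \<alpha>\<^sub>1 \<alpha>\<^sub>2 c z < 1"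
proof -
  have pos: "0 < c + z" using assms by simp
  have "min \<alpha>\<^sub>1 \<alpha>\<^sub>2 * c + min \<alpha>\<^sub>1 \<alpha>\<^sub>2 * z \<le> \<alpha>\<^sub>2 * c + \<alpha>\<^sub>1 * z"
    using assms by (intro add_mono mult_right_mono) auto
  then show "min \<alpha>\<^sub>1 \<alpha>\<^sub>2 \<le> Bfun \<alpha>\<^sub>1 \<alpha>\<^sub>2 c z"
    using pos by (simp add: Bfun_def pos_le_divide_eq algebra_simps)
  have "\<alpha>\<^sub>2 * c + \<alpha>\<^sub>1 * z < 1 * c + 1 * z"
    using assms by (intro add_strict_mono mult_strict_right_mono) auto
  then show "Bfun \<alpha>\<^sub>1 \<alpha>\<^sub>2 c z < 1"
    using pos by (simp add: Bfun_def)
qed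

lemma inverse_Psi:
  "0 < z \<Longrightarrow> inverse (Psi \<alpha>\<^sub>1 \<alpha>\<^sub>2 c z) = z powr Bfun \<alpha>\<^sub>1 \<alpha>\<^sub>2 c z"
  by (simp add: Psi_def powr_minus)

lemma inverse_Psi_bounds:
  assumes "0 < \<alpha>\<^sub>1" "\<alpha>\<^sub>1 < 1" "0 < \<alpha>\<^sub>2" "\<alpha>\<^sub>2 < 1" "0 < c" "1 \<le> z"
  shows "1 \<le> inverse (Psi \<alpha>\<^sub>1 \<alpha>\<^sub>2 c z)" "inverse (Psi \<alpha>\<^sub>1 \<alpha>\<^sub>2 c z) \<le> z"
proof -
  have z: "0 < z" using assms by simp
  note B = Bfun_bounds[OF assms(1-5) z]
  have "0 \<le> Bfun \<alpha>\<^sub>1 \<alpha>\<^sub>2 c z" using B(1) assms by linarith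
  then show "1 \<le> inverse (Psi \<alpha>\<^sub>1 \<alpha>\<^sub>2 c z)"
    using assms z by (simp add: inverse_Psi ge_one_powr_ge_zero)
  show "inverse (Psi \<alpha>\<^sub>1 \<alpha>\<^sub>2 c z) \<le> z"
    using powr_mono[of "Bfun \<alpha>\<^sub>1 \<alpha>\<^sub>2 c z" 1 z] B(2) assms z by (simp add: inverse_Psi)
qed

lemma inverse_Psi_tendsto_0:
  assumes "0 < \<alpha>\<^sub>1" "\<alpha>\<^sub>1 < 1" "0 < \<alpha>\<^sub>2" "\<alpha>\<^sub>2 < 1" "0 < c"
  shows "((\<lambda>z. inverse (Psi \<alpha>\<^sub>1 \<alpha>\<^sub>2 c z)) \<longlongrightarrow> 0) (at_right 0)"
proof (rule tendsto_sandwich)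
  have ev: "\<forall>\<^sub>F z::real in at_right 0. z \<in> {0<..<1}"
    by (rule eventually_at_right_real) simp
  then show "\<forall>\<^sub>F z in at_right 0. 0 \<le> inverse (Psi \<alpha>\<^sub>1 \<alpha>\<^sub>2 c z)"
    by eventually_elim (simp add: inverse_Psi)
  show "\<forall>\<^sub>F z in at_right 0. inverse (Psi \<alpha>\<^sub>1 \<alpha>\<^sub>2 c z) \<le> z powr (min \<alpha>\<^sub>1 \<alpha>\<^sub>2)"
    using ev
  proof eventually_elim
    case (elim z)
    then show ?case
      using Bfun_bounds[OF assms, of z] by (simp add: inverse_Psi powr_mono')
  qed
  show "((\<lambda>z. z powr (min \<alpha>\<^sub>1 \<alpha>\<^sub>2)) \<longlongrightarrow> 0) (at_right 0)"
  proof -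
    have "\<forall>\<^sub>F z::real in at_right 0. 0 \<le> z"
      using ev by eventually_elim simp
    then have "((\<lambda>z. z powr (min \<alpha>\<^sub>1 \<alpha>\<^sub>2)) \<longlongrightarrow> 0 powr (min \<alpha>\<^sub>1 \<alpha>\<^sub>2)) (at_right 0)"
      using assms by (intro tendsto_powr' tendsto_const tendsto_ident_at) auto
    then show ?thesis by simp
  qed
qed simp

section \<open>Global supersolutions of the weak Duhamel inequality\<close>

text \<open>The adjoint of convolution with \<open>M t\<close>, hence \<open>x + y\<close> in place
  of \<open>x - y\<close>: it arises when the measure is moved from the solution onto the test
  function.\<close>

definition kernel_average ::
    "(real \<Rightarrow> 'a::euclidean_space measure) \<Rightarrow> ('a \<Rightarrow> ennreal) \<Rightarrow> real \<Rightarrow> 'a \<Rightarrow> ennreal" where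
  "kernel_average M \<phi> t x = (\<integral>\<^sup>+y. \<phi> (x + y) \<partial>M t)"

lemma measurable_kernel_average:
  assumes "borel_kernel M" and [measurable]: "\<phi> \<in> borel_measurable borel"
    and [measurable]: "f \<in> N \<rightarrow>\<^sub>M borel" "g \<in> N \<rightarrow>\<^sub>M borel"
  shows "(\<lambda>w. kernel_average M \<phi> (f w) (g w)) \<in> borel_measurable N"
  unfolding kernel_average_def
  by (rule measurable_nn_integral_kernel[OF assms(1)]) measurable

lemma laplace_kernel_average:
  fixes M :: "real \<Rightarrow> (real ^ 'n) measure"
  assumes M: "borel_kernel M" and l: "0 < l" and C: "0 \<le> C"
    and FL: "\<And>\<xi>. has_fourier_laplace M \<xi> z (C / (l + (norm \<xi>)\<^sup>2))"
  obtains R where "resolvent_measure R C l"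
    "\<And>\<phi> x. \<phi> \<in> borel_measurable borel \<Longrightarrow>
      (\<integral>\<^sup>+t\<in>{0<..}. ennreal (exp (- z * t)) * kernel_average M \<phi> t x \<partial>lborel) = (\<integral>\<^sup>+y. \<phi> (x + y) \<partial>R)"
proof -
  obtain R where R: "resolvent_measure R C l"
    "\<And>f. f \<in> borel_measurable borel \<Longrightarrow> (\<integral>\<^sup>+y. f y \<partial>R) =
      (\<integral>\<^sup>+t\<in>{0<..}. ennreal (exp (- z * t)) * (\<integral>\<^sup>+y. f y \<partial>M t) \<partial>lborel)"
    using laplace_resolvent[OF assms] by blast
  show thesis
  proof (rule that[OF R(1)])
    fix \<phi> :: "real ^ 'n \<Rightarrow> ennreal" and x
    assume [measurable]: "\<phi> \<in> borel_measurable borel"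
    show "(\<integral>\<^sup>+t\<in>{0<..}. ennreal (exp (- z * t)) * kernel_average M \<phi> t x \<partial>lborel) = (\<integral>\<^sup>+y. \<phi> (x + y) \<partial>R)"
      unfolding kernel_average_def by (rule R(2)[symmetric]) measurable
  qed
qed

text \<open>What the argument needs from a global solution: the mild equation as an inequality
  tested with nonnegative functions, together with L^1 bounds on bounded time intervals.
  \<open>l\<close> stands for the inverse of \<Psi>; its two-sided bound for z \<ge> 1 serves the
  short-time estimate.\<close>

locale global_supersolution =
  fixes p :: real and l :: "real \<Rightarrow> real" and Z Y :: "real \<Rightarrow> (real ^ 'n) measure"
    and w :: "real ^ 'n \<Rightarrow> ennreal" and V :: "real \<Rightarrow> real ^ 'n \<Rightarrow> real"
  assumes p: "1 < p"
    and l_pos: "\<And>z. 0 < z \<Longrightarrow> 0 < l z"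
    and l_ge: "\<And>z. 1 \<le> z \<Longrightarrow> 1 \<le> l z" and l_le: "\<And>z. 1 \<le> z \<Longrightarrow> l z \<le> z"
    and Z: "borel_kernel Z" and Y: "borel_kernel Y"
    and Z_laplace: "\<And>z \<xi>. 0 < z \<Longrightarrow>
      has_fourier_laplace Z \<xi> z (l z / (z * (l z + (norm \<xi>)\<^sup>2)))"
    and Y_laplace: "\<And>z \<xi>. 0 < z \<Longrightarrow> has_fourier_laplace Y \<xi> z (1 / (l z + (norm \<xi>)\<^sup>2))"
    and w: "w \<in> borel_measurable borel"
    and V: "(\<lambda>(t, x). V t x) \<in> borel_measurable (borel \<Otimes>\<^sub>M borel)"
    and V_nonneg: "\<And>t x. 0 \<le> V t x"
    and V_bounded: "\<And>T. \<exists>B::real. \<forall>t\<in>{0<..T}. (\<integral>\<^sup>+x. ennreal (V t x) \<partial>lborel) \<le> ennreal B"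
    and duhamel: "\<And>t \<phi>. 0 < t \<Longrightarrow> \<phi> \<in> borel_measurable borel \<Longrightarrow>
      (\<integral>\<^sup>+x. w x * kernel_average Z \<phi> t x \<partial>lborel) +
      (\<integral>\<^sup>+s\<in>{0<..<t}. (\<integral>\<^sup>+x. ennreal (V s x powr p) * kernel_average Y \<phi> (t - s) x \<partial>lborel) \<partial>lborel)
      \<le> (\<integral>\<^sup>+x. \<phi> x * ennreal (V t x) \<partial>lborel)"
begin

lemmas [measurable] = w measurable_kernel_average[OF Z] measurable_kernel_average[OF Y]

lemma V_measurable[measurable (raw)]:
  assumes [measurable]: "f \<in> borel_measurable N" "g \<in> N \<rightarrow>\<^sub>M borel"
  shows "(\<lambda>q. V (f q) (g q)) \<in> borel_measurable N"
  using measurable_compose[OF measurable_Pair[OF assms] V] by simp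

section \<open>Testing the inequality with a weight in time\<close>

definition mass :: "(real ^ 'n \<Rightarrow> ennreal) \<Rightarrow> real \<Rightarrow> ennreal" where
  "mass \<phi> t = (\<integral>\<^sup>+x. \<phi> x * ennreal (V t x) \<partial>lborel)"

definition energy :: "(real ^ 'n \<Rightarrow> ennreal) \<Rightarrow> real \<Rightarrow> ennreal" where
  "energy \<phi> t = (\<integral>\<^sup>+x. \<phi> x * ennreal (V t x powr p) \<partial>lborel)"

lemma measurable_mass[measurable]:
  assumes [measurable]: "\<phi> \<in> borel_measurable borel"
  shows "mass \<phi> \<in> borel_measurable borel"
  unfolding mass_def by measurable

lemma measurable_energy[measurable]:
  assumes [measurable]: "\<phi> \<in> borel_measurable borel"
  shows "energy \<phi> \<in> borel_measurable borel"
  unfolding energy_def by measurable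

text \<open>Integrate the tested inequality against \<omega>(t) dt and use Tonelli; the substitution
  t = s + \<tau> decouples the time convolution. An exponential \<omega> gives Laplace transforms,
  the indicator of a half-line gives the delayed growth inequality.\<close>

lemma weighted_duhamel:
  assumes [measurable]: "\<omega> \<in> borel_measurable borel" "\<phi> \<in> borel_measurable borel"
  shows "(\<integral>\<^sup>+x. w x * (\<integral>\<^sup>+t\<in>{0<..}. \<omega> t * kernel_average Z \<phi> t x \<partial>lborel) \<partial>lborel) +
    (\<integral>\<^sup>+s\<in>{0<..}. (\<integral>\<^sup>+x. ennreal (V s x powr p) *
      (\<integral>\<^sup>+\<tau>\<in>{0<..}. \<omega> (s + \<tau>) * kernel_average Y \<phi> \<tau> x \<partial>lborel) \<partial>lborel) \<partial>lborel)
    \<le> (\<integral>\<^sup>+t\<in>{0<..}. \<omega> t * mass \<phi> t \<partial>lborel)"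
proof -
  let ?I = "indicator {0::real<..} :: real \<Rightarrow> ennreal"
  let ?A = "\<lambda>t. \<integral>\<^sup>+x. w x * kernel_average Z \<phi> t x \<partial>lborel"
  let ?H = "\<lambda>s \<tau>. \<integral>\<^sup>+x. ennreal (V s x powr p) * kernel_average Y \<phi> \<tau> x \<partial>lborel"
  have "(\<integral>\<^sup>+x. w x * (\<integral>\<^sup>+t\<in>{0<..}. \<omega> t * kernel_average Z \<phi> t x \<partial>lborel) \<partial>lborel) =
      (\<integral>\<^sup>+x. \<integral>\<^sup>+t. \<omega> t * ?I t * (w x * kernel_average Z \<phi> t x) \<partial>lborel \<partial>lborel)"
    by (subst nn_integral_cmult[symmetric]) (simp_all add: mult_ac)
  also have "\<dots> = (\<integral>\<^sup>+t. \<integral>\<^sup>+x. \<omega> t * ?I t * (w x * kernel_average Z \<phi> t x) \<partial>lborel \<partial>lborel)"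
    by (rule lborel_pair.Fubini') measurable
  also have "\<dots> = (\<integral>\<^sup>+t. \<omega> t * ?I t * ?A t \<partial>lborel)"
    by (subst nn_integral_cmult) simp_all
  finally have A: "(\<integral>\<^sup>+x. w x * (\<integral>\<^sup>+t\<in>{0<..}. \<omega> t * kernel_average Z \<phi> t x \<partial>lborel) \<partial>lborel) =
      (\<integral>\<^sup>+t. \<omega> t * ?I t * ?A t \<partial>lborel)" .
  have "(\<integral>\<^sup>+s\<in>{0<..}. (\<integral>\<^sup>+x. ennreal (V s x powr p) *
      (\<integral>\<^sup>+\<tau>\<in>{0<..}. \<omega> (s + \<tau>) * kernel_average Y \<phi> \<tau> x \<partial>lborel) \<partial>lborel) \<partial>lborel) =
      (\<integral>\<^sup>+s. \<integral>\<^sup>+\<tau>. \<omega> (s + \<tau>) * (?I s * ?I \<tau>) * ?H s \<tau> \<partial>lborel \<partial>lborel)"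
  proof (rule nn_integral_cong)
    fix s
    have "(\<integral>\<^sup>+x. ennreal (V s x powr p) *
        (\<integral>\<^sup>+\<tau>\<in>{0<..}. \<omega> (s + \<tau>) * kernel_average Y \<phi> \<tau> x \<partial>lborel) \<partial>lborel) * ?I s =
        (\<integral>\<^sup>+x. \<integral>\<^sup>+\<tau>. \<omega> (s + \<tau>) * (?I s * ?I \<tau>) *
          (ennreal (V s x powr p) * kernel_average Y \<phi> \<tau> x) \<partial>lborel \<partial>lborel)"
      by (subst nn_integral_cmult[symmetric], measurable, subst nn_integral_multc[symmetric], measurable)
        (subst nn_integral_multc[symmetric], simp_all add: mult_ac)
    also have "\<dots> = (\<integral>\<^sup>+\<tau>. \<integral>\<^sup>+x. \<omega> (s + \<tau>) * (?I s * ?I \<tau>) *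
          (ennreal (V s x powr p) * kernel_average Y \<phi> \<tau> x) \<partial>lborel \<partial>lborel)"
      by (rule lborel_pair.Fubini') measurable
    also have "\<dots> = (\<integral>\<^sup>+\<tau>. \<omega> (s + \<tau>) * (?I s * ?I \<tau>) * ?H s \<tau> \<partial>lborel)"
      by (subst nn_integral_cmult) simp_all
    finally show "(\<integral>\<^sup>+x. ennreal (V s x powr p) *
        (\<integral>\<^sup>+\<tau>\<in>{0<..}. \<omega> (s + \<tau>) * kernel_average Y \<phi> \<tau> x \<partial>lborel) \<partial>lborel) * ?I s =
        (\<integral>\<^sup>+\<tau>. \<omega> (s + \<tau>) * (?I s * ?I \<tau>) * ?H s \<tau> \<partial>lborel)" .
  qed
  also have "\<dots> = (\<integral>\<^sup>+s. \<integral>\<^sup>+t. \<omega> t * (?I s * ?I (t - s)) * ?H s (t - s) \<partial>lborel \<partial>lborel)"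
  proof (rule nn_integral_cong)
    fix s
    show "(\<integral>\<^sup>+\<tau>. \<omega> (s + \<tau>) * (?I s * ?I \<tau>) * ?H s \<tau> \<partial>lborel) =
        (\<integral>\<^sup>+t. \<omega> t * (?I s * ?I (t - s)) * ?H s (t - s) \<partial>lborel)"
      by (subst nn_integral_real_affine[where c=1 and t=s,
            of "\<lambda>t. \<omega> t * (?I s * ?I (t - s)) * ?H s (t - s)"]) simp_all
  qed
  also have "\<dots> = (\<integral>\<^sup>+t. \<integral>\<^sup>+s. \<omega> t * (?I s * ?I (t - s)) * ?H s (t - s) \<partial>lborel \<partial>lborel)"
    by (rule lborel_pair.Fubini') measurable
  also have "\<dots> = (\<integral>\<^sup>+t. \<omega> t * ?I t * (\<integral>\<^sup>+s\<in>{0<..<t}. ?H s (t - s) \<partial>lborel) \<partial>lborel)"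
  proof (rule nn_integral_cong)
    fix t :: real
    have "\<omega> t * ?I t * (\<integral>\<^sup>+s\<in>{0<..<t}. ?H s (t - s) \<partial>lborel) =
        (\<integral>\<^sup>+s. \<omega> t * ?I t * (?H s (t - s) * indicator {0<..<t} s) \<partial>lborel)"
      by (rule nn_integral_cmult[symmetric]) measurable
    also have "\<dots> = (\<integral>\<^sup>+s. \<omega> t * (?I s * ?I (t - s)) * ?H s (t - s) \<partial>lborel)"
      by (rule nn_integral_cong) (auto simp: indicator_def)
    finally show "(\<integral>\<^sup>+s. \<omega> t * (?I s * ?I (t - s)) * ?H s (t - s) \<partial>lborel) =
        \<omega> t * ?I t * (\<integral>\<^sup>+s\<in>{0<..<t}. ?H s (t - s) \<partial>lborel)" by simp
  qed
  finally have B: "(\<integral>\<^sup>+s\<in>{0<..}. (\<integral>\<^sup>+x. ennreal (V s x powr p) *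
      (\<integral>\<^sup>+\<tau>\<in>{0<..}. \<omega> (s + \<tau>) * kernel_average Y \<phi> \<tau> x \<partial>lborel) \<partial>lborel) \<partial>lborel) =
      (\<integral>\<^sup>+t. \<omega> t * ?I t * (\<integral>\<^sup>+s\<in>{0<..<t}. ?H s (t - s) \<partial>lborel) \<partial>lborel)" .
  \<comment> \<open>The domain depends on \<open>t\<close>. Its indicator is a product of half-line
    indicators in \<open>s\<close> and \<open>t - s\<close>, for which joint measurability is
    immediate.\<close>
  have [measurable]: "(\<lambda>t. \<integral>\<^sup>+s\<in>{0<..<t}. ?H s (t - s) \<partial>lborel) \<in> borel_measurable borel"
  proof -
    have "(\<lambda>t. \<integral>\<^sup>+s. ?H s (t - s) * (?I s * ?I (t - s)) \<partial>lborel) \<in> borel_measurable borel"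
      by measurable
    moreover have "(\<lambda>t. \<integral>\<^sup>+s. ?H s (t - s) * (?I s * ?I (t - s)) \<partial>lborel) =
        (\<lambda>t. \<integral>\<^sup>+s\<in>{0<..<t}. ?H s (t - s) \<partial>lborel)"
      by (intro ext nn_integral_cong) (auto simp: indicator_def)
    ultimately show ?thesis by simp
  qed
  have "(\<integral>\<^sup>+t. \<omega> t * ?I t * ?A t \<partial>lborel) +
      (\<integral>\<^sup>+t. \<omega> t * ?I t * (\<integral>\<^sup>+s\<in>{0<..<t}. ?H s (t - s) \<partial>lborel) \<partial>lborel) =
      (\<integral>\<^sup>+t. \<omega> t * ?I t * ?A t + \<omega> t * ?I t * (\<integral>\<^sup>+s\<in>{0<..<t}. ?H s (t - s) \<partial>lborel) \<partial>lborel)"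
    by (subst nn_integral_add) simp_all
  also have "\<dots> \<le> (\<integral>\<^sup>+t\<in>{0<..}. \<omega> t * mass \<phi> t \<partial>lborel)"
  proof (rule nn_integral_mono)
    fix t :: real
    show "\<omega> t * ?I t * ?A t + \<omega> t * ?I t * (\<integral>\<^sup>+s\<in>{0<..<t}. ?H s (t - s) \<partial>lborel) \<le> \<omega> t * mass \<phi> t * ?I t"
    proof (cases "0 < t")
      case True
      then show ?thesis
        using mult_left_mono[OF duhamel[OF True assms(2)], of "\<omega> t"]
        by (simp add: mass_def distrib_left)
    qed simp
  qed
  finally show ?thesis unfolding A B .
qed

text \<open>The tangent inequality integrated against \<omega>(t) \<phi>(x). It takes the place of
  Jensen's inequality: no normalization of the weight is required, and \<open>m\<close> may be the
  mean or any other convenient point.\<close>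

lemma weighted_tangent:
  assumes [measurable]: "\<omega> \<in> borel_measurable borel" "\<phi> \<in> borel_measurable borel" and m: "0 < m"
  shows "ennreal (p * m powr (p - 1)) * (\<integral>\<^sup>+t. \<omega> t * mass \<phi> t \<partial>lborel)
    \<le> (\<integral>\<^sup>+t. \<omega> t * energy \<phi> t \<partial>lborel) +
      ennreal ((p - 1) * m powr p) * ((\<integral>\<^sup>+t. \<omega> t \<partial>lborel) * (\<integral>\<^sup>+x. \<phi> x \<partial>lborel))"
proof -
  let ?a = "ennreal (p * m powr (p - 1))" and ?b = "ennreal ((p - 1) * m powr p)"
  have pw: "?a * mass \<phi> t \<le> energy \<phi> t + ?b * (\<integral>\<^sup>+x. \<phi> x \<partial>lborel)" for t
  proof -
    have "?a * mass \<phi> t = (\<integral>\<^sup>+x. \<phi> x * ennreal (p * m powr (p - 1) * V t x) \<partial>lborel)"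
      unfolding mass_def
      by (subst nn_integral_cmult[symmetric], measurable)
        (simp only: ennreal_mult''[OF V_nonneg], simp only: mult_ac)
    also have "\<dots> \<le> (\<integral>\<^sup>+x. \<phi> x * (ennreal (V t x powr p) + ?b) \<partial>lborel)"
      using powr_ge_tangent[OF m V_nonneg p] p
      by (intro nn_integral_mono mult_left_mono) (auto simp flip: ennreal_plus intro!: ennreal_leI)
    also have "\<dots> = energy \<phi> t + ?b * (\<integral>\<^sup>+x. \<phi> x \<partial>lborel)"
      unfolding energy_def distrib_left
      by (subst nn_integral_add) (auto simp: nn_integral_multc mult.commute)
    finally show ?thesis .
  qed
  have "?a * (\<integral>\<^sup>+t. \<omega> t * mass \<phi> t \<partial>lborel) = (\<integral>\<^sup>+t. \<omega> t * (?a * mass \<phi> t) \<partial>lborel)"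
    by (subst nn_integral_cmult[symmetric]) (auto simp: mult_ac)
  also have "\<dots> \<le> (\<integral>\<^sup>+t. \<omega> t * (energy \<phi> t + ?b * (\<integral>\<^sup>+x. \<phi> x \<partial>lborel)) \<partial>lborel)"
    by (intro nn_integral_mono mult_left_mono pw) auto
  also have "\<dots> = (\<integral>\<^sup>+t. \<omega> t * energy \<phi> t \<partial>lborel) + ?b * ((\<integral>\<^sup>+t. \<omega> t \<partial>lborel) * (\<integral>\<^sup>+x. \<phi> x \<partial>lborel))"
    unfolding distrib_left
    by (subst nn_integral_add) (auto simp: nn_integral_multc mult_ac)
  finally show ?thesis .
qed

lemma Y_resolvent:
  assumes z: "0 < z"
  obtains R where "resolvent_measure R 1 (l z)"
    "\<And>\<phi> x. \<phi> \<in> borel_measurable borel \<Longrightarrow>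
      (\<integral>\<^sup>+t\<in>{0<..}. ennreal (exp (- z * t)) * kernel_average Y \<phi> t x \<partial>lborel) = (\<integral>\<^sup>+y. \<phi> (x + y) \<partial>R)"
  using laplace_kernel_average[OF Y l_pos[OF z] _ Y_laplace[OF z]] by auto

lemma Z_resolvent:
  assumes z: "0 < z"
  obtains R where "resolvent_measure R (l z / z) (l z)"
    "\<And>\<phi> x. \<phi> \<in> borel_measurable borel \<Longrightarrow>
      (\<integral>\<^sup>+t\<in>{0<..}. ennreal (exp (- z * t)) * kernel_average Z \<phi> t x \<partial>lborel) = (\<integral>\<^sup>+y. \<phi> (x + y) \<partial>R)"
proof -
  have "has_fourier_laplace Z \<xi> z (l z / z / (l z + (norm \<xi>)\<^sup>2))" for \<xi>
    using Z_laplace[OF z, of \<xi>] by simp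
  moreover have "0 \<le> l z / z" using l_pos[OF z] z by simp
  ultimately show thesis
    using laplace_kernel_average[OF Z l_pos[OF z], of "l z / z" z] that by blast
qed

abbreviation (input) "G s x \<equiv> ennreal (gauss s (x :: real ^ 'n))"

abbreviation (input) "\<psi> s \<equiv> (gauss_potential (1 / 2) s :: real ^ 'n \<Rightarrow> ennreal)"

section \<open>Estimates for one fixed Gaussian width\<close>

context
  fixes s \<mu> :: real
  assumes s: "0 < s" and \<mu>_def: "\<mu> = real CARD('n) / (2 * s)"
begin

lemma \<mu>_nonneg: "0 \<le> \<mu>"
  using s by (simp add: \<mu>_def)

lemma Y_laplace_gauss_ge:
  assumes z: "0 < z"
  shows "ennreal (1 / (l z + \<mu>)) * G s x \<le>
    (\<integral>\<^sup>+t\<in>{0<..}. ennreal (exp (- z * t)) * kernel_average Y (G s) t x \<partial>lborel)"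
proof -
  obtain R where R: "resolvent_measure R 1 (l z)"
    "\<And>\<phi> x. \<phi> \<in> borel_measurable borel \<Longrightarrow>
      (\<integral>\<^sup>+t\<in>{0<..}. ennreal (exp (- z * t)) * kernel_average Y \<phi> t x \<partial>lborel) = (\<integral>\<^sup>+y. \<phi> (x + y) \<partial>R)"
    using Y_resolvent[OF z] by blast
  show ?thesis
    by (subst R(2), measurable) (use resolvent_gauss_ge[OF R(1) l_pos[OF z] _ s] in \<open>simp add: \<mu>_def\<close>)
qed

lemma Z_laplace_gauss_ge:
  assumes z: "0 < z"
  shows "ennreal (l z / z / (l z + \<mu>)) * G s x \<le>
    (\<integral>\<^sup>+t\<in>{0<..}. ennreal (exp (- z * t)) * kernel_average Z (G s) t x \<partial>lborel)"
proof -
  obtain R where R: "resolvent_measure R (l z / z) (l z)"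
    "\<And>\<phi> x. \<phi> \<in> borel_measurable borel \<Longrightarrow>
      (\<integral>\<^sup>+t\<in>{0<..}. ennreal (exp (- z * t)) * kernel_average Z \<phi> t x \<partial>lborel) = (\<integral>\<^sup>+y. \<phi> (x + y) \<partial>R)"
    using Z_resolvent[OF z] by blast
  have "0 \<le> l z / z" using l_pos[OF z] z by simp
  note * = resolvent_gauss_ge[OF R(1) l_pos[OF z] this s]
  show ?thesis
    by (subst R(2), measurable) (use * in \<open>simp add: \<mu>_def\<close>)
qed

text \<open>For t > \<epsilon> one has exp(-z t) \<le> exp(-z \<epsilon> / 2) exp(-(z / 2) t), so
  the tail of the transform at \<open>z\<close> is at most exp(-z \<epsilon> / 2) times the
  transform at \<open>z / 2\<close>. The full transform is bounded below and the one at
  \<open>z / 2\<close> above, both by multiples of the potential.\<close>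

lemma short_time_potential:
  obtains c where "0 < c" "\<And>\<epsilon> x. 0 < \<epsilon> \<Longrightarrow> \<epsilon> \<le> 1 \<Longrightarrow>
    ennreal (c * \<epsilon>\<^sup>2) * \<psi> s x \<le> (\<integral>\<^sup>+\<tau>\<in>{0<..\<epsilon>}. kernel_average Y (\<psi> s) \<tau> x \<partial>lborel)"
proof
  define K where "K = max 20 \<mu>"
  have K: "20 \<le> K" "\<mu> \<le> K" by (auto simp: K_def)
  show "0 < 1 / (100 * K)" using K by simp
  fix \<epsilon> :: real and x :: "real ^ 'n"
  assume \<epsilon>: "0 < \<epsilon>" "\<epsilon> \<le> 1"
  \<comment> \<open>Then z \<epsilon> = K / \<epsilon> makes the tail exponentially small, while 1 /
    (z + \<mu>) is still of order \<epsilon>^2. Moreover z \<ge> 20 places z / 2 in the range where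
    \<open>l\<close> is at least 1.\<close>
  define z where "z = K / \<epsilon>\<^sup>2"
  have "\<epsilon>\<^sup>2 \<le> 1" using \<epsilon> by (simp add: power_le_one)
  then have "20 * \<epsilon>\<^sup>2 \<le> 20 * 1" by (intro mult_left_mono) auto
  then have "20 * \<epsilon>\<^sup>2 \<le> K" using K by linarith
  then have z: "20 \<le> z" using \<epsilon> by (simp add: z_def pos_le_divide_eq)
  obtain R where R: "resolvent_measure R 1 (l z)"
    "\<And>\<phi> x. \<phi> \<in> borel_measurable borel \<Longrightarrow>
      (\<integral>\<^sup>+t\<in>{0<..}. ennreal (exp (- z * t)) * kernel_average Y \<phi> t x \<partial>lborel) = (\<integral>\<^sup>+y. \<phi> (x + y) \<partial>R)"
    by (rule Y_resolvent[of z]) (use z in auto)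
  obtain R' where R': "resolvent_measure R' 1 (l (z / 2))"
    "\<And>\<phi> x. \<phi> \<in> borel_measurable borel \<Longrightarrow>
      (\<integral>\<^sup>+t\<in>{0<..}. ennreal (exp (- (z / 2) * t)) * kernel_average Y \<phi> t x \<partial>lborel) = (\<integral>\<^sup>+y. \<phi> (x + y) \<partial>R')"
    by (rule Y_resolvent[of "z / 2"]) (use z in auto)
  let ?E = "2 * exp (- z * \<epsilon> / 2)"
  let ?I = "\<integral>\<^sup>+\<tau>\<in>{0<..\<epsilon>}. kernel_average Y (\<psi> s) \<tau> x \<partial>lborel"
  have lz: "0 < l z" "l z \<le> z" "1 \<le> l (z / 2)" "0 < l (z / 2)"
    using l_ge[of z] l_le[of z] l_ge[of "z / 2"] z by auto
  \<comment> \<open>Finiteness allows the tail term to be cancelled in the extended reals at the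
    end.\<close>
  have fin: "\<psi> s x \<noteq> top"
    using gauss_potential_le[of "1/2" s x] s by (auto simp: top_unique)
  have "ennreal (1 / (z + \<mu>)) * \<psi> s x \<le> ennreal (1 / (l z + real DIM(real ^ 'n) / (2 * s))) * \<psi> s x"
    using lz z \<mu>_nonneg by (intro mult_right_mono ennreal_leI frac_le) (auto simp flip: \<mu>_def)
  also have "\<dots> \<le> (\<integral>\<^sup>+y. \<psi> s (x + y) \<partial>R)"
    by (rule resolvent_potential_ge[OF R(1) lz(1) _ s]) simp
  also have "\<dots> = (\<integral>\<^sup>+t\<in>{0<..}. ennreal (exp (- z * t)) * kernel_average Y (\<psi> s) t x \<partial>lborel)"
    by (rule R(2)[symmetric]) measurable
  also have "\<dots> \<le> (\<integral>\<^sup>+t. kernel_average Y (\<psi> s) t x * indicator {0<..\<epsilon>} t +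
      ennreal (exp (- z * \<epsilon> / 2)) * (ennreal (exp (- (z / 2) * t)) * kernel_average Y (\<psi> s) t x * indicator {0<..} t) \<partial>lborel)"
  proof (rule nn_integral_mono)
    fix t :: real
    have "ennreal (exp (- z * t)) * kernel_average Y (\<psi> s) t x \<le> kernel_average Y (\<psi> s) t x" if "0 < t" "t \<le> \<epsilon>"
    proof -
      have "exp (- z * t) \<le> 1" using that z by simp
      then have "ennreal (exp (- z * t)) * kernel_average Y (\<psi> s) t x \<le> 1 * kernel_average Y (\<psi> s) t x"
        by (intro mult_right_mono) (simp_all add: ennreal_le_1)
      then show ?thesis by simp
    qed
    moreover have "ennreal (exp (- z * t)) * kernel_average Y (\<psi> s) t x \<le>
        ennreal (exp (- z * \<epsilon> / 2)) * (ennreal (exp (- (z / 2) * t)) * kernel_average Y (\<psi> s) t x)" if "\<epsilon> < t"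
    proof -
      have "z * \<epsilon> \<le> z * t" using that z by simp
      then have "exp (- z * t) \<le> exp (- z * \<epsilon> / 2) * exp (- (z / 2) * t)"
        unfolding exp_add[symmetric] by simp
      then have "ennreal (exp (- z * t)) * kernel_average Y (\<psi> s) t x \<le>
          ennreal (exp (- z * \<epsilon> / 2) * exp (- (z / 2) * t)) * kernel_average Y (\<psi> s) t x"
        by (intro mult_right_mono ennreal_leI) auto
      then show ?thesis by (simp add: ennreal_mult' mult.assoc)
    qed
    ultimately show "ennreal (exp (- z * t)) * kernel_average Y (\<psi> s) t x * indicator {0<..} t \<le>
      kernel_average Y (\<psi> s) t x * indicator {0<..\<epsilon>} t +
      ennreal (exp (- z * \<epsilon> / 2)) * (ennreal (exp (- (z / 2) * t)) * kernel_average Y (\<psi> s) t x * indicator {0<..} t)"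
      using \<epsilon> by (cases "0 < t"; cases "t \<le> \<epsilon>") (auto simp: add_increasing2)
  qed
  also have "\<dots> = ?I + ennreal (exp (- z * \<epsilon> / 2)) *
      (\<integral>\<^sup>+t\<in>{0<..}. ennreal (exp (- (z / 2) * t)) * kernel_average Y (\<psi> s) t x \<partial>lborel)"
    by (subst nn_integral_add) (auto simp: nn_integral_cmult)
  also have "(\<integral>\<^sup>+t\<in>{0<..}. ennreal (exp (- (z / 2) * t)) * kernel_average Y (\<psi> s) t x \<partial>lborel) =
      (\<integral>\<^sup>+y. \<psi> s (x + y) \<partial>R')"
    by (rule R'(2)) measurable
  also have "\<dots> \<le> ennreal (1 / (l (z / 2) - 1 / 2)) * \<psi> s x"
    using lz by (intro resolvent_potential_le[OF R'(1) _ _ _ s]) auto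
  also have "\<dots> \<le> ennreal 2 * \<psi> s x"
    using lz by (intro mult_right_mono ennreal_leI) (auto simp: field_simps)
  finally have "ennreal (1 / (z + \<mu>)) * \<psi> s x \<le> ?I + ennreal (exp (- z * \<epsilon> / 2)) * (ennreal 2 * \<psi> s x)"
    by (simp add: mult_left_mono add_left_mono)
  also have "ennreal (exp (- z * \<epsilon> / 2)) * (ennreal 2 * \<psi> s x) = ennreal ?E * \<psi> s x"
    by (simp add: ennreal_mult' mult_ac)
  finally have main: "ennreal (1 / (z + \<mu>)) * \<psi> s x \<le> ?I + ennreal ?E * \<psi> s x" .
  have num: "1 / (100 * K) * \<epsilon>\<^sup>2 + ?E \<le> 1 / (z + \<mu>)"
    using resolvent_minus_tail[OF K \<mu>_nonneg \<epsilon>] by (simp add: z_def)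
  have "ennreal ?E * \<psi> s x + ennreal (1 / (100 * K) * \<epsilon>\<^sup>2) * \<psi> s x =
      ennreal (?E + 1 / (100 * K) * \<epsilon>\<^sup>2) * \<psi> s x"
    using K by (subst ennreal_plus) (auto simp: distrib_right)
  also have "\<dots> \<le> ennreal (1 / (z + \<mu>)) * \<psi> s x"
    using num by (intro mult_right_mono ennreal_leI) auto
  also have "\<dots> \<le> ennreal ?E * \<psi> s x + ?I"
    using main by (simp only: add.commute)
  finally have "ennreal ?E * \<psi> s x = top \<or> ennreal (1 / (100 * K) * \<epsilon>\<^sup>2) * \<psi> s x \<le> ?I"
    by (simp only: ennreal_add_left_cancel_le infinity_ennreal_def)
  moreover have "ennreal ?E * \<psi> s x \<noteq> top"
    using fin by (simp add: ennreal_mult_eq_top_iff)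
  ultimately show "ennreal (1 / (100 * K) * \<epsilon>\<^sup>2) * \<psi> s x \<le> ?I"
    by blast
qed

text \<open>An exponential weight satisfies \<omega>(t + \<tau>) = \<omega>(t) \<omega>(\<tau>), so
  the inner integral in the weighted inequality is exp(-z t) times the transform of
  \<open>Y\<close>, and the pointwise lower bounds for both kernels can be inserted.\<close>

lemma laplace_mass_ge:
  assumes z: "0 < z"
  shows "ennreal (l z / z / (l z + \<mu>)) * (\<integral>\<^sup>+x. w x * G s x \<partial>lborel) +
      ennreal (1 / (l z + \<mu>)) * (\<integral>\<^sup>+t\<in>{0<..}. ennreal (exp (- z * t)) * energy (G s) t \<partial>lborel)
    \<le> (\<integral>\<^sup>+t\<in>{0<..}. ennreal (exp (- z * t)) * mass (G s) t \<partial>lborel)"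
proof -
  let ?\<omega> = "\<lambda>t. ennreal (exp (- z * t))"
  have "ennreal (l z / z / (l z + \<mu>)) * (\<integral>\<^sup>+x. w x * G s x \<partial>lborel) =
      (\<integral>\<^sup>+x. w x * (ennreal (l z / z / (l z + \<mu>)) * G s x) \<partial>lborel)"
    by (subst nn_integral_cmult[symmetric]) (auto simp: mult_ac)
  also have "\<dots> \<le> (\<integral>\<^sup>+x. w x * (\<integral>\<^sup>+t\<in>{0<..}. ?\<omega> t * kernel_average Z (G s) t x \<partial>lborel) \<partial>lborel)"
    by (intro nn_integral_mono mult_left_mono Z_laplace_gauss_ge z) simp
  finally have 1: "ennreal (l z / z / (l z + \<mu>)) * (\<integral>\<^sup>+x. w x * G s x \<partial>lborel)
    \<le> (\<integral>\<^sup>+x. w x * (\<integral>\<^sup>+t\<in>{0<..}. ?\<omega> t * kernel_average Z (G s) t x \<partial>lborel) \<partial>lborel)" .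
  have "ennreal (1 / (l z + \<mu>)) * (\<integral>\<^sup>+t\<in>{0<..}. ?\<omega> t * energy (G s) t \<partial>lborel) =
      (\<integral>\<^sup>+t\<in>{0<..}. ennreal (1 / (l z + \<mu>)) * (?\<omega> t * energy (G s) t) \<partial>lborel)"
    by (subst nn_integral_cmult[symmetric]) (auto simp: mult_ac)
  also have "\<dots> \<le> (\<integral>\<^sup>+t\<in>{0<..}. (\<integral>\<^sup>+x. ennreal (V t x powr p) *
      (\<integral>\<^sup>+\<tau>\<in>{0<..}. ?\<omega> (t + \<tau>) * kernel_average Y (G s) \<tau> x \<partial>lborel) \<partial>lborel) \<partial>lborel)"
  proof (intro nn_integral_mono mult_right_mono)
    fix t :: real
    have "ennreal (1 / (l z + \<mu>)) * (?\<omega> t * energy (G s) t) =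
        (\<integral>\<^sup>+x. ennreal (V t x powr p) * (?\<omega> t * (ennreal (1 / (l z + \<mu>)) * G s x)) \<partial>lborel)"
      unfolding energy_def
      by (subst nn_integral_cmult[symmetric], measurable, subst nn_integral_cmult[symmetric], measurable)
        (simp only: mult_ac)
    also have "\<dots> \<le> (\<integral>\<^sup>+x. ennreal (V t x powr p) * (?\<omega> t *
        (\<integral>\<^sup>+\<tau>\<in>{0<..}. ?\<omega> \<tau> * kernel_average Y (G s) \<tau> x \<partial>lborel)) \<partial>lborel)"
      by (intro nn_integral_mono mult_left_mono Y_laplace_gauss_ge z) simp_all
    also have "\<dots> = (\<integral>\<^sup>+x. ennreal (V t x powr p) *
      (\<integral>\<^sup>+\<tau>\<in>{0<..}. ?\<omega> (t + \<tau>) * kernel_average Y (G s) \<tau> x \<partial>lborel) \<partial>lborel)"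
    proof -
      have "?\<omega> (t + \<tau>) = ?\<omega> t * ?\<omega> \<tau>" for \<tau>
        by (simp add: distrib_left exp_add exp_diff ennreal_mult'[symmetric] exp_minus field_simps)
      then show ?thesis
        by (subst nn_integral_cmult[symmetric]) (simp_all add: mult_ac)
    qed
    finally show "ennreal (1 / (l z + \<mu>)) * (?\<omega> t * energy (G s) t) \<le> (\<integral>\<^sup>+x. ennreal (V t x powr p) *
      (\<integral>\<^sup>+\<tau>\<in>{0<..}. ?\<omega> (t + \<tau>) * kernel_average Y (G s) \<tau> x \<partial>lborel) \<partial>lborel)" .
  qed simp
  finally have 2: "ennreal (1 / (l z + \<mu>)) * (\<integral>\<^sup>+t\<in>{0<..}. ?\<omega> t * energy (G s) t \<partial>lborel) \<le>
    (\<integral>\<^sup>+t\<in>{0<..}. (\<integral>\<^sup>+x. ennreal (V t x powr p) *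
      (\<integral>\<^sup>+\<tau>\<in>{0<..}. ?\<omega> (t + \<tau>) * kernel_average Y (G s) \<tau> x \<partial>lborel) \<partial>lborel) \<partial>lborel)" .
  show ?thesis
    by (rule order_trans[OF add_mono[OF 1 2] weighted_duhamel]) measurable
qed

section \<open>Growth of the time-integrated potential mass\<close>

definition total :: "real \<Rightarrow> ennreal" where
  "total t = (\<integral>\<^sup>+\<tau>\<in>{0<..t}. mass (\<psi> s) \<tau> \<partial>lborel)"

lemma total_mono: "t \<le> t' \<Longrightarrow> total t \<le> total t'"
  unfolding total_def by (intro nn_integral_mono) (auto simp: indicator_def)

text \<open>The potential is bounded and \<open>V t\<close> is bounded in L^1 on bounded time
  intervals. This makes \<open>enn2real\<close> faithful on \<open>total\<close>.\<close>

lemma total_finite: "total T \<noteq> top"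
proof -
  obtain B :: real where B: "\<And>t. t \<in> {0<..T} \<Longrightarrow> (\<integral>\<^sup>+x. ennreal (V t x) \<partial>lborel) \<le> ennreal B"
    using V_bounded[of T] by blast
  let ?c = "(4 * pi * s) powr (- (real DIM(real ^ 'n) / 2)) / (1 / 2)"
  have "mass (\<psi> s) t \<le> ennreal ?c * ennreal B" if "t \<in> {0<..T}" for t
  proof -
    have "mass (\<psi> s) t \<le> (\<integral>\<^sup>+x. ennreal ?c * ennreal (V t x) \<partial>lborel)"
      unfolding mass_def using s by (intro nn_integral_mono mult_right_mono gauss_potential_le) auto
    also have "\<dots> = ennreal ?c * (\<integral>\<^sup>+x. ennreal (V t x) \<partial>lborel)"
      by (rule nn_integral_cmult) measurable
    also have "\<dots> \<le> ennreal ?c * ennreal B"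
      by (intro mult_left_mono B that) simp
    finally show ?thesis .
  qed
  then have "total T \<le> (\<integral>\<^sup>+\<tau>. ennreal ?c * ennreal B * indicator {0<..T} \<tau> \<partial>lborel)"
    unfolding total_def by (intro nn_integral_mono) (auto simp: indicator_def)
  also have "\<dots> = ennreal ?c * ennreal B * ennreal (if 0 \<le> T then T else 0)"
    by (subst nn_integral_cmult_indicator) auto
  also have "\<dots> < top"
    by (simp add: ennreal_mult_less_top)
  finally show ?thesis by simp
qed

text \<open>Jensen's inequality for the measure \<psi>(x) dx d\<tau> on times up to
  \<open>t\<close>. Its mass is 2 t because the potential of rate 1/2 has integral 2; the tangent is
  taken at the mean \<open>m\<close>.\<close>

lemma total_jensen:
  assumes t: "0 < t"
  shows "ennreal (2 * t * (enn2real (total t) / (2 * t)) powr p)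
    \<le> (\<integral>\<^sup>+\<tau>\<in>{0<..t}. energy (\<psi> s) \<tau> \<partial>lborel)" (is "_ \<le> ?Q")
proof (cases "enn2real (total t) = 0 \<or> ?Q = top")
  case True
  then show ?thesis by auto
next
  case False
  define m where "m = enn2real (total t) / (2 * t)"
  have m: "0 < m" using False t by (simp add: m_def less_le)
  have tot: "total t = ennreal (m * (2 * t))"
    using t total_finite[of t] by (simp add: m_def less_top)
  obtain q where q: "?Q = ennreal q" "0 \<le> q"
    using False by (cases ?Q) auto
  have int\<psi>: "(\<integral>\<^sup>+x. \<psi> s x \<partial>lborel) = ennreal 2"
    using nn_integral_gauss_potential[of "1/2" s, where 'a="real ^ 'n"] s by simp
  have "ennreal (p * m powr (p - 1)) * (\<integral>\<^sup>+\<tau>. indicator {0<..t} \<tau> * mass (\<psi> s) \<tau> \<partial>lborel)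
    \<le> (\<integral>\<^sup>+\<tau>. indicator {0<..t} \<tau> * energy (\<psi> s) \<tau> \<partial>lborel) +
      ennreal ((p - 1) * m powr p) * ((\<integral>\<^sup>+\<tau>. indicator {0<..t} \<tau> \<partial>lborel) * (\<integral>\<^sup>+x. \<psi> s x \<partial>lborel))"
    using m by (intro weighted_tangent) measurable
  then have "ennreal (p * m powr (p - 1)) * total t \<le> ?Q + ennreal ((p - 1) * m powr p) * (ennreal t * ennreal 2)"
    using t by (simp add: total_def int\<psi> mult.commute[of "indicator _ _"])
  moreover have "ennreal t * ennreal 2 = ennreal (t * 2)"
    by (rule ennreal_mult'[symmetric]) (use t in simp)
  moreover have "ennreal ((p - 1) * m powr p) * ennreal (t * 2) = ennreal ((p - 1) * m powr p * (t * 2))"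
    by (rule ennreal_mult''[symmetric]) (use t in simp)
  moreover have "ennreal (p * m powr (p - 1)) * ennreal (m * (2 * t)) = ennreal (p * m powr (p - 1) * (m * (2 * t)))"
    by (rule ennreal_mult''[symmetric]) (use t m in simp)
  moreover have "ennreal q + ennreal ((p - 1) * m powr p * (t * 2)) = ennreal (q + (p - 1) * m powr p * (t * 2))"
    by (rule ennreal_plus[symmetric]) (use q p t in simp_all)
  ultimately have "ennreal (p * m powr (p - 1) * (m * (2 * t))) \<le> ennreal (q + (p - 1) * m powr p * (t * 2))"
    by (simp only: tot q(1))
  moreover have "0 \<le> q + (p - 1) * m powr p * (t * 2)"
    using p t q by simp
  ultimately have "p * m powr (p - 1) * (m * (2 * t)) \<le> q + (p - 1) * m powr p * (t * 2)"
    by (simp only: ennreal_le_iff)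
  moreover have "p * m powr (p - 1) * (m * (2 * t)) = p * (m powr (p - 1) * m) * (t * 2)"
    by (simp only: mult_ac)
  moreover have "m powr (p - 1) * m = m powr p" using m by (simp add: powr_diff)
  ultimately have "p * m powr p * (t * 2) \<le> q + (p - 1) * m powr p * (t * 2)"
    by (simp only:)
  then have "2 * t * m powr p \<le> q"
    by (simp add: algebra_simps)
  then show ?thesis
    unfolding m_def[symmetric] q(1) by (rule ennreal_leI)
qed

text \<open>With \<omega> the indicator of times up to t + \<epsilon>, only sources at times r \<le>
  t and delays \<tau> \<le> \<epsilon> are kept; for these r + \<tau> is still admissible. The datum
  term is nonnegative and dropped, and Jensen's inequality handles the sources.\<close>

lemma total_delayed_growth:
  obtains c where "0 < c" "\<And>t \<epsilon>. 0 < t \<Longrightarrow> 0 < \<epsilon> \<Longrightarrow> \<epsilon> \<le> 1 \<Longrightarrow>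
    c * \<epsilon>\<^sup>2 * (2 * t) * (enn2real (total t) / (2 * t)) powr p \<le> enn2real (total (t + \<epsilon>))"
proof -
  obtain c where c: "0 < c" "\<And>\<epsilon> x. 0 < \<epsilon> \<Longrightarrow> \<epsilon> \<le> 1 \<Longrightarrow>
    ennreal (c * \<epsilon>\<^sup>2) * \<psi> s x \<le> (\<integral>\<^sup>+\<tau>\<in>{0<..\<epsilon>}. kernel_average Y (\<psi> s) \<tau> x \<partial>lborel)"
    using short_time_potential by blast
  show thesis
  proof (rule that[OF c(1)])
    fix t \<epsilon> :: real assume t: "0 < t" and \<epsilon>: "0 < \<epsilon>" "\<epsilon> \<le> 1"
    let ?\<omega> = "indicator {..t + \<epsilon>} :: real \<Rightarrow> ennreal"
    have "ennreal (c * \<epsilon>\<^sup>2) * ennreal (2 * t * (enn2real (total t) / (2 * t)) powr p) \<le>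
        ennreal (c * \<epsilon>\<^sup>2) * (\<integral>\<^sup>+\<tau>\<in>{0<..t}. energy (\<psi> s) \<tau> \<partial>lborel)"
      by (intro mult_left_mono total_jensen t) simp
    also have "\<dots> = (\<integral>\<^sup>+r\<in>{0<..t}. (\<integral>\<^sup>+x. ennreal (V r x powr p) * (ennreal (c * \<epsilon>\<^sup>2) * \<psi> s x) \<partial>lborel) \<partial>lborel)"
      unfolding energy_def
      by (subst nn_integral_cmult[symmetric], measurable, subst mult.assoc[symmetric],
          subst nn_integral_cmult[symmetric], measurable) (simp only: mult_ac)
    also have "\<dots> \<le> (\<integral>\<^sup>+r\<in>{0<..}. (\<integral>\<^sup>+x. ennreal (V r x powr p) *
      (\<integral>\<^sup>+\<tau>\<in>{0<..}. ?\<omega> (r + \<tau>) * kernel_average Y (\<psi> s) \<tau> x \<partial>lborel) \<partial>lborel) \<partial>lborel)"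
    proof (rule nn_integral_mono)
      fix r :: real
      have "(\<integral>\<^sup>+x. ennreal (V r x powr p) * (ennreal (c * \<epsilon>\<^sup>2) * \<psi> s x) \<partial>lborel) \<le>
        (\<integral>\<^sup>+x. ennreal (V r x powr p) *
          (\<integral>\<^sup>+\<tau>\<in>{0<..}. ?\<omega> (r + \<tau>) * kernel_average Y (\<psi> s) \<tau> x \<partial>lborel) \<partial>lborel)" if "r \<le> t"
      proof (intro nn_integral_mono mult_left_mono)
        fix x
        have "ennreal (c * \<epsilon>\<^sup>2) * \<psi> s x \<le> (\<integral>\<^sup>+\<tau>\<in>{0<..\<epsilon>}. kernel_average Y (\<psi> s) \<tau> x \<partial>lborel)"
          using c(2) \<epsilon> by blast
        also have "\<dots> \<le> (\<integral>\<^sup>+\<tau>\<in>{0<..}. ?\<omega> (r + \<tau>) * kernel_average Y (\<psi> s) \<tau> x \<partial>lborel)"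
          using that by (intro nn_integral_mono) (auto simp: indicator_def)
        finally show "ennreal (c * \<epsilon>\<^sup>2) * \<psi> s x \<le>
          (\<integral>\<^sup>+\<tau>\<in>{0<..}. ?\<omega> (r + \<tau>) * kernel_average Y (\<psi> s) \<tau> x \<partial>lborel)" .
      qed simp
      then show "(\<integral>\<^sup>+x. ennreal (V r x powr p) * (ennreal (c * \<epsilon>\<^sup>2) * \<psi> s x) \<partial>lborel) * indicator {0<..t} r \<le>
        (\<integral>\<^sup>+x. ennreal (V r x powr p) *
          (\<integral>\<^sup>+\<tau>\<in>{0<..}. ?\<omega> (r + \<tau>) * kernel_average Y (\<psi> s) \<tau> x \<partial>lborel) \<partial>lborel) * indicator {0<..} r"
        by (cases "0 < r \<and> r \<le> t") auto
    qed
    also have "\<dots> \<le> (\<integral>\<^sup>+t\<in>{0<..}. ?\<omega> t * mass (\<psi> s) t \<partial>lborel)"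
      by (rule order_trans[OF _ weighted_duhamel]) (auto intro: add_increasing)
    also have "\<dots> = total (t + \<epsilon>)"
      unfolding total_def by (intro nn_integral_cong) (auto simp: indicator_def)
    finally have "ennreal (c * \<epsilon>\<^sup>2 * (2 * t * (enn2real (total t) / (2 * t)) powr p)) \<le> total (t + \<epsilon>)"
      using c(1) by (simp only: ennreal_mult' zero_le_mult_iff zero_le_power2 less_imp_le simp_thms)
    then have "enn2real (ennreal (c * \<epsilon>\<^sup>2 * (2 * t * (enn2real (total t) / (2 * t)) powr p)))
        \<le> enn2real (total (t + \<epsilon>))"
      using total_finite by (intro enn2real_mono) (auto simp: less_top)
    then show "c * \<epsilon>\<^sup>2 * (2 * t) * (enn2real (total t) / (2 * t)) powr p \<le> enn2real (total (t + \<epsilon>))"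
      using c(1) t by (subst (asm) enn2real_ennreal) (auto simp: mult.assoc)
  qed
qed

lemma total_linear_bound:
  obtains C where "0 < C" "\<And>t. 1 \<le> t \<Longrightarrow> total t \<le> ennreal (C * (t + 1))"
proof -
  obtain c where c: "0 < c" "\<And>t \<epsilon>. 0 < t \<Longrightarrow> 0 < \<epsilon> \<Longrightarrow> \<epsilon> \<le> 1 \<Longrightarrow>
    c * \<epsilon>\<^sup>2 * (2 * t) * (enn2real (total t) / (2 * t)) powr p \<le> enn2real (total (t + \<epsilon>))"
    using total_delayed_growth by blast
  obtain C where C: "0 < C" "\<And>t. 1 \<le> t \<Longrightarrow> enn2real (total t) \<le> C * (t + 1)"
  proof (rule linear_bound_of_delayed_growth[of "\<lambda>t. enn2real (total t)" 2 c p])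
    show "enn2real (total r) \<le> enn2real (total t)" if "0 < r" "r \<le> t" for r t
      using that total_finite by (intro enn2real_mono total_mono) (auto simp: less_top)
  qed (use c p in auto)
  show thesis
  proof (rule that[OF C(1)])
    fix t :: real assume "1 \<le> t"
    have "total t = ennreal (enn2real (total t))"
      using total_finite[of t] by (simp add: less_top)
    also have "\<dots> \<le> ennreal (C * (t + 1))"
      using C(2)[OF \<open>1 \<le> t\<close>] by (rule ennreal_leI)
    finally show "total t \<le> ennreal (C * (t + 1))" .
  qed
qed

text \<open>Integration by parts in Tonelli form: exp(-z t) is the integral of z exp(-z r) over r >
  t, so the transform is at most the integral of z exp(-z r) \<open>total (r + 1)\<close>. The
  argument \<open>r + 1\<close> keeps to times at least 1, where the linear bound holds.\<close>

lemma laplace_mass_potential_finite: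
  assumes z: "0 < z"
  shows "(\<integral>\<^sup>+t\<in>{0<..}. ennreal (exp (- z * t)) * mass (\<psi> s) t \<partial>lborel) < top"
proof -
  obtain C where C: "0 < C" "\<And>t. 1 \<le> t \<Longrightarrow> total t \<le> ennreal (C * (t + 1))"
    using total_linear_bound by blast
  have tail: "ennreal (exp (- z * t)) = (\<integral>\<^sup>+r. ennreal (z * exp (- z * r)) * indicator {t<..} r \<partial>lborel)" for t
  proof -
    have "(\<integral>\<^sup>+r. ennreal (z * exp (- z * r)) * indicator {t<..} r \<partial>lborel) =
        (\<integral>\<^sup>+r. ennreal (z * exp (- z * (t + 1 * r))) * indicator {t<..} (t + 1 * r) \<partial>lborel)"
      by (subst nn_integral_real_affine[where c=1 and t=t]) simp_all
    also have "\<dots> = (\<integral>\<^sup>+r. ennreal (z * exp (- z * t)) * (ennreal (exp (- z * r)) * indicator {0<..} r) \<partial>lborel)"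
    proof (rule nn_integral_cong)
      fix r :: real
      have "z * exp (- z * (t + 1 * r)) = z * exp (- z * t) * exp (- z * r)"
        by (simp add: algebra_simps flip: exp_add)
      then show "ennreal (z * exp (- z * (t + 1 * r))) * indicator {t<..} (t + 1 * r) =
          ennreal (z * exp (- z * t)) * (ennreal (exp (- z * r)) * indicator {0<..} r)"
        using z by (auto simp: indicator_def ennreal_mult'[symmetric])
    qed
    also have "\<dots> = ennreal (z * exp (- z * t)) * ennreal (1 / z)"
      unfolding nn_integral_exp_decay[OF z, symmetric] by (rule nn_integral_cmult) measurable
    also have "\<dots> = ennreal (exp (- z * t))"
      using z by (simp flip: ennreal_mult')
    finally show ?thesis by simp
  qed
  have "(\<integral>\<^sup>+t\<in>{0<..}. ennreal (exp (- z * t)) * mass (\<psi> s) t \<partial>lborel) =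
      (\<integral>\<^sup>+t. \<integral>\<^sup>+r. ennreal (z * exp (- z * r)) * indicator {t<..} r * (mass (\<psi> s) t * indicator {0<..} t) \<partial>lborel \<partial>lborel)"
    unfolding tail by (subst nn_integral_multc[symmetric], measurable)
      (subst nn_integral_multc[symmetric], simp_all add: mult.assoc)
  also have "\<dots> = (\<integral>\<^sup>+t. \<integral>\<^sup>+r. ennreal (z * exp (- z * r)) * indicator {0<..} (r - t) * (mass (\<psi> s) t * indicator {0<..} t) \<partial>lborel \<partial>lborel)"
    by (intro nn_integral_cong) (auto simp: indicator_def)
  also have "\<dots> = (\<integral>\<^sup>+r. \<integral>\<^sup>+t. ennreal (z * exp (- z * r)) * indicator {0<..} (r - t) * (mass (\<psi> s) t * indicator {0<..} t) \<partial>lborel \<partial>lborel)"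
    by (rule lborel_pair.Fubini') measurable
  also have "\<dots> \<le> (\<integral>\<^sup>+r. ennreal (z * (C * (2 + 2 / z))) * (ennreal (exp (- (z / 2) * r)) * indicator {0<..} r) \<partial>lborel)"
  proof (rule nn_integral_mono)
    fix r :: real
    show "(\<integral>\<^sup>+t. ennreal (z * exp (- z * r)) * indicator {0<..} (r - t) * (mass (\<psi> s) t * indicator {0<..} t) \<partial>lborel) \<le>
      ennreal (z * (C * (2 + 2 / z))) * (ennreal (exp (- (z / 2) * r)) * indicator {0<..} r)"
    proof (cases "0 < r")
      case True
      have "(\<integral>\<^sup>+t. ennreal (z * exp (- z * r)) * indicator {0<..} (r - t) * (mass (\<psi> s) t * indicator {0<..} t) \<partial>lborel)
          \<le> (\<integral>\<^sup>+t. ennreal (z * exp (- z * r)) * (mass (\<psi> s) t * indicator {0<..r + 1} t) \<partial>lborel)"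
        by (intro nn_integral_mono) (auto simp: indicator_def)
      also have "\<dots> = ennreal (z * exp (- z * r)) * total (r + 1)"
        unfolding total_def by (rule nn_integral_cmult) measurable
      also have "\<dots> \<le> ennreal (z * exp (- z * r)) * ennreal (C * (r + 2))"
        using C(2)[of "r + 1"] True by (intro mult_left_mono) (auto simp: add.assoc)
      also have "\<dots> = ennreal (z * exp (- z * r) * (C * (r + 2)))"
        using z by (simp flip: ennreal_mult')
      \<comment> \<open>Half of the exponential decay is spent on the linear factor, through r + 2
        \<le> (2 + 2/z) exp(z r / 2).\<close>
      also have "\<dots> \<le> ennreal (z * (C * (2 + 2 / z)) * exp (- (z / 2) * r))"
      proof (rule ennreal_leI)
        let ?e = "exp ((z / 2) * r)"
        have "(z / 2) * r \<le> ?e" using exp_ge_add_one_self[of "(z / 2) * r"] by linarith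
        then have "r \<le> 2 / z * ?e" using z by (simp add: field_simps)
        moreover have "1 \<le> ?e" using z True by simp
        ultimately have "r + 2 \<le> (2 + 2 / z) * ?e"
          unfolding distrib_right by linarith
        then have "z * exp (- z * r) * (C * (r + 2)) \<le> z * exp (- z * r) * (C * ((2 + 2 / z) * ?e))"
          using z C(1) by (intro mult_left_mono) auto
        also have "\<dots> = z * (C * (2 + 2 / z)) * (exp (- z * r) * ?e)"
          by (simp only: mult_ac)
        also have "exp (- z * r) * ?e = exp (- (z / 2) * r)"
          unfolding exp_add[symmetric] by simp
        finally show "z * exp (- z * r) * (C * (r + 2)) \<le> z * (C * (2 + 2 / z)) * exp (- (z / 2) * r)" .
      qed
      also have "\<dots> = ennreal (z * (C * (2 + 2 / z))) * ennreal (exp (- (z / 2) * r))"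
        by (rule ennreal_mult'') simp
      finally show ?thesis using True by simp
    next
      case False
      then have "(\<lambda>t. ennreal (z * exp (- z * r)) * indicator {0<..} (r - t) * (mass (\<psi> s) t * indicator {0<..} t)) = (\<lambda>t. 0)"
        by (auto simp: indicator_def)
      then show ?thesis by simp
    qed
  qed
  also have "\<dots> = ennreal (z * (C * (2 + 2 / z))) * ennreal (1 / (z / 2))"
  proof -
    have "0 < z / 2" using z by simp
    from nn_integral_exp_decay[OF this] show ?thesis
      by (subst nn_integral_cmult) simp_all
  qed
  also have "\<dots> < top" by (simp add: ennreal_mult_less_top)
  finally show ?thesis .
qed

text \<open>The Gaussian is dominated by a multiple of its own potential, so finiteness carries
  over.\<close>

lemma laplace_mass_gauss_finite:
  assumes z: "0 < z"
  shows "(\<integral>\<^sup>+t\<in>{0<..}. ennreal (exp (- z * t)) * mass (G s) t \<partial>lborel) < top"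
proof -
  let ?a = "1 / 2 + \<mu>"
  have a: "0 < ?a" using s by (simp add: \<mu>_def add_pos_nonneg)
  have "G s x \<le> ennreal ?a * \<psi> s x" for x
  proof -
    have "G s x = ennreal ?a * (ennreal (1 / ?a) * G s x)"
      using a by (simp add: mult.assoc[symmetric] ennreal_mult'[symmetric])
    also have "\<dots> \<le> ennreal ?a * \<psi> s x"
      using gauss_le_gauss_potential[of "1/2" s x] s by (intro mult_left_mono) (auto simp: \<mu>_def)
    finally show ?thesis .
  qed
  then have "mass (G s) t \<le> ennreal ?a * mass (\<psi> s) t" for t
    unfolding mass_def
    by (subst nn_integral_cmult[symmetric])
      (auto intro!: nn_integral_mono mult_right_mono simp: mult.assoc[symmetric])
  then have "(\<integral>\<^sup>+t\<in>{0<..}. ennreal (exp (- z * t)) * mass (G s) t \<partial>lborel) \<le>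
      (\<integral>\<^sup>+t. ennreal ?a * (ennreal (exp (- z * t)) * mass (\<psi> s) t * indicator {0<..} t) \<partial>lborel)"
  proof (intro nn_integral_mono)
    fix t :: real
    have "ennreal (exp (- z * t)) * mass (G s) t \<le> ennreal (exp (- z * t)) * (ennreal ?a * mass (\<psi> s) t)"
      by (intro mult_left_mono \<open>mass (G s) t \<le> _\<close>) simp
    then show "ennreal (exp (- z * t)) * mass (G s) t * indicator {0<..} t \<le>
        ennreal ?a * (ennreal (exp (- z * t)) * mass (\<psi> s) t * indicator {0<..} t)"
      by (cases "0 < t") (simp_all add: mult.left_commute[of "ennreal ?a"])
  qed
  also have "\<dots> = ennreal ?a * (\<integral>\<^sup>+t\<in>{0<..}. ennreal (exp (- z * t)) * mass (\<psi> s) t \<partial>lborel)"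
    by (rule nn_integral_cmult) measurable
  also have "\<dots> < top"
    using laplace_mass_potential_finite[OF z] by (simp add: ennreal_mult_less_top)
  finally show ?thesis .
qed

text \<open>Here \<open>m\<close> is the tangent point whose slope p m^(p-1) equals l(z) + \<mu>.
  The upper bound for the mass then has exactly the coefficient of the lower bound, and what is
  left, (p - 1) m^p, is the maximum of (l(z) + \<mu>) v - v^p over v \<ge> 0.\<close>

lemma gauss_mean_le:
  assumes z: "0 < z" and m: "0 < m" "p * m powr (p - 1) = l z + \<mu>"
  shows "ennreal (l z) * (\<integral>\<^sup>+x. w x * G s x \<partial>lborel) \<le> ennreal ((p - 1) * m powr p)"
proof -
  let ?a = "l z + \<mu>"
  let ?W = "\<integral>\<^sup>+x. w x * G s x \<partial>lborel"
  let ?L = "\<integral>\<^sup>+t\<in>{0<..}. ennreal (exp (- z * t)) * mass (G s) t \<partial>lborel"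
  let ?E = "\<integral>\<^sup>+t\<in>{0<..}. ennreal (exp (- z * t)) * energy (G s) t \<partial>lborel"
  have lz: "0 < l z" by (rule l_pos[OF z])
  have a: "0 < ?a" using s lz by (simp add: \<mu>_def add_pos_nonneg)
  have "ennreal (l z / z) * ?W + ?E =
      ennreal ?a * (ennreal (l z / z / ?a) * ?W + ennreal (1 / ?a) * ?E)"
  proof -
    have "ennreal ?a * ennreal (l z / z / ?a) = ennreal (l z / z)" "ennreal ?a * ennreal (1 / ?a) = 1"
      using a by (simp_all add: ennreal_mult'[symmetric])
    then show ?thesis by (simp only: distrib_left mult.assoc[symmetric] mult_1)
  qed
  also have "\<dots> \<le> ennreal ?a * ?L"
    by (intro mult_left_mono laplace_mass_ge z) simp
  finally have lower: "ennreal (l z / z) * ?W + ?E \<le> ennreal ?a * ?L" .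
  have int\<omega>: "(\<integral>\<^sup>+t. ennreal (exp (- z * t)) * indicator {0<..} t \<partial>lborel) = ennreal (1 / z)"
    by (rule nn_integral_exp_decay[OF z])
  have "ennreal ?a * (\<integral>\<^sup>+t. (ennreal (exp (- z * t)) * indicator {0<..} t) * mass (G s) t \<partial>lborel) \<le>
    (\<integral>\<^sup>+t. (ennreal (exp (- z * t)) * indicator {0<..} t) * energy (G s) t \<partial>lborel) +
      ennreal ((p - 1) * m powr p) * ((\<integral>\<^sup>+t. ennreal (exp (- z * t)) * indicator {0<..} t \<partial>lborel) * (\<integral>\<^sup>+x. G s x \<partial>lborel))"
    unfolding m(2)[symmetric] by (intro weighted_tangent m) measurable
  then have upper: "ennreal ?a * ?L \<le> ?E + ennreal ((p - 1) * m powr p) * ennreal (1 / z)"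
    unfolding int\<omega> gauss_integral[OF s] by (simp add: mult_ac)
  \<comment> \<open>Finiteness of the transformed mass is spent here: it bounds \<open>?E\<close>,
    which stands on both sides and may now be cancelled.\<close>
  have "?E \<le> ennreal ?a * ?L"
    by (rule order_trans[OF _ lower]) (simp add: add_increasing)
  moreover have "ennreal ?a * ?L < top"
    using laplace_mass_gauss_finite[OF z] by (simp add: ennreal_mult_less_top)
  ultimately have "?E \<noteq> top" by (auto simp: top_unique)
  moreover have "?E + ennreal (l z / z) * ?W \<le> ?E + ennreal ((p - 1) * m powr p) * ennreal (1 / z)"
    using order_trans[OF lower upper] by (simp only: add.commute)
  ultimately have "ennreal (l z / z) * ?W \<le> ennreal ((p - 1) * m powr p) * ennreal (1 / z)"
    by (simp add: ennreal_add_left_cancel_le)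
  then have "ennreal z * (ennreal (l z / z) * ?W) \<le> ennreal z * (ennreal ((p - 1) * m powr p) * ennreal (1 / z))"
    by (intro mult_left_mono) auto
  moreover have "ennreal z * (ennreal (l z / z) * ?W) = ennreal (l z) * ?W"
    using z by (simp add: mult.assoc[symmetric] ennreal_mult'[symmetric])
  moreover have "ennreal z * (ennreal ((p - 1) * m powr p) * ennreal (1 / z)) = ennreal ((p - 1) * m powr p)"
    using z p by (simp add: ennreal_mult'[symmetric])
  ultimately show ?thesis by simp
qed

end

end

section \<open>Global mild solutions\<close>

lemma nn_integral_lborel_translate:
  fixes f :: "'a::euclidean_space \<Rightarrow> ennreal"
  assumes [measurable]: "f \<in> borel_measurable borel"
  shows "(\<integral>\<^sup>+x. f (x + y) \<partial>lborel) = (\<integral>\<^sup>+x. f x \<partial>lborel)"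
proof -
  have "(\<integral>\<^sup>+x. f x \<partial>lborel) = (\<integral>\<^sup>+x. f x \<partial>distr lborel borel ((+) y))"
    by (simp only: lborel_distr_plus)
  also have "\<dots> = (\<integral>\<^sup>+x. f (x + y) \<partial>lborel)"
    by (subst nn_integral_distr) (simp_all add: add.commute)
  finally show ?thesis by simp
qed

text \<open>Tonelli and the translation x \<rightarrow> x + y for each fixed
  \<open>y\<close>.\<close>

lemma nn_integral_convolution_dual:
  fixes M :: "real \<Rightarrow> 'a::euclidean_space measure"
  assumes M: "borel_kernel M"
    and [measurable]: "\<phi> \<in> borel_measurable borel" "f \<in> borel_measurable borel"
  shows "(\<integral>\<^sup>+x. \<phi> x * (\<integral>\<^sup>+y. f (x - y) \<partial>M t) \<partial>lborel) =
    (\<integral>\<^sup>+x. f x * kernel_average M \<phi> t x \<partial>lborel)"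
proof -
  have sets[measurable_cong]: "sets (M t) = sets borel" by (rule borel_kernelD(2)[OF M])
  have "(\<integral>\<^sup>+x. \<phi> x * (\<integral>\<^sup>+y. f (x - y) \<partial>M t) \<partial>lborel) =
      (\<integral>\<^sup>+x. \<integral>\<^sup>+y. \<phi> x * f (x - y) \<partial>M t \<partial>lborel)"
    by (subst nn_integral_cmult) simp_all
  also have "\<dots> = (\<integral>\<^sup>+y. \<integral>\<^sup>+x. \<phi> x * f (x - y) \<partial>lborel \<partial>M t)"
    by (rule nn_integral_kernel_swap[OF M sigma_finite_lborel]) measurable
  also have "\<dots> = (\<integral>\<^sup>+y. \<integral>\<^sup>+x. \<phi> (x + y) * f x \<partial>lborel \<partial>M t)"
  proof (rule nn_integral_cong)
    fix y
    show "(\<integral>\<^sup>+x. \<phi> x * f (x - y) \<partial>lborel) = (\<integral>\<^sup>+x. \<phi> (x + y) * f x \<partial>lborel)"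
      using nn_integral_lborel_translate[of "\<lambda>x. \<phi> x * f (x - y)" y] by simp
  qed
  also have "\<dots> = (\<integral>\<^sup>+x. \<integral>\<^sup>+y. \<phi> (x + y) * f x \<partial>M t \<partial>lborel)"
    by (rule nn_integral_kernel_swap[OF M sigma_finite_lborel, symmetric]) measurable
  also have "\<dots> = (\<integral>\<^sup>+x. f x * kernel_average M \<phi> t x \<partial>lborel)"
    unfolding kernel_average_def by (subst nn_integral_cmult[symmetric]) (simp_all add: mult.commute)
  finally show ?thesis .
qed

lemma nn_integral_convolution:
  fixes M :: "real \<Rightarrow> 'a::euclidean_space measure"
  assumes M: "borel_kernel M" and [measurable]: "f \<in> borel_measurable borel"
  shows "(\<integral>\<^sup>+x. (\<integral>\<^sup>+y. f (x - y) \<partial>M t) \<partial>lborel) =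
    emeasure (M t) UNIV * (\<integral>\<^sup>+x. f x \<partial>lborel)"
proof -
  have "(\<integral>\<^sup>+x. 1 * (\<integral>\<^sup>+y. f (x - y) \<partial>M t) \<partial>lborel) =
      (\<integral>\<^sup>+x. f x * kernel_average M (\<lambda>_. 1) t x \<partial>lborel)"
    by (rule nn_integral_convolution_dual[OF M]) measurable
  also have "\<dots> = (\<integral>\<^sup>+x. f x * emeasure (M t) UNIV \<partial>lborel)"
    unfolding kernel_average_def by (simp add: borel_kernelD(3)[OF M])
  also have "\<dots> = emeasure (M t) UNIV * (\<integral>\<^sup>+x. f x \<partial>lborel)"
    by (subst nn_integral_multc) (simp_all add: mult.commute)
  finally show ?thesis by simp
qed

lemma AE_convolution_finite:
  fixes M :: "real \<Rightarrow> 'a::euclidean_space measure"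
  assumes M: "borel_kernel M" and [measurable]: "f \<in> borel_measurable borel"
    and fin: "(\<integral>\<^sup>+x. f x \<partial>lborel) < top"
  shows "AE x in lborel. (\<integral>\<^sup>+y. f (x - y) \<partial>M t) \<noteq> top"
proof -
  have "(\<lambda>x. \<integral>\<^sup>+y. f (x - y) \<partial>M t) \<in> borel_measurable lborel"
    using measurable_nn_integral_kernel[OF M, of "\<lambda>_. t" lborel "\<lambda>x y. f (x - y)"] by simp
  moreover have "emeasure (M t) UNIV < top"
    using finite_measure.emeasure_finite[OF borel_kernelD(1)[OF M], of t UNIV] by (simp add: less_top)
  then have "(\<integral>\<^sup>+x. (\<integral>\<^sup>+y. f (x - y) \<partial>M t) \<partial>lborel) \<noteq> top"
    using fin by (simp add: nn_integral_convolution[OF M] ennreal_mult_eq_top_iff less_top)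
  ultimately show ?thesis
    using nn_integral_PInf_AE[of "\<lambda>x. \<integral>\<^sup>+y. f (x - y) \<partial>M t" lborel] by simp
qed

text \<open>\<open>measure_conv\<close> is a Bochner integral and takes a default value where the
  integrand is not integrable. The convolution of the positive part has finite integral, so it is
  finite almost everywhere; the negative part vanishes only almost everywhere, but its convolution
  has integral zero and is again null.\<close>

lemma AE_measure_conv:
  fixes M :: "real \<Rightarrow> (real ^ 'n) measure"
  assumes M: "borel_kernel M" and g: "integrable lborel g" and nonneg: "AE x in lborel. 0 \<le> g x"
  shows "AE x in lborel. 0 \<le> measure_conv (M t) g x \<and>
    ennreal (measure_conv (M t) g x) = (\<integral>\<^sup>+y. ennreal (g (x - y)) \<partial>M t)"
proof -
  have [measurable]: "g \<in> borel_measurable borel" using g by auto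
  have sets[measurable_cong]: "sets (M t) = sets borel" by (rule borel_kernelD(2)[OF M])
  have "(\<integral>\<^sup>+x. ennreal (norm (g x)) \<partial>lborel) < top"
    using g by (simp add: integrable_iff_bounded)
  then have pos: "(\<integral>\<^sup>+x. ennreal (g x) \<partial>lborel) < top"
    by (rule le_less_trans[rotated]) (intro nn_integral_mono ennreal_leI, simp)
  have "(\<integral>\<^sup>+x. ennreal (- g x) \<partial>lborel) = 0"
    using nonneg by (subst nn_integral_0_iff_AE) (auto elim!: eventually_mono simp: ennreal_neg)
  then have "(\<integral>\<^sup>+x. (\<integral>\<^sup>+y. ennreal (- g (x - y)) \<partial>M t) \<partial>lborel) = 0"
    using nn_integral_convolution[OF M, of "\<lambda>x. ennreal (- g x)" t] by simp
  moreover have "(\<lambda>x. \<integral>\<^sup>+y. ennreal (- g (x - y)) \<partial>M t) \<in> borel_measurable lborel"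
    using measurable_nn_integral_kernel[OF M, of "\<lambda>_. t" lborel "\<lambda>x y. ennreal (- g (x - y))"] by simp
  ultimately have neg: "AE x in lborel. (\<integral>\<^sup>+y. ennreal (- g (x - y)) \<partial>M t) = 0"
    by (simp add: nn_integral_0_iff_AE)
  have "AE x in lborel. (\<integral>\<^sup>+y. ennreal (g (x - y)) \<partial>M t) \<noteq> top"
    using AE_convolution_finite[OF M, of "\<lambda>x. ennreal (g x)" t] pos by simp
  with neg show ?thesis
  proof eventually_elim
    case (elim x)
    have "integrable (M t) (\<lambda>y. g (x - y))"
      unfolding real_integrable_def using elim by simp
    then have "measure_conv (M t) g x = enn2real (\<integral>\<^sup>+y. ennreal (g (x - y)) \<partial>M t)"
      unfolding measure_conv_def using elim by (simp add: real_lebesgue_integral_def)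
    with elim show ?case by (simp add: less_top)
  qed
qed

lemma AE_lborel_reflect:
  fixes t :: real
  assumes N: "N \<in> null_sets lborel"
  shows "AE s in lborel. t - s \<notin> N"
proof -
  have [measurable]: "N \<in> sets borel" using N by auto
  have "(\<integral>\<^sup>+s. indicator N (t + (- 1) * s) \<partial>lborel) = (\<integral>\<^sup>+s. indicator N s \<partial>lborel)"
    by (subst nn_integral_real_affine[where c="- 1" and t=t and f="indicator N"]) simp_all
  also have "\<dots> = 0" using N by (simp add: null_sets_def)
  finally have "AE s in lborel. indicator N (t + (- 1) * s) = (0::ennreal)"
    by (subst (asm) nn_integral_0_iff_AE) simp_all
  then show ?thesis by eventually_elim (simp add: indicator_eq_0_iff)
qed

text \<open>The situation to be refuted: infinite existence time, in the form of a mild solution on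
  every \<open>[0,T]\<close>. The results drawn from it are upper bounds for the datum.\<close>

locale global_mild_solution =
  fixes \<alpha>\<^sub>1 \<alpha>\<^sub>2 c p :: real and Z Y :: "real \<Rightarrow> (real ^ 'n) measure"
    and u\<^sub>0 :: "real ^ 'n \<Rightarrow> real" and u :: "real \<Rightarrow> real ^ 'n \<Rightarrow> real"
  assumes exponents: "0 < \<alpha>\<^sub>1" "\<alpha>\<^sub>1 < 1" "0 < \<alpha>\<^sub>2" "\<alpha>\<^sub>2 < 1" "0 < c" "1 < p"
    and Z_fam: "Z_family \<alpha>\<^sub>1 \<alpha>\<^sub>2 c Z" and Y_fam: "Y_family \<alpha>\<^sub>1 \<alpha>\<^sub>2 c Y"
    and u\<^sub>0: "integrable lborel u\<^sub>0" and u\<^sub>0_nonneg: "AE x in lborel. 0 \<le> u\<^sub>0 x"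
    and mild: "\<And>T. 0 < T \<Longrightarrow> mild_solution p Z Y u\<^sub>0 T u"
begin

text \<open>The positive part is what enters the nonlinearity. Extension by zero to negative times
  gives a function that is jointly Borel on the whole space.\<close>

definition V :: "real \<Rightarrow> real ^ 'n \<Rightarrow> real" where
  "V t x = (if 0 \<le> t then max 0 (u t x) else 0)"

lemma V_nonneg: "0 \<le> V t x"
  by (simp add: V_def)

lemma integrable_u: "0 \<le> t \<Longrightarrow> integrable lborel (u t)"
  using mild[of "t + 1"] by (auto simp: mild_solution_def in_L1_def)

text \<open>Joint measurability is given on each bounded time interval. Clamping the time to
  \<open>[0, k + 1]\<close> yields globally measurable functions that agree with \<open>V\<close> at
  any given point for large \<open>k\<close>.\<close>

lemma V_joint_measurable: "(\<lambda>(t, x). V t x) \<in> borel_measurable (borel \<Otimes>\<^sub>M borel)"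
proof (rule borel_measurable_LIMSEQ_real)
  let ?V = "\<lambda>k (t, x). if 0 \<le> t \<and> t \<le> real (Suc k) then max 0 (u (max 0 (min (real (Suc k)) t)) x) else 0"
  show "(\<lambda>k. ?V k q) \<longlonglongrightarrow> (case q of (t, x) \<Rightarrow> V t x)" for q
  proof (cases q)
    case (Pair t x)
    obtain k0 :: nat where k0: "t \<le> k0" using real_arch_simple by blast
    have "?V k q = (case q of (t, x) \<Rightarrow> V t x)" if "k \<ge> k0" for k
    proof -
      have "t \<le> real (Suc k)" using k0 that by linarith
      then show ?thesis by (simp add: Pair V_def)
    qed
    then have "\<forall>\<^sub>F k in sequentially. ?V k q = (case q of (t, x) \<Rightarrow> V t x)"
      by (auto simp: eventually_sequentially)
    then show ?thesis by (rule tendsto_eventually)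
  qed
  show "?V k \<in> borel_measurable (borel \<Otimes>\<^sub>M borel)" for k
  proof -
    let ?S = "restrict_space borel {0..real (Suc k)} :: real measure"
    have "(\<lambda>t. max 0 (min (real (Suc k)) t)) \<in> borel \<rightarrow>\<^sub>M ?S"
      by (intro measurable_restrict_space2) auto
    then have "(\<lambda>q. (max 0 (min (real (Suc k)) (fst q)), snd q)) \<in> (borel \<Otimes>\<^sub>M borel) \<rightarrow>\<^sub>M (?S \<Otimes>\<^sub>M (borel :: (real ^ 'n) measure))"
      by (intro measurable_Pair measurable_snd measurable_compose[OF measurable_fst])
    moreover have "(\<lambda>(t, x). u t x) \<in> borel_measurable (?S \<Otimes>\<^sub>M borel)"
      using mild[of "real (Suc k)"] by (simp add: mild_solution_def)
    ultimately have [measurable]: "(\<lambda>q. u (max 0 (min (real (Suc k)) (fst q))) (snd q)) \<in> borel_measurable (borel \<Otimes>\<^sub>M (borel :: (real ^ 'n) measure))"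
      using measurable_compose by fastforce
    show ?thesis
      unfolding case_prod_beta by measurable
  qed
qed

lemma V_measurable[measurable (raw)]:
  assumes [measurable]: "f \<in> borel_measurable N" "g \<in> N \<rightarrow>\<^sub>M borel"
  shows "(\<lambda>q. V (f q) (g q)) \<in> borel_measurable N"
  using measurable_compose[OF measurable_Pair[OF assms] V_joint_measurable] by simp

lemma nn_integral_V_le: "0 \<le> t \<Longrightarrow> (\<integral>\<^sup>+x. ennreal (V t x) \<partial>lborel) \<le> ennreal (L1_norm (u t))"
proof -
  assume t: "0 \<le> t"
  have "(\<integral>\<^sup>+x. ennreal (V t x) \<partial>lborel) \<le> (\<integral>\<^sup>+x. ennreal \<bar>u t x\<bar> \<partial>lborel)"
    using t by (intro nn_integral_mono ennreal_leI) (auto simp: V_def)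
  also have "\<dots> = ennreal (L1_norm (u t))"
    unfolding L1_norm_def using integrable_u[OF t]
    by (intro nn_integral_eq_integral integrable_abs) auto
  finally show ?thesis .
qed

text \<open>The L^1 norm is continuous along the solution, hence bounded on a compact time
  interval.\<close>

lemma V_bounded: "\<exists>B::real. \<forall>t\<in>{0<..T}. (\<integral>\<^sup>+x. ennreal (V t x) \<partial>lborel) \<le> ennreal B"
proof -
  let ?T = "max T 1" and ?n = "\<lambda>t. L1_norm (u t)"
  have T: "0 < ?T" by simp
  have "continuous_on {0..?T} ?n"
    unfolding continuous_on_def
  proof
    fix t assume t: "t \<in> {0..?T}"
    have lim: "((\<lambda>s. L1_norm (\<lambda>x. u s x - u t x)) \<longlongrightarrow> 0) (at t within {0..?T})"
      using mild[OF T] t by (simp add: mild_solution_def)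
    have "dist (?n s) (?n t) \<le> L1_norm (\<lambda>x. u s x - u t x)" if "s \<in> {0..?T}" for s
    proof -
      have I: "integrable lborel (u s)" "integrable lborel (u t)"
        using that t by (auto intro: integrable_u)
      have "?n s - ?n t = (\<integral>x. \<bar>u s x\<bar> - \<bar>u t x\<bar> \<partial>lborel)"
        unfolding L1_norm_def using I by (intro Bochner_Integration.integral_diff[symmetric] integrable_abs)
      then have "\<bar>?n s - ?n t\<bar> \<le> (\<integral>x. \<bar>\<bar>u s x\<bar> - \<bar>u t x\<bar>\<bar> \<partial>lborel)"
        by (simp only: integral_abs_bound)
      also have "\<dots> \<le> L1_norm (\<lambda>x. u s x - u t x)"
        unfolding L1_norm_def using I
        by (intro integral_mono integrable_abs Bochner_Integration.integrable_diff) auto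
      finally show ?thesis by (simp add: dist_real_def)
    qed
    then have "\<forall>\<^sub>F s in at t within {0..?T}. dist (?n s) (?n t) \<le> L1_norm (\<lambda>x. u s x - u t x)"
      by (auto simp: eventually_at_filter)
    then have "((\<lambda>s. dist (?n s) (?n t)) \<longlongrightarrow> 0) (at t within {0..?T})"
      by (intro tendsto_sandwich[OF _ _ tendsto_const lim]) auto
    then show "(?n \<longlongrightarrow> ?n t) (at t within {0..?T})"
      by (subst tendsto_dist_iff)
  qed
  then have "bounded (?n ` {0..?T})"
    by (intro compact_imp_bounded compact_continuous_image) auto
  then obtain B where "\<forall>y\<in>?n ` {0..?T}. norm y \<le> B"
    unfolding bounded_iff by blast
  then have B: "\<bar>?n t\<bar> \<le> B" if "t \<in> {0..?T}" for t
    using that by simp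
  show ?thesis
  proof (intro exI ballI)
    fix t assume t: "t \<in> {0<..T}"
    then have "ennreal (?n t) \<le> ennreal B" using B[of t] by (intro ennreal_leI) (auto simp: le_max_iff_disj)
    then show "(\<integral>\<^sup>+x. ennreal (V t x) \<partial>lborel) \<le> ennreal B"
      using nn_integral_V_le[of t] t by auto
  qed
qed

text \<open>Interpolation: where \<bar>u\<bar> \<le> M, the power V^p is at most M^(p-1) V, and V is
  integrable.\<close>

lemma AE_power_integrable:
  assumes t: "0 < t"
  shows "AE s in lborel. s \<in> {0<..<t} \<longrightarrow> (\<integral>\<^sup>+x. ennreal (V s x powr p) \<partial>lborel) < top"
proof -
  obtain M where "AE s in lborel. s \<in> {0<..<t} \<longrightarrow> Linf_bound (u s) M"
    using mild[OF t] by (auto simp: mild_solution_def)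
  then show ?thesis
  proof eventually_elim
    case (elim s)
    show ?case
    proof
      assume s: "s \<in> {0<..<t}"
      then have "AE x in lborel. \<bar>u s x\<bar> \<le> M" using elim by (simp add: Linf_bound_def)
      then have "AE x in lborel. ennreal (V s x powr p) \<le> ennreal (max 0 M powr (p - 1)) * ennreal (V s x)"
      proof eventually_elim
        case (elim x)
        have "V s x powr p = V s x powr (p - 1) * V s x"
          using V_nonneg[of s x] by (cases "V s x = 0") (auto simp: powr_diff)
        also have "\<dots> \<le> max 0 M powr (p - 1) * V s x"
          using elim s exponents V_nonneg[of s x] by (intro mult_right_mono powr_mono2) (auto simp: V_def)
        finally show ?case by (simp flip: ennreal_mult' add: ennreal_leI)
      qed
      then have "(\<integral>\<^sup>+x. ennreal (V s x powr p) \<partial>lborel)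
          \<le> (\<integral>\<^sup>+x. ennreal (max 0 M powr (p - 1)) * ennreal (V s x) \<partial>lborel)"
        by (rule nn_integral_mono_AE)
      also have "\<dots> = ennreal (max 0 M powr (p - 1)) * (\<integral>\<^sup>+x. ennreal (V s x) \<partial>lborel)"
        by (rule nn_integral_cmult) measurable
      also have "\<dots> \<le> ennreal (max 0 M powr (p - 1)) * ennreal (L1_norm (u s))"
        using s by (intro mult_left_mono nn_integral_V_le) auto
      also have "\<dots> < top" by (simp add: ennreal_mult_less_top)
      finally show "(\<integral>\<^sup>+x. ennreal (V s x powr p) \<partial>lborel) < top" .
    qed
  qed
qed

text \<open>The pointwise equation is multiplied by \<phi> and integrated, and the kernels are moved
  onto \<phi>. The care lies in passing from Bochner integrals to nonnegative ones and from
  \<open>Y (t - s)\<close> to its Borel version for almost every \<open>s\<close>. The result is an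
  inequality because \<open>u\<close> is bounded by its positive part.\<close>

lemma weak_duhamel:
  assumes Z': "borel_kernel Z'" "\<And>t. 0 < t \<Longrightarrow> Z' t = Z t"
    and Y': "borel_kernel Y'" "N \<in> null_sets lborel" "\<And>t. 0 < t \<Longrightarrow> t \<notin> N \<Longrightarrow> Y' t = Y t"
    and t: "0 < t" and \<phi>[measurable]: "\<phi> \<in> borel_measurable borel"
  shows "(\<integral>\<^sup>+x. ennreal (u\<^sub>0 x) * kernel_average Z' \<phi> t x \<partial>lborel) +
      (\<integral>\<^sup>+s\<in>{0<..<t}. (\<integral>\<^sup>+x. ennreal (V s x powr p) * kernel_average Y' \<phi> (t - s) x \<partial>lborel) \<partial>lborel)
      \<le> (\<integral>\<^sup>+x. \<phi> x * ennreal (V t x) \<partial>lborel)"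
proof -
  have [measurable]: "u\<^sub>0 \<in> borel_measurable borel" using u\<^sub>0 by auto
  define K where "K x s = (\<integral>\<^sup>+y. ennreal (V s (x - y) powr p) \<partial>Y' (t - s))" for x s
  have K_meas[measurable (raw)]: "(\<lambda>q. K (f q) (g q)) \<in> borel_measurable L"
    if [measurable]: "f \<in> L \<rightarrow>\<^sub>M borel" "g \<in> borel_measurable L" for f g and L :: "'z measure"
    unfolding K_def by (rule measurable_nn_integral_kernel[OF Y'(1)]) measurable
  have reflect: "AE s in lborel. t - s \<notin> N" by (rule AE_lborel_reflect[OF Y'(2)])
  have K_fin: "AE s in lborel. s \<in> {0<..<t} \<longrightarrow> (AE x in lborel. K x s \<noteq> top)"
    using AE_power_integrable[OF t]
  proof eventually_elim
    case (elim s)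
    then show ?case
      unfolding K_def using AE_convolution_finite[OF Y'(1), of "\<lambda>x. ennreal (V s x powr p)" "t - s"] by auto
  qed
  \<comment> \<open>Where \<open>K x s\<close> is infinite, both sides are the junk value 0; \<open>K_fin\<close> makes this harmless.\<close>
  have int_eq: "duhamel_integrand p Y u t x s = enn2real (K x s)" if "s \<in> {0<..<t}" "t - s \<notin> N" for x s
  proof -
    have Ys: "Y (t - s) = Y' (t - s)" using that Y'(3)[of "t - s"] by simp
    have [measurable_cong]: "sets (Y' (t - s)) = sets borel" by (rule borel_kernelD(2)[OF Y'(1)])
    have "duhamel_integrand p Y u t x s = (\<integral>y. V s (x - y) powr p \<partial>Y' (t - s))"
      using that by (simp add: duhamel_integrand_def P_op_def measure_conv_def V_def Ys)
    also have "\<dots> = enn2real (K x s)"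
      unfolding K_def by (rule integral_eq_nn_integral) auto
    finally show ?thesis .
  qed
  have "AE x in lborel. 0 \<le> measure_conv (Z' t) u\<^sub>0 x \<and>
      ennreal (measure_conv (Z' t) u\<^sub>0 x) = (\<integral>\<^sup>+y. ennreal (u\<^sub>0 (x - y)) \<partial>Z' t)"
    by (rule AE_measure_conv[OF Z'(1) u\<^sub>0 u\<^sub>0_nonneg])
  moreover have "AE x in lborel. set_integrable lebesgue {0..t} (duhamel_integrand p Y u t x) \<and>
        u t x = S_op Z t u\<^sub>0 x + (LINT s:{0..t}|lebesgue. duhamel_integrand p Y u t x s)"
    using mild[OF t] t by (simp add: mild_solution_def)
  ultimately have pointwise: "AE x in lborel. (\<integral>\<^sup>+y. ennreal (u\<^sub>0 (x - y)) \<partial>Z' t) +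
      (\<integral>\<^sup>+s\<in>{0<..<t}. ennreal (enn2real (K x s)) \<partial>lborel) \<le> ennreal (V t x)"
  proof eventually_elim
    case (elim x)
    let ?d = "duhamel_integrand p Y u t x"
    have d_nonneg: "0 \<le> ?d s" for s
      unfolding duhamel_integrand_def P_op_def measure_conv_def by (intro integral_nonneg_AE) auto
    have "(\<integral>\<^sup>+s\<in>{0<..<t}. ennreal (enn2real (K x s)) \<partial>lborel) =
        (\<integral>\<^sup>+s\<in>{0<..<t}. ennreal (enn2real (K x s)) \<partial>lebesgue)"
      by (simp add: nn_integral_completion)
    \<comment> \<open>The two integrands agree inside the open interval off the reflected null set;
      at the end points nonnegativity of the Duhamel integrand suffices.\<close>
    also have "\<dots> \<le> (\<integral>\<^sup>+s. ennreal (indicator {0..t} s * ?d s) \<partial>lebesgue)"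
      using AE_completion[OF reflect]
      by (intro nn_integral_mono_AE, eventually_elim) (auto simp: indicator_def int_eq)
    also have "\<dots> = ennreal (LINT s:{0..t}|lebesgue. ?d s)"
      using elim d_nonneg unfolding set_integrable_def set_lebesgue_integral_def
      by (subst nn_integral_eq_integral) auto
    finally have 1: "(\<integral>\<^sup>+s\<in>{0<..<t}. ennreal (enn2real (K x s)) \<partial>lborel) \<le> ennreal (LINT s:{0..t}|lebesgue. ?d s)" .
    have L: "0 \<le> (LINT s:{0..t}|lebesgue. ?d s)"
      unfolding set_lebesgue_integral_def using d_nonneg by (intro integral_nonneg_AE) auto
    have S: "S_op Z t u\<^sub>0 x = measure_conv (Z' t) u\<^sub>0 x"
      using t Z'(2)[OF t] by (simp add: S_op_def)
    have "(\<integral>\<^sup>+y. ennreal (u\<^sub>0 (x - y)) \<partial>Z' t) +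
        (\<integral>\<^sup>+s\<in>{0<..<t}. ennreal (enn2real (K x s)) \<partial>lborel) \<le>
        ennreal (measure_conv (Z' t) u\<^sub>0 x) + ennreal (LINT s:{0..t}|lebesgue. ?d s)"
      using elim(1) by (intro add_mono 1) simp
    also have "\<dots> = ennreal (measure_conv (Z' t) u\<^sub>0 x + (LINT s:{0..t}|lebesgue. ?d s))"
      using elim(1) L by (intro ennreal_plus[symmetric]) auto
    also have "measure_conv (Z' t) u\<^sub>0 x + (LINT s:{0..t}|lebesgue. ?d s) = u t x"
      using elim(2) S by simp
    also have "ennreal (u t x) \<le> ennreal (V t x)"
      using t by (intro ennreal_leI) (simp add: V_def)
    finally show ?case .
  qed
  have [measurable]: "(\<lambda>x. \<integral>\<^sup>+y. ennreal (u\<^sub>0 (x - y)) \<partial>Z' t) \<in> borel_measurable borel"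
    using measurable_nn_integral_kernel[OF Z'(1), of "\<lambda>_. t" borel "\<lambda>x y. ennreal (u\<^sub>0 (x - y))"] by simp
  have A: "(\<integral>\<^sup>+x. ennreal (u\<^sub>0 x) * kernel_average Z' \<phi> t x \<partial>lborel) =
      (\<integral>\<^sup>+x. \<phi> x * (\<integral>\<^sup>+y. ennreal (u\<^sub>0 (x - y)) \<partial>Z' t) \<partial>lborel)"
    by (rule nn_integral_convolution_dual[OF Z'(1), symmetric]) measurable
  have "(\<integral>\<^sup>+s\<in>{0<..<t}. (\<integral>\<^sup>+x. ennreal (V s x powr p) * kernel_average Y' \<phi> (t - s) x \<partial>lborel) \<partial>lborel) =
      (\<integral>\<^sup>+s\<in>{0<..<t}. (\<integral>\<^sup>+x. \<phi> x * ennreal (enn2real (K x s)) \<partial>lborel) \<partial>lborel)"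
    using K_fin
  proof (intro nn_integral_cong_AE, eventually_elim)
    case (elim s)
    have "(\<integral>\<^sup>+x. ennreal (V s x powr p) * kernel_average Y' \<phi> (t - s) x \<partial>lborel) =
        (\<integral>\<^sup>+x. \<phi> x * K x s \<partial>lborel)"
      unfolding K_def by (rule nn_integral_convolution_dual[OF Y'(1), symmetric]) measurable
    moreover have "(\<integral>\<^sup>+x. \<phi> x * K x s \<partial>lborel) = (\<integral>\<^sup>+x. \<phi> x * ennreal (enn2real (K x s)) \<partial>lborel)"
      if "s \<in> {0<..<t}"
      using elim that by (intro nn_integral_cong_AE) (auto elim!: eventually_mono simp: less_top)
    ultimately show ?case by (auto simp: indicator_def)
  qed
  also have "\<dots> = (\<integral>\<^sup>+s. \<integral>\<^sup>+x. \<phi> x * (ennreal (enn2real (K x s)) * indicator {0<..<t} s) \<partial>lborel \<partial>lborel)"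
    by (subst nn_integral_multc[symmetric]) (simp_all add: mult.assoc)
  also have "\<dots> = (\<integral>\<^sup>+x. \<integral>\<^sup>+s. \<phi> x * (ennreal (enn2real (K x s)) * indicator {0<..<t} s) \<partial>lborel \<partial>lborel)"
    by (rule lborel_pair.Fubini') measurable
  also have "\<dots> = (\<integral>\<^sup>+x. \<phi> x * (\<integral>\<^sup>+s\<in>{0<..<t}. ennreal (enn2real (K x s)) \<partial>lborel) \<partial>lborel)"
    by (subst nn_integral_cmult) simp_all
  finally have B: "(\<integral>\<^sup>+s\<in>{0<..<t}. (\<integral>\<^sup>+x. ennreal (V s x powr p) * kernel_average Y' \<phi> (t - s) x \<partial>lborel) \<partial>lborel) =
      (\<integral>\<^sup>+x. \<phi> x * (\<integral>\<^sup>+s\<in>{0<..<t}. ennreal (enn2real (K x s)) \<partial>lborel) \<partial>lborel)" .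
  have "(\<integral>\<^sup>+x. \<phi> x * (\<integral>\<^sup>+y. ennreal (u\<^sub>0 (x - y)) \<partial>Z' t) \<partial>lborel) +
      (\<integral>\<^sup>+x. \<phi> x * (\<integral>\<^sup>+s\<in>{0<..<t}. ennreal (enn2real (K x s)) \<partial>lborel) \<partial>lborel) =
      (\<integral>\<^sup>+x. \<phi> x * ((\<integral>\<^sup>+y. ennreal (u\<^sub>0 (x - y)) \<partial>Z' t) +
        (\<integral>\<^sup>+s\<in>{0<..<t}. ennreal (enn2real (K x s)) \<partial>lborel)) \<partial>lborel)"
    by (subst nn_integral_add[symmetric]) (simp_all add: distrib_left)
  also have "\<dots> \<le> (\<integral>\<^sup>+x. \<phi> x * ennreal (V t x) \<partial>lborel)"
    using pointwise by (intro nn_integral_mono_AE) (auto elim!: eventually_mono intro: mult_left_mono)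
  finally show ?thesis unfolding A B .
qed

end

section \<open>Consequences for the initial datum\<close>

context global_mild_solution
begin

lemma gauss_mean_le:
  assumes z: "0 < z" and s: "0 < s" and m: "0 < m"
    and eq: "p * m powr (p - 1) = inverse (Psi \<alpha>\<^sub>1 \<alpha>\<^sub>2 c z) + real CARD('n) / (2 * s)"
  shows "ennreal (inverse (Psi \<alpha>\<^sub>1 \<alpha>\<^sub>2 c z)) *
    (\<integral>\<^sup>+x. ennreal (u\<^sub>0 x) * ennreal (gauss s x) \<partial>lborel) \<le> ennreal ((p - 1) * m powr p)"
proof -
  obtain Z' where Z': "borel_kernel Z'" "\<And>t. 0 < t \<Longrightarrow> Z' t = Z t"
    "\<And>z \<xi>. 0 < z \<Longrightarrow> has_fourier_laplace Z' \<xi> z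
      (inverse (Psi \<alpha>\<^sub>1 \<alpha>\<^sub>2 c z) / (z * (inverse (Psi \<alpha>\<^sub>1 \<alpha>\<^sub>2 c z) + (norm \<xi>)\<^sup>2)))"
    using Z_family_kernel[OF Z_fam] by blast
  obtain Y' N where Y': "borel_kernel Y'" "N \<in> null_sets lborel"
    "\<And>t. 0 < t \<Longrightarrow> t \<notin> N \<Longrightarrow> Y' t = Y t"
    "\<And>z \<xi>. 0 < z \<Longrightarrow> has_fourier_laplace Y' \<xi> z (1 / (inverse (Psi \<alpha>\<^sub>1 \<alpha>\<^sub>2 c z) + (norm \<xi>)\<^sup>2))"
    using Y_family_kernel[OF Y_fam] by blast
  interpret S: global_supersolution p "\<lambda>z. inverse (Psi \<alpha>\<^sub>1 \<alpha>\<^sub>2 c z)" Z' Y' "\<lambda>x. ennreal (u\<^sub>0 x)" V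
  proof
    show "0 < inverse (Psi \<alpha>\<^sub>1 \<alpha>\<^sub>2 c z)" if "0 < z" for z
      using that by (simp add: inverse_Psi)
    show "(\<lambda>x. ennreal (u\<^sub>0 x)) \<in> borel_measurable borel"
      using borel_measurable_integrable[OF u\<^sub>0] by simp
    show "\<exists>B::real. \<forall>t\<in>{0<..T}. (\<integral>\<^sup>+x. ennreal (V t x) \<partial>lborel) \<le> ennreal B" for T
      by (rule V_bounded)
  qed (use exponents Z' Y' V_nonneg V_joint_measurable weak_duhamel inverse_Psi_bounds in \<open>simp_all\<close>)
  show ?thesis
    by (rule S.gauss_mean_le[OF s refl z m eq])
qed

text \<open>What remains once all powers of \<open>l\<close> are collected at s = 1/l: the Gaussian
  normalization, and (p - 1) m^p for the tangent point m = ((1 + n/2) l / p)^(1/(p-1)).\<close>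

definition growth_const :: real where
  "growth_const = (4 * pi) powr (real CARD('n) / 2) * (p - 1) *
    ((1 + real CARD('n) / 2) / p) powr (p / (p - 1))"

text \<open>At s = 1/l the sum l + n/(2 s) equals (1 + n/2) l, so both sides are pure powers of
  \<open>l\<close>. The exponent is 1/(p - 1) - n/2: positive exactly below the critical power 1 +
  2/n and zero at it.\<close>

lemma exp_mean_le:
  assumes z: "0 < z"
  defines "l \<equiv> inverse (Psi \<alpha>\<^sub>1 \<alpha>\<^sub>2 c z)"
  shows "(\<integral>\<^sup>+x. ennreal (u\<^sub>0 x) * ennreal (exp (- l * (norm x)\<^sup>2 / 4)) \<partial>lborel)
    \<le> ennreal (growth_const * l powr (p / (p - 1) - 1 - real CARD('n) / 2))"
proof -
  let ?k = "real CARD('n) / 2"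
  have l: "0 < l" using z by (simp add: l_def inverse_Psi)
  have p: "1 < p" by (rule exponents)
  define m where "m = ((1 + ?k) * l / p) powr (1 / (p - 1))"
  have pos: "0 < (1 + ?k) * l / p" using l p by (simp add: add_pos_nonneg)
  then have m: "0 < m"
    unfolding m_def by (metis less_irrefl powr_gt_zero)
  have mp1: "m powr (p - 1) = (1 + ?k) * l / p"
  proof -
    have e: "1 / (p - 1) * (p - 1) = 1" using p by simp
    show ?thesis by (simp only: m_def powr_powr e powr_one[OF less_imp_le[OF pos]])
  qed
  have mp: "m powr p = ((1 + ?k) / p) powr (p / (p - 1)) * l powr (p / (p - 1))"
  proof -
    have "m powr p = ((1 + ?k) / p * l) powr (p / (p - 1))"
      by (simp add: m_def powr_powr)
    then show ?thesis by (simp only: powr_mult)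
  qed
  have "p * m powr (p - 1) = l + real CARD('n) / (2 * (1 / l))"
    unfolding mp1 using p l by (simp add: field_simps)
  then have le: "ennreal l * (\<integral>\<^sup>+x. ennreal (u\<^sub>0 x) * ennreal (gauss (1 / l) x) \<partial>lborel) \<le> ennreal ((p - 1) * m powr p)"
    unfolding l_def using l by (intro gauss_mean_le z m) (simp_all add: l_def)
  have [measurable]: "u\<^sub>0 \<in> borel_measurable borel" using u\<^sub>0 by auto
  let ?I = "\<integral>\<^sup>+x. ennreal (u\<^sub>0 x) * ennreal (exp (- l * (norm x)\<^sup>2 / 4)) \<partial>lborel"
  have "gauss (1 / l) x = (4 * pi) powr (- ?k) * l powr ?k * exp (- l * (norm x)\<^sup>2 / 4)" for x :: "real ^ 'n"
    using l by (simp add: gauss_def powr_divide powr_minus field_simps)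
  then have "(\<integral>\<^sup>+x. ennreal (u\<^sub>0 x) * ennreal (gauss (1 / l) x) \<partial>lborel) =
      (\<integral>\<^sup>+x. ennreal ((4 * pi) powr (- ?k) * l powr ?k) * (ennreal (u\<^sub>0 x) * ennreal (exp (- l * (norm x)\<^sup>2 / 4))) \<partial>lborel)"
    by (simp add: ennreal_mult' mult_ac)
  also have "\<dots> = ennreal ((4 * pi) powr (- ?k) * l powr ?k) * ?I"
    by (rule nn_integral_cmult) measurable
  finally have le': "ennreal l * (ennreal ((4 * pi) powr (- ?k) * l powr ?k) * ?I) \<le> ennreal ((p - 1) * m powr p)"
    using le by simp
  \<comment> \<open>The reciprocal of the factor in front of \<open>?I\<close> in the preceding
    inequality.\<close>
  define d where "d = (4 * pi) powr ?k * l powr (- (1 + ?k))"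
  have d: "0 \<le> d" by (simp add: d_def)
  have "d * (l * ((4 * pi) powr (- ?k) * l powr ?k)) = 1"
  proof -
    have "l powr (- (1 + ?k)) * (l * l powr ?k) = 1" "(4 * pi) powr ?k * (4 * pi) powr (- ?k) = 1"
      using l by (simp_all only: powr_minus powr_add) (simp_all add: field_simps)
    moreover have "d * (l * ((4 * pi) powr (- ?k) * l powr ?k)) =
        (l powr (- (1 + ?k)) * (l * l powr ?k)) * ((4 * pi) powr ?k * (4 * pi) powr (- ?k))"
      unfolding d_def by (simp only: mult_ac)
    ultimately show ?thesis by simp
  qed
  then have "?I = ennreal d * (ennreal l * (ennreal ((4 * pi) powr (- ?k) * l powr ?k) * ?I))"
    using d l by (simp add: mult.assoc[symmetric] ennreal_mult'[symmetric])
  also have "\<dots> \<le> ennreal d * ennreal ((p - 1) * m powr p)"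
    by (intro mult_left_mono le') simp
  also have "\<dots> = ennreal (d * ((p - 1) * m powr p))"
    using d by (rule ennreal_mult'[symmetric])
  also have "d * ((p - 1) * m powr p) = growth_const * l powr (p / (p - 1) - 1 - ?k)"
  proof -
    have "l powr (- (1 + ?k)) * l powr (p / (p - 1)) = l powr (p / (p - 1) - 1 - ?k)"
      by (simp flip: powr_add add: algebra_simps)
    then show ?thesis
      unfolding growth_const_def d_def mp by (simp add: mult_ac)
  qed
  finally show ?thesis .
qed

lemma nn_integral_u\<^sub>0: "(\<integral>\<^sup>+x. ennreal (u\<^sub>0 x) \<partial>lborel) = ennreal (L1_norm u\<^sub>0)"
proof -
  have "(\<integral>\<^sup>+x. ennreal (u\<^sub>0 x) \<partial>lborel) = (\<integral>\<^sup>+x. ennreal \<bar>u\<^sub>0 x\<bar> \<partial>lborel)"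
    using u\<^sub>0_nonneg by (intro nn_integral_cong_AE) (auto elim!: eventually_mono)
  also have "\<dots> = ennreal (L1_norm u\<^sub>0)"
    unfolding L1_norm_def using u\<^sub>0 by (intro nn_integral_eq_integral integrable_abs) auto
  finally show ?thesis .
qed

text \<open>Fatou's lemma along z = 1/(j + 1): then \<open>l\<close> tends to 0 and the exponential
  weight to 1. The limit is kept as a parameter, so that the subcritical and critical cases differ
  only in its value.\<close>

lemma L1_norm_le_limit:
  assumes lim: "((\<lambda>l. growth_const * l powr (p / (p - 1) - 1 - real CARD('n) / 2)) \<longlongrightarrow> b) (at_right 0)"
  shows "L1_norm u\<^sub>0 \<le> b"
proof -
  let ?l = "\<lambda>z. inverse (Psi \<alpha>\<^sub>1 \<alpha>\<^sub>2 c z)" and ?z = "\<lambda>j. inverse (real (Suc j))"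
  let ?f = "\<lambda>l. growth_const * l powr (p / (p - 1) - 1 - real CARD('n) / 2)"
  have [measurable]: "u\<^sub>0 \<in> borel_measurable borel" using u\<^sub>0 by auto
  have z: "filterlim ?z (at_right 0) sequentially"
    using LIMSEQ_inverse_real_of_nat by (auto simp: filterlim_at)
  have l0: "(\<lambda>j. ?l (?z j)) \<longlonglongrightarrow> 0"
    using inverse_Psi_tendsto_0[OF exponents(1-5)] z by (rule filterlim_compose)
  then have "filterlim (\<lambda>j. ?l (?z j)) (at_right 0) sequentially"
    by (auto simp: filterlim_at inverse_Psi)
  with lim have lim': "(\<lambda>j. ?f (?l (?z j))) \<longlonglongrightarrow> b"
    by (rule filterlim_compose)
  have pw: "(\<lambda>j. ennreal (u\<^sub>0 x) * ennreal (exp (- ?l (?z j) * (norm x)\<^sup>2 / 4))) \<longlonglongrightarrow> ennreal (u\<^sub>0 x)" for x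
  proof -
    have "(\<lambda>j. exp (- ?l (?z j) * (norm x)\<^sup>2 / 4)) \<longlonglongrightarrow> exp (- 0 * (norm x)\<^sup>2 / 4)"
      using l0 by (intro tendsto_intros) auto
    then have "(\<lambda>j. ennreal (u\<^sub>0 x * exp (- ?l (?z j) * (norm x)\<^sup>2 / 4))) \<longlonglongrightarrow> ennreal (u\<^sub>0 x * 1)"
      by (intro tendsto_ennrealI tendsto_mult_left) simp
    then show ?thesis by (simp add: ennreal_mult'')
  qed
  have "ennreal (L1_norm u\<^sub>0) = (\<integral>\<^sup>+x. liminf (\<lambda>j. ennreal (u\<^sub>0 x) * ennreal (exp (- ?l (?z j) * (norm x)\<^sup>2 / 4))) \<partial>lborel)"
    using lim_imp_Liminf[OF trivial_limit_sequentially pw] by (simp add: nn_integral_u\<^sub>0)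
  also have "\<dots> \<le> liminf (\<lambda>j. \<integral>\<^sup>+x. ennreal (u\<^sub>0 x) * ennreal (exp (- ?l (?z j) * (norm x)\<^sup>2 / 4)) \<partial>lborel)"
    by (rule nn_integral_liminf) measurable
  also have "\<dots> \<le> liminf (\<lambda>j. ennreal (?f (?l (?z j))))"
    by (intro Liminf_mono always_eventually allI exp_mean_le) simp
  also have "\<dots> = ennreal b"
    by (intro lim_imp_Liminf tendsto_ennrealI lim') simp
  finally have le: "ennreal (L1_norm u\<^sub>0) \<le> ennreal b" .
  have "0 \<le> b"
    by (rule tendsto_lowerbound[OF lim']) (use exponents in \<open>auto simp: growth_const_def\<close>)
  then show ?thesis using le by simp
qed

lemma subcritical_zero:
  assumes "p < 1 + 2 / real CARD('n)"
  shows "AE x in lborel. u\<^sub>0 x = 0"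
proof -
  let ?n = "real CARD('n)"
  let ?e = "p / (p - 1) - 1 - ?n / 2"
  have n: "0 < ?n" by simp
  have p: "0 < p - 1" using exponents by simp
  have "p / (p - 1) - 1 = 1 / (p - 1)" using p by (simp add: field_simps)
  moreover have "(p - 1) * ?n < 2"
    using assms n by (simp add: pos_less_divide_eq[symmetric])
  then have "?n / 2 < 1 / (p - 1)"
    using p by (simp add: pos_less_divide_eq mult.commute)
  ultimately have e: "0 < ?e" by simp
  have "\<forall>\<^sub>F l::real in at_right 0. 0 \<le> l"
    using eventually_at_right_less[of "0::real"] by eventually_elim simp
  then have "((\<lambda>l. l powr ?e) \<longlongrightarrow> 0 powr ?e) (at_right 0)"
    using e by (intro tendsto_powr' tendsto_const tendsto_ident_at) auto
  then have "((\<lambda>l. growth_const * l powr ?e) \<longlongrightarrow> growth_const * 0 powr ?e) (at_right 0)"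
    by (rule tendsto_mult_left)
  then have "L1_norm u\<^sub>0 \<le> 0"
    using L1_norm_le_limit[of 0] by simp
  then have "(\<integral>\<^sup>+x. ennreal (u\<^sub>0 x) \<partial>lborel) = 0"
    by (simp add: nn_integral_u\<^sub>0 ennreal_neg)
  then have "AE x in lborel. ennreal (u\<^sub>0 x) = 0"
    using u\<^sub>0 by (subst (asm) nn_integral_0_iff_AE) auto
  with u\<^sub>0_nonneg show ?thesis
    by eventually_elim (simp add: ennreal_eq_0_iff)
qed

text \<open>The exponent of \<open>l\<close> vanishes and the bound is \<open>growth_const\<close>
  itself. With k = n/2 one has p = 1 + 1/k, p/(p - 1) = 1 + k and (1 + k)/p = k, so the constant
  collapses to (4 \<pi> k)^k = (2 \<pi> n)^(n/2), which lies below the threshold (4 \<pi>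
  n)^(n/2).\<close>

lemma critical_mass_le:
  assumes p_eq: "p = 1 + 2 / real CARD('n)"
  shows "L1_norm u\<^sub>0 \<le> (2 * pi * real CARD('n)) powr (real CARD('n) / 2)"
proof (rule L1_norm_le_limit)
  define k where "k = real CARD('n) / 2"
  have k: "0 < k" by (simp add: k_def)
  have p: "p = 1 + 1 / k" using p_eq by (simp add: k_def)
  have e: "p / (p - 1) = 1 + k" and b: "(1 + k) / p = k"
    using k by (simp_all add: p field_simps)
  have "growth_const = (4 * pi) powr k * ((p - 1) * k powr (1 + k))"
    unfolding growth_const_def k_def[symmetric] e b by simp
  also have "(p - 1) * k powr (1 + k) = k powr k"
    using k by (simp add: p powr_add)
  also have "(4 * pi) powr k * k powr k = (4 * pi * k) powr k"
    by (simp add: powr_mult)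
  finally have g: "growth_const = (2 * pi * real CARD('n)) powr k"
    by (simp add: k_def mult_ac)
  have "\<forall>\<^sub>F l::real in at_right 0. growth_const * l powr (p / (p - 1) - 1 - k) = growth_const"
    using eventually_at_right_less[of "0::real"] by eventually_elim (simp add: e)
  then show "((\<lambda>l. growth_const * l powr (p / (p - 1) - 1 - real CARD('n) / 2)) \<longlongrightarrow>
      (2 * pi * real CARD('n)) powr (real CARD('n) / 2)) (at_right 0)"
    unfolding k_def[symmetric] g[symmetric] by (rule tendsto_eventually)
qed

end

section \<open>Blow-up in the three cases\<close>

theorem corollary4p4:
  fixes \<alpha>\<^sub>1 \<alpha>\<^sub>2 c p :: real
    and Z Y :: "real \<Rightarrow> (real ^ 'n) measure"
  assumes "0 < \<alpha>\<^sub>1" "\<alpha>\<^sub>1 < 1" "0 < \<alpha>\<^sub>2" "\<alpha>\<^sub>2 < 1" "0 < c" "1 < p"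
    and "bernstein_function (\<lambda>s. inverse (Psi \<alpha>\<^sub>1 \<alpha>\<^sub>2 c s))"
    and "Z_family \<alpha>\<^sub>1 \<alpha>\<^sub>2 c Z"
    and "Y_family \<alpha>\<^sub>1 \<alpha>\<^sub>2 c Y"
  shows
    "(\<forall>u\<^sub>0 Tmax u.
        in_X u\<^sub>0 \<and> (AE x in lborel. 0 \<le> u\<^sub>0 x) \<and> \<not> (AE x in lborel. u\<^sub>0 x = 0) \<and>
        nonneg_maximal_mild_solution p Z Y u\<^sub>0 Tmax u \<longrightarrow>
          (p < 1 + 2 / real CARD('n) \<longrightarrow> Tmax < \<infinity>) \<and>
          (p = 1 + 2 / real CARD('n) \<and>
           L1_norm u\<^sub>0 > (4 * pi * real CARD('n)) powr (real CARD('n) / 2) \<longrightarrow> Tmax < \<infinity>)) \<and>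
     (\<forall>\<phi>. in_X \<phi> \<and> (AE x in lborel. 0 \<le> \<phi> x) \<and> \<not> (AE x in lborel. \<phi> x = 0) \<longrightarrow>
        (\<exists>A\<^sub>0>0. \<forall>A\<ge>A\<^sub>0. \<forall>Tmax u.
           nonneg_maximal_mild_solution p Z Y (\<lambda>x. A * \<phi> x) Tmax u \<longrightarrow> Tmax < \<infinity>))"
proof (intro conjI allI impI)
  have global: "global_mild_solution \<alpha>\<^sub>1 \<alpha>\<^sub>2 c p Z Y u\<^sub>0 u"
    if "in_X u\<^sub>0" "AE x in lborel. 0 \<le> u\<^sub>0 x" "nonneg_maximal_mild_solution p Z Y u\<^sub>0 Tmax u" "\<not> Tmax < \<infinity>"
    for u\<^sub>0 :: "real ^ 'n \<Rightarrow> real" and Tmax u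
    using that assms
    by unfold_locales (auto simp: in_X_def in_L1_def nonneg_maximal_mild_solution_def)
  fix u\<^sub>0 :: "real ^ 'n \<Rightarrow> real" and Tmax u
  assume *: "in_X u\<^sub>0 \<and> (AE x in lborel. 0 \<le> u\<^sub>0 x) \<and> \<not> (AE x in lborel. u\<^sub>0 x = 0) \<and>
    nonneg_maximal_mild_solution p Z Y u\<^sub>0 Tmax u"
  show "Tmax < \<infinity>" if "p < 1 + 2 / real CARD('n)"
    using global_mild_solution.subcritical_zero[OF global that] * by blast
  show "Tmax < \<infinity>" if h: "p = 1 + 2 / real CARD('n) \<and>
      L1_norm u\<^sub>0 > (4 * pi * real CARD('n)) powr (real CARD('n) / 2)"
  proof (rule ccontr)
    assume "\<not> Tmax < \<infinity>"
    then have "L1_norm u\<^sub>0 \<le> (2 * pi * real CARD('n)) powr (real CARD('n) / 2)"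
      using global_mild_solution.critical_mass_le[OF global] * h by blast
    also have "\<dots> \<le> (4 * pi * real CARD('n)) powr (real CARD('n) / 2)"
      by (intro powr_mono2) auto
    finally show False using h by simp
  qed
next
  fix \<phi> :: "real ^ 'n \<Rightarrow> real"
  assume \<phi>: "in_X \<phi> \<and> (AE x in lborel. 0 \<le> \<phi> x) \<and> \<not> (AE x in lborel. \<phi> x = 0)"
  then have [measurable]: "\<phi> \<in> borel_measurable borel"
    by (auto simp: in_X_def in_L1_def)
  \<comment> \<open>The tangent point for z = s = 1, where the inverse of \<Psi> equals 1 and the
    Gaussian rate is n/2.\<close>
  define m where "m = ((1 + real CARD('n) / 2) / p) powr (1 / (p - 1))"
  have pos: "0 < (1 + real CARD('n) / 2) / p" using assms by (simp add: add_pos_nonneg)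
  have m: "0 < m" "p * m powr (p - 1) = 1 + real CARD('n) / 2"
    using pos assms by (auto simp: m_def powr_powr)
  let ?b = "(p - 1) * m powr p"
  let ?I = "\<integral>\<^sup>+x. ennreal (\<phi> x) * ennreal (gauss 1 x) \<partial>lborel"
  have "?I \<noteq> 0"
  proof
    assume "?I = 0"
    then have "AE x in lborel. ennreal (\<phi> x) * ennreal (gauss 1 x) = 0"
      by (subst (asm) nn_integral_0_iff_AE) auto
    moreover have "AE x in lborel. 0 \<le> \<phi> x" using \<phi> by simp
    ultimately have "AE x in lborel. \<phi> x = 0"
    proof eventually_elim
      case (elim x)
      then show ?case using gauss_pos[of 1 x] by (auto simp: ennreal_eq_0_iff not_le)
    qed
    then show False using \<phi> by blast
  qed
  \<comment> \<open>A positive real lower bound for the Gaussian mean is enough, so an infinite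
    value needs no exclusion.\<close>
  then obtain a where a: "0 < a" "ennreal a \<le> ?I"
  proof (cases ?I)
    case (real r)
    with \<open>?I \<noteq> 0\<close> show thesis by (intro that[of r]) (auto simp: less_le)
  next
    case top
    then show thesis by (intro that[of 1]) auto
  qed
  show "\<exists>A\<^sub>0>0. \<forall>A\<ge>A\<^sub>0. \<forall>Tmax u.
    nonneg_maximal_mild_solution p Z Y (\<lambda>x. A * \<phi> x) Tmax u \<longrightarrow> Tmax < \<infinity>"
  \<comment> \<open>The mean of the datum scales linearly in \<open>A\<close> while the bound
    \<open>?b\<close> is fixed; this threshold gives A a \<ge> b + a > b.\<close>
  proof (intro exI[of _ "?b / a + 1"] conjI allI impI)
    show "0 < ?b / a + 1" using a(1) assms by (simp add: add_nonneg_pos)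
    fix A Tmax u
    assume A: "?b / a + 1 \<le> A" and u: "nonneg_maximal_mild_solution p Z Y (\<lambda>x. A * \<phi> x) Tmax u"
    have A0: "0 < A" using A \<open>0 < ?b / a + 1\<close> by linarith
    show "Tmax < \<infinity>"
    proof (rule ccontr)
      assume "\<not> Tmax < \<infinity>"
      then interpret g: global_mild_solution \<alpha>\<^sub>1 \<alpha>\<^sub>2 c p Z Y "\<lambda>x. A * \<phi> x" u
        using u assms \<phi> A0
        by unfold_locales (auto simp: in_X_def in_L1_def nonneg_maximal_mild_solution_def elim!: eventually_mono)
      have "ennreal (inverse (Psi \<alpha>\<^sub>1 \<alpha>\<^sub>2 c 1)) *
          (\<integral>\<^sup>+x. ennreal (A * \<phi> x) * ennreal (gauss 1 x) \<partial>lborel) \<le> ennreal ?b"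
        by (rule g.gauss_mean_le) (use m in \<open>auto simp: inverse_Psi\<close>)
      also have "(\<integral>\<^sup>+x. ennreal (A * \<phi> x) * ennreal (gauss 1 x) \<partial>lborel) = ennreal A * ?I"
        using A0 by (subst nn_integral_cmult[symmetric]) (auto simp: ennreal_mult' mult.assoc)
      finally have "ennreal A * ?I \<le> ennreal ?b" by (simp add: inverse_Psi)
      moreover have "ennreal (A * a) \<le> ennreal A * ?I"
        using A0 a by (simp add: ennreal_mult' mult_left_mono)
      ultimately have "ennreal (A * a) \<le> ennreal ?b" by (rule order_trans[rotated])
      moreover have "0 \<le> ?b" using assms by simp
      ultimately have "A * a \<le> ?b" by simp
      moreover have "?b < A * a" using A a(1) by (simp add: field_simps)
      ultimately show False by simp
    qed
  qed
qed

end
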